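(* Let $a$ be a self-adjoint Hilbert-Schmidt operator on $H$, and let $$\mathfrak S_a=\{UaU^* : U\in \mathsf{U}\mathsf{B}(H)\}$$ be its orbit under the full unitary group $\mathsf{U}\mathsf{B}(H)$ of $\mathsf{B}(H)$. Then the set $\mathfrak S_a\subset\mathsf{HS}^h$ can be given an analytic submanifold structure (as a submanifold of $\mathsf{HS}^h$) if and only if the $C^*$-algebra generated by $a$ and $1$ is finite dimensional.
   Context: $H$ is a complex separable Hilbert space, $\mathsf{B}(H)$ the bounded operators on $H$, $\mathsf{U}\mathsf{B}(H)$ the group of all unitary operators on $H$, and $1$ the identity operator. $\mathsf{HS}\subset\mathsf{B}(H)$ is the ideal of Hilbert-Schmidt operators with norm $\|x\|_2=2\,\mathrm{tr}(x^*x)^{1/2}$, and $\mathsf{HS}^h$ is the closed real subspace of self-adjoint Hilbert-Schmidt operators, a real Hilbert space with inner product $\langle x,y\rangle_2=4\,\mathrm{tr}(yx)$. Analytic means real analytic. "Submanifold" is understood in the standard (Lang) sense of an embedded submanifold; in particular a submanifold $M$ of $\mathsf{HS}^h$ is locally closed: every point of $M$ has an open neighborhood $U$ in $\mathsf{HS}^h$ such that $M\cap U$ is closed in $U$. *)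

theory Defs
  imports "HOL-Analysis.Analysis"
begin

section \<open>Complex Hilbert spaces\<close>

class complex_vector = real_vector +
  fixes scaleC :: "complex \<Rightarrow> 'a \<Rightarrow> 'a" (infixr \<open>*\<^sub>C\<close> 75)
  assumes scaleC_add_right: "c *\<^sub>C (x + y) = c *\<^sub>C x + c *\<^sub>C y"
    and scaleC_add_left: "(c + d) *\<^sub>C x = c *\<^sub>C x + d *\<^sub>C x"
    and scaleC_scaleC: "c *\<^sub>C d *\<^sub>C x = (c * d) *\<^sub>C x"
    and scaleC_one [simp]: "1 *\<^sub>C x = x"
    and scaleR_eq_scaleC: "r *\<^sub>R x = complex_of_real r *\<^sub>C x"

global_interpretation complex_vector: vector_space "scaleC :: complex \<Rightarrow> 'a \<Rightarrow> 'a::complex_vector"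
  by unfold_locales (simp_all add: scaleC_add_right scaleC_add_left scaleC_scaleC)

text \<open>The inner product is linear in its second argument; its real part is the
  inner product of \<^class>\<open>real_inner\<close>, so that the norm is the Hilbert norm.\<close>

class complex_inner = complex_vector + real_inner +
  fixes cinner :: "'a \<Rightarrow> 'a \<Rightarrow> complex"
  assumes cinner_add_right: "cinner x (y + z) = cinner x y + cinner x z"
    and cinner_scaleC_right: "cinner x (c *\<^sub>C y) = c * cinner x y"
    and cinner_commute: "cinner x y = cnj (cinner y x)"
    and inner_eq_Re_cinner: "inner x y = Re (cinner x y)"

class complex_hilbert_space = complex_inner + complete_space

instance complex_hilbert_space \<subseteq> banach ..

lemma cinner_add_left: "cinner (x + y) z = cinner x z + cinner y z"
  by (metis cinner_add_right cinner_commute complex_cnj_add)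

lemma cinner_scaleC_left: "cinner (c *\<^sub>C x) z = cnj c * cinner x z"
  by (metis cinner_scaleC_right cinner_commute complex_cnj_mult)

lemma cinner_self: "cinner x x = complex_of_real ((norm x)\<^sup>2)"
proof -
  have "Im (cinner x x) = 0"
    using arg_cong[OF cinner_commute[of x x], of Im] by simp
  then show ?thesis
    by (simp add: complex_eq_iff inner_eq_Re_cinner[symmetric] power2_norm_eq_inner)
qed

lemma Im_cinner: "Im (cinner x y) = inner (\<i> *\<^sub>C x) y"
  by (simp add: inner_eq_Re_cinner cinner_scaleC_left)

lemma norm_scaleC: "norm (c *\<^sub>C x) = cmod c * norm (x::'a::complex_inner)"
proof -
  have "complex_of_real ((norm (c *\<^sub>C x))\<^sup>2) = cnj c * c * complex_of_real ((norm x)\<^sup>2)"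
    using cinner_self[of "c *\<^sub>C x"] cinner_self[of x]
    by (simp add: cinner_scaleC_left cinner_scaleC_right mult_ac)
  also have "\<dots> = complex_of_real ((cmod c * norm x)\<^sup>2)"
    using complex_norm_square[of c] by (simp add: power_mult_distrib mult.commute)
  finally have "(norm (c *\<^sub>C x))\<^sup>2 = (cmod c * norm x)\<^sup>2"
    using of_real_eq_iff by blast
  then show ?thesis
    by (simp add: power2_eq_iff_nonneg)
qed

lemma norm_cinner_le: "cmod (cinner x y) \<le> norm x * norm y"
proof (cases "cinner x y = 0")
  case False
  define c where "c = cnj (sgn (cinner x y))"
  have "cmod (cinner x y) = Re (c * cinner x y)"
    using False unfolding c_def
    by (simp add: sgn_eq cmod_def power2_eq_square[symmetric] field_simps)
       (simp add: add_divide_distrib[symmetric] real_div_sqrt)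
  also have "\<dots> = inner x (c *\<^sub>C y)"
    by (simp add: inner_eq_Re_cinner cinner_scaleC_right)
  also have "\<dots> \<le> norm x * norm (c *\<^sub>C y)"
    by (rule norm_cauchy_schwarz)
  also have "norm (c *\<^sub>C y) = norm y"
    using False by (simp add: norm_scaleC c_def norm_sgn)
  finally show ?thesis .
qed simp

lemma bounded_bilinear_cinner: "bounded_bilinear (cinner :: 'a::complex_inner \<Rightarrow> 'a \<Rightarrow> complex)"
  by standard
    (auto simp: cinner_add_left cinner_add_right scaleR_eq_scaleC cinner_scaleC_left
      cinner_scaleC_right scaleR_conv_of_real intro!: exI[of _ 1] norm_cinner_le)

interpretation cinner: bounded_bilinear "cinner :: 'a::complex_inner \<Rightarrow> 'a \<Rightarrow> complex"
  by (rule bounded_bilinear_cinner)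

lemma bounded_linear_scaleC: "bounded_linear (\<lambda>x::'a::complex_inner. c *\<^sub>C x)"
  by (rule bounded_linear_intro[where K = "cmod c"])
     (simp_all add: scaleC_add_right scaleR_eq_scaleC scaleC_scaleC mult.commute norm_scaleC)

lemma nearest_point_closed_subspace:
  fixes S :: "'a::{real_inner, complete_space} set"
  assumes S: "subspace S" "closed S"
  shows "\<exists>p\<in>S. \<forall>s\<in>S. norm (v - p) \<le> norm (v - s)"
proof -
  define d where "d = Inf ((\<lambda>s. (norm (v - s))\<^sup>2) ` S)"
  have ne: "(\<lambda>s. (norm (v - s))\<^sup>2) ` S \<noteq> {}"
    using subspace_0[OF S(1)] by auto
  have bdd: "bdd_below ((\<lambda>s. (norm (v - s))\<^sup>2) ` S)"
    by (rule bdd_belowI[of _ 0]) auto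
  have dle: "d \<le> (norm (v - s))\<^sup>2" if "s \<in> S" for s
    unfolding d_def using that bdd by (auto intro: cInf_lower)
  have "\<exists>s\<in>S. (norm (v - s))\<^sup>2 < d + 1 / real (Suc n)" for n
  proof -
    have "\<exists>y\<in>(\<lambda>s. (norm (v - s))\<^sup>2) ` S. y < d + 1 / real (Suc n)"
      unfolding d_def by (rule cInf_lessD[OF ne]) simp
    then show ?thesis by auto
  qed
  then obtain f where f: "\<And>n. f n \<in> S" "\<And>n. (norm (v - f n))\<^sup>2 < d + 1 / real (Suc n)"
    by metis
  have par: "(norm (f m - f n))\<^sup>2 \<le> 2 / real (Suc m) + 2 / real (Suc n)" for m n
  proof -
    have mid: "(1/2) *\<^sub>R (f m + f n) \<in> S"
      using f(1) S(1) by (intro subspace_scale subspace_add) auto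
    have "(norm (f m - f n))\<^sup>2 = 2 * (norm (v - f m))\<^sup>2 + 2 * (norm (v - f n))\<^sup>2
        - 4 * (norm (v - (1/2) *\<^sub>R (f m + f n)))\<^sup>2"
      by (simp add: power2_norm_eq_inner algebra_simps inner_commute)
    with dle[OF mid] f(2)[of m] f(2)[of n] show ?thesis by simp
  qed
  have "Cauchy f"
  proof (rule metric_CauchyI)
    fix e :: real assume e: "e > 0"
    obtain N where N: "real N > 4 / e\<^sup>2" using reals_Archimedean2 by blast
    have "dist (f m) (f n) < e" if "m \<ge> N" "n \<ge> N" for m n
    proof -
      have q: "2 / real (Suc k) < e\<^sup>2 / 2" if "k \<ge> N" for k
      proof -
        have "4 / e\<^sup>2 < real (Suc k)" using N that by linarith
        then have "4 < real (Suc k) * e\<^sup>2" using e by (simp add: pos_divide_less_eq)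
        then show ?thesis
          by (simp add: pos_divide_less_eq mult.commute del: of_nat_Suc)
      qed
      have "(norm (f m - f n))\<^sup>2 < e\<^sup>2"
        using par[of m n] q[OF that(1)] q[OF that(2)] by linarith
      then show ?thesis using e by (simp add: dist_norm power2_less_imp_less)
    qed
    then show "\<exists>M. \<forall>m\<ge>M. \<forall>n\<ge>M. dist (f m) (f n) < e" by blast
  qed
  then obtain p where p: "f \<longlonglongrightarrow> p" using Cauchy_convergent convergent_def by blast
  have pS: "p \<in> S" using closed_sequentially[OF S(2)] f(1) p by blast
  have "(norm (v - p))\<^sup>2 \<le> d"
  proof (rule LIMSEQ_le)
    show "(\<lambda>n. (norm (v - f n))\<^sup>2) \<longlonglongrightarrow> (norm (v - p))\<^sup>2"
      by (intro tendsto_intros p)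
    have "(\<lambda>n. d + 1 / real (Suc n)) \<longlonglongrightarrow> d + 0"
      by (intro tendsto_intros LIMSEQ_Suc lim_1_over_n)
    then show "(\<lambda>n. d + 1 / real (Suc n)) \<longlonglongrightarrow> d" by simp
    show "\<exists>N. \<forall>n\<ge>N. (norm (v - f n))\<^sup>2 \<le> d + 1 / real (Suc n)"
      using f(2) less_imp_le by blast
  qed
  then have "norm (v - p) \<le> norm (v - s)" if "s \<in> S" for s
    using power2_le_imp_le[OF order_trans[OF _ dle[OF that]]] by simp
  with pS show ?thesis by blast
qed

lemma real_orthogonal_projection:
  fixes S :: "'a::{real_inner, complete_space} set"
  assumes S: "subspace S" "closed S"
  shows "\<exists>p\<in>S. \<forall>s\<in>S. inner s (v - p) = 0"
proof -
  obtain p where p: "p \<in> S" "\<And>s. s \<in> S \<Longrightarrow> norm (v - p) \<le> norm (v - s)"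
    using nearest_point_closed_subspace[OF assms] by blast
  have "inner s (v - p) = 0" if s: "s \<in> S" for s
  proof (cases "s = 0")
    case False
    define t where "t = inner s (v - p) / inner s s"
    have "p + t *\<^sub>R s \<in> S" using p(1) s S(1) by (simp add: subspace_add subspace_scale)
    from p(2)[OF this] have "(norm (v - p))\<^sup>2 \<le> (norm (v - (p + t *\<^sub>R s)))\<^sup>2"
      by (simp add: power_mono)
    also have "\<dots> = (norm (v - p))\<^sup>2 - 2 * t * inner s (v - p) + t * t * inner s s"
      by (simp add: power2_norm_eq_inner algebra_simps inner_commute)
    also have "\<dots> = (norm (v - p))\<^sup>2 - (inner s (v - p))\<^sup>2 / inner s s"
      using False by (simp add: t_def power2_eq_square field_simps)
    finally have "(inner s (v - p))\<^sup>2 / inner s s \<le> 0" by simp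
    moreover have "inner s s > 0" using False by simp
    ultimately show ?thesis
      by (smt (verit) divide_pos_pos zero_less_power2)
  qed simp
  with p(1) show ?thesis by blast
qed

lemma csubspace_imp_subspace:
  "complex_vector.subspace S \<Longrightarrow> subspace S"
  by (simp add: subspace_def complex_vector.subspace_def scaleR_eq_scaleC)

lemma orthogonal_projection:
  fixes S :: "'a::complex_hilbert_space set"
  assumes S: "complex_vector.subspace S" "closed S"
  shows "\<exists>p\<in>S. \<forall>s\<in>S. cinner s (v - p) = 0"
proof -
  obtain p where p: "p \<in> S" "\<And>s. s \<in> S \<Longrightarrow> inner s (v - p) = 0"
    using real_orthogonal_projection[OF csubspace_imp_subspace[OF S(1)] S(2)] by blast
  have "cinner s (v - p) = 0" if "s \<in> S" for s
    using p(2)[OF that] p(2)[of "\<i> *\<^sub>C s"] complex_vector.subspace_scale[OF S(1) that]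
    by (simp add: complex_eq_iff inner_eq_Re_cinner[symmetric] Im_cinner)
  with p(1) show ?thesis by blast
qed

definition is_onb :: "'a::complex_inner set \<Rightarrow> bool" where
  "is_onb E \<longleftrightarrow> (\<forall>e\<in>E. \<forall>f\<in>E. cinner e f = (if e = f then 1 else 0)) \<and>
    closure (complex_vector.span E) = UNIV"

lemma closed_csubspace_closure:
  fixes S :: "'a::complex_inner set"
  assumes "complex_vector.subspace S"
  shows "complex_vector.subspace (closure S)"
  unfolding complex_vector.subspace_def
proof (intro conjI ballI allI)
  show "0 \<in> closure S"
    using assms closure_subset by (auto simp: complex_vector.subspace_def)
next
  fix x y assume "x \<in> closure S" "y \<in> closure S"
  then obtain f g where "\<forall>n. f n \<in> S" "f \<longlonglongrightarrow> x" "\<forall>n. g n \<in> S" "g \<longlonglongrightarrow> y"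
    unfolding closure_sequential by blast
  then have "(\<lambda>n. f n + g n) \<longlonglongrightarrow> x + y" "\<forall>n. f n + g n \<in> S"
    using assms by (auto simp: complex_vector.subspace_def intro!: tendsto_intros)
  then show "x + y \<in> closure S"
    unfolding closure_sequential by (intro exI[of _ "\<lambda>n. f n + g n"] conjI)
next
  fix c x assume "x \<in> closure S"
  then obtain f where "\<forall>n. f n \<in> S" "f \<longlonglongrightarrow> x"
    unfolding closure_sequential by blast
  then have "(\<lambda>n. c *\<^sub>C f n) \<longlonglongrightarrow> c *\<^sub>C x" "\<forall>n. c *\<^sub>C f n \<in> S"
    using assms bounded_linear.tendsto[OF bounded_linear_scaleC]
    by (auto simp: complex_vector.subspace_def)
  then show "c *\<^sub>C x \<in> closure S"
    unfolding closure_sequential by (intro exI[of _ "\<lambda>n. c *\<^sub>C f n"] conjI)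
qed

lemma ex_onb: "\<exists>E :: 'a::complex_hilbert_space set. is_onb E"
proof -
  define A where "A = {E :: 'a set. \<forall>e\<in>E. \<forall>f\<in>E. cinner e f = (if e = f then 1 else 0)}"
  have "\<Union>C \<in> A" if C: "subset.chain A C" for C
    unfolding A_def
  proof (intro CollectI ballI)
    fix e f assume "e \<in> \<Union>C" "f \<in> \<Union>C"
    then obtain X Y where "X \<in> C" "e \<in> X" "Y \<in> C" "f \<in> Y" by blast
    moreover from this have "X \<subseteq> Y \<or> Y \<subseteq> X"
      using C by (auto simp: subset_chain_def)
    ultimately obtain Z where "Z \<in> C" "e \<in> Z" "f \<in> Z" by blast
    moreover from this have "Z \<in> A" using C by (auto simp: subset_chain_def)
    ultimately show "cinner e f = (if e = f then 1 else 0)" unfolding A_def by blast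
  qed
  then have "\<exists>M\<in>A. \<forall>X\<in>A. M \<subseteq> X \<longrightarrow> X = M"
    by (rule subset_Zorn')
  then obtain E where E: "E \<in> A" and max: "\<And>X. X \<in> A \<Longrightarrow> E \<subseteq> X \<Longrightarrow> X = E" by blast
  let ?S = "closure (complex_vector.span E)"
  have sub: "complex_vector.subspace ?S"
    by (rule closed_csubspace_closure) simp
  have "v \<in> ?S" for v
  proof (rule ccontr)
    assume v: "v \<notin> ?S"
    obtain p where p: "p \<in> ?S" "\<And>s. s \<in> ?S \<Longrightarrow> cinner s (v - p) = 0"
      using orthogonal_projection[OF sub] by blast
    then have nz: "v - p \<noteq> 0" using v by auto
    define w where "w = complex_of_real (inverse (norm (v - p))) *\<^sub>C (v - p)"
    have "norm w = 1"
      using nz unfolding w_def norm_scaleC norm_of_real by simp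
    then have w1: "cinner w w = 1" by (simp add: cinner_self)
    have w2: "cinner e w = 0" if "e \<in> E" for e
    proof -
      have "e \<in> ?S"
        using that complex_vector.span_base closure_subset by blast
      then show ?thesis using p(2) by (simp add: w_def cinner_scaleC_right)
    qed
    have w3: "cinner w e = 0" if "e \<in> E" for e
      using w2[OF that] cinner_commute[of w e] by simp
    have "insert w E \<in> A"
      using E w1 w2 w3 unfolding A_def by auto
    then have "w \<in> E" using max by blast
    then show False using w1 w2 by auto
  qed
  with E have "is_onb E" unfolding A_def is_onb_def by blast
  then show ?thesis by blast
qed

lemma norm_diff_onb_sum:
  fixes v :: "'a::complex_inner"
  assumes "finite F" and on: "\<forall>e\<in>F. \<forall>f\<in>F. cinner e f = (if e = f then 1 else 0)"
  shows "(norm (v - (\<Sum>f\<in>F. c f *\<^sub>C f)))\<^sup>2 =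
    (norm v)\<^sup>2 - (\<Sum>f\<in>F. (cmod (cinner f v))\<^sup>2) + (\<Sum>f\<in>F. (cmod (cinner f v - c f))\<^sup>2)"
proof -
  define w where "w = (\<Sum>f\<in>F. c f *\<^sub>C f)"
  have fw: "cinner f w = c f" if "f \<in> F" for f
  proof -
    have "cinner f w = (\<Sum>g\<in>F. c g * cinner f g)"
      by (simp add: w_def cinner.sum_right cinner_scaleC_right)
    also have "\<dots> = (\<Sum>g\<in>F. if f = g then c g else 0)"
      using on that by (intro sum.cong) auto
    also have "\<dots> = c f" using assms(1) that by simp
    finally show ?thesis .
  qed
  have "cinner w w = (\<Sum>f\<in>F. cnj (c f) * cinner f w)"
    by (subst (1) w_def) (simp add: cinner.sum_left cinner_scaleC_left)
  also have "\<dots> = (\<Sum>f\<in>F. complex_of_real ((cmod (c f))\<^sup>2))"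
    by (intro sum.cong) (simp_all add: fw complex_norm_square mult.commute del: of_real_power)
  also have "\<dots> = complex_of_real (\<Sum>f\<in>F. (cmod (c f))\<^sup>2)" by simp
  finally have ww: "(norm w)\<^sup>2 = (\<Sum>f\<in>F. (cmod (c f))\<^sup>2)"
    unfolding cinner_self using of_real_eq_iff by blast
  have vw: "inner v w = (\<Sum>f\<in>F. Re (cnj (cinner f v) * c f))"
    unfolding w_def
    by (simp add: inner_eq_Re_cinner cinner.sum_right cinner_scaleC_right Re_sum
        cinner_commute[of v] mult.commute del: times_complex.simps)
  have sq: "(cmod (a - b))\<^sup>2 = (cmod a)\<^sup>2 - 2 * Re (cnj a * b) + (cmod b)\<^sup>2" for a b
    unfolding cmod_power2 by (simp add: power2_eq_square algebra_simps)
  have "(norm (v - w))\<^sup>2 = (norm v)\<^sup>2 - 2 * inner v w + (norm w)\<^sup>2"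
    by (simp add: power2_norm_eq_inner algebra_simps inner_commute)
  then show ?thesis
    unfolding w_def[symmetric] sq sum.distrib sum_subtractf ww vw sum_distrib_left by simp
qed

lemma parseval:
  fixes v :: "'a::complex_inner"
  assumes E: "is_onb E"
  shows "((\<lambda>e. (cmod (cinner e v))\<^sup>2) has_sum (norm v)\<^sup>2) E"
proof -
  have on: "\<forall>e\<in>F. \<forall>f\<in>F. cinner e f = (if e = f then 1 else 0)" if "F \<subseteq> E" for F
    using E that unfolding is_onb_def by blast
  have bessel: "(\<Sum>e\<in>F. (cmod (cinner e v))\<^sup>2) \<le> (norm v)\<^sup>2" if F: "finite F" "F \<subseteq> E" for F
    using norm_diff_onb_sum[OF F(1) on[OF F(2)], of v "\<lambda>e. cinner e v"]
      zero_le_power2[of "norm (v - (\<Sum>f\<in>F. cinner f v *\<^sub>C f))"]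
    by simp
  show ?thesis
    unfolding has_sum_def tendsto_iff eventually_finite_subsets_at_top
  proof (intro allI impI)
    fix \<epsilon> :: real assume \<epsilon>: "\<epsilon> > 0"
    have "v \<in> closure (complex_vector.span E)" using E unfolding is_onb_def by simp
    then obtain w where w: "w \<in> complex_vector.span E" "dist w v < sqrt \<epsilon>"
      unfolding closure_approachable using \<epsilon> by (metis real_sqrt_gt_zero)
    obtain F c where F: "finite F" "F \<subseteq> E" "w = (\<Sum>f\<in>F. c f *\<^sub>C f)"
      using w(1) unfolding complex_vector.span_explicit by blast
    have "(norm v)\<^sup>2 - (\<Sum>f\<in>F. (cmod (cinner f v))\<^sup>2) \<le> (norm (v - w))\<^sup>2"
      unfolding F(3) norm_diff_onb_sum[OF F(1) on[OF F(2)]] by (simp add: sum_nonneg)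
    also have "\<dots> < (sqrt \<epsilon>)\<^sup>2"
      using w(2) by (intro power_strict_mono) (simp_all add: dist_norm norm_minus_commute)
    also have "\<dots> = \<epsilon>" using \<epsilon> by simp
    finally have 1: "(norm v)\<^sup>2 - (\<Sum>f\<in>F. (cmod (cinner f v))\<^sup>2) < \<epsilon>" .
    have "dist (\<Sum>e\<in>G. (cmod (cinner e v))\<^sup>2) ((norm v)\<^sup>2) < \<epsilon>"
      if G: "finite G" "F \<subseteq> G" "G \<subseteq> E" for G
    proof -
      have "(\<Sum>e\<in>F. (cmod (cinner e v))\<^sup>2) \<le> (\<Sum>e\<in>G. (cmod (cinner e v))\<^sup>2)"
        using G by (intro sum_mono2) auto
      with 1 bessel[OF G(1) G(3)] show ?thesis by (simp add: dist_real_def)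
    qed
    with F(1,2) show "\<exists>X. finite X \<and> X \<subseteq> E \<and> (\<forall>Y. finite Y \<and> X \<subseteq> Y \<and> Y \<subseteq> E \<longrightarrow>
        dist (\<Sum>e\<in>Y. (cmod (cinner e v))\<^sup>2) ((norm v)\<^sup>2) < \<epsilon>)" by blast
  qed
qed

section \<open>Bounded operators\<close>

instantiation blinfun :: (real_normed_vector, complex_inner) complex_vector
begin

lift_definition scaleC_blinfun :: "complex \<Rightarrow> 'a \<Rightarrow>\<^sub>L 'b \<Rightarrow> 'a \<Rightarrow>\<^sub>L 'b" is "\<lambda>c f x. c *\<^sub>C f x"
  by (rule bounded_linear_compose[OF bounded_linear_scaleC])

instance
  by standard (transfer; simp add: scaleC_add_right scaleC_add_left scaleC_scaleC scaleR_eq_scaleC)+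

end

declare scaleC_blinfun.rep_eq [simp]

text \<open>\<^typ>\<open>'a \<Rightarrow>\<^sub>L 'a\<close> consists of all bounded real-linear maps; \<open>B(H)\<close> is the
  subset of complex-linear ones (with the same operator norm).\<close>

definition bounded_ops :: "('a::complex_inner \<Rightarrow>\<^sub>L 'a) set" where
  "bounded_ops = {T :: 'a \<Rightarrow>\<^sub>L 'a. \<forall>c x. T (c *\<^sub>C x) = c *\<^sub>C T x}"

text \<open>On \<open>B(H)\<close> the adjoint exists and is unique (lemmas \<open>ex_adjoint\<close>, \<open>adj_unique\<close>).\<close>

definition adj :: "('a::complex_inner \<Rightarrow>\<^sub>L 'a) \<Rightarrow> ('a \<Rightarrow>\<^sub>L 'a)" where
  "adj T = (THE S :: 'a \<Rightarrow>\<^sub>L 'a. \<forall>x y. cinner (T x) y = cinner x (S y))"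

lemma cinner_right_eqI:
  assumes "\<And>x. cinner x a = cinner x b" shows "a = b"
proof -
  have "cinner (a - b) (a - b) = 0" using assms by (simp add: cinner.diff_right)
  then show ?thesis by (simp add: cinner_self)
qed

lemma riesz_representation:
  fixes \<phi> :: "'a::complex_hilbert_space \<Rightarrow> complex"
  assumes bl: "bounded_linear \<phi>" and cl: "\<And>c x. \<phi> (c *\<^sub>C x) = c * \<phi> x"
  shows "\<exists>z. \<forall>x. \<phi> x = cinner z x"
proof (cases "\<forall>x. \<phi> x = 0")
  case True
  then show ?thesis by (intro exI[of _ 0]) (simp add: cinner.zero_left)
next
  case False
  interpret bounded_linear \<phi> by (rule bl)
  define K where "K = {x. \<phi> x = 0}"
  have sub: "complex_vector.subspace K"
    unfolding K_def complex_vector.subspace_def by (simp add: zero add cl)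
  have cK: "closed K"
    unfolding K_def by (intro closed_Collect_eq continuous_intros linear_continuous_on bl)
  from False obtain v where v: "\<phi> v \<noteq> 0" by blast
  obtain p where p: "p \<in> K" "\<And>s. s \<in> K \<Longrightarrow> cinner s (v - p) = 0"
    using orthogonal_projection[OF sub cK] by blast
  define u where "u = v - p"
  have \<phi>u: "\<phi> u \<noteq> 0" using p(1) v by (simp add: u_def diff K_def)
  then have u0: "cinner u u \<noteq> 0" using zero by (auto simp: cinner_self)
  define z where "z = cnj (\<phi> u / cinner u u) *\<^sub>C u"
  have "\<phi> x = cinner z x" for x
  proof -
    have "\<phi> x *\<^sub>C u - \<phi> u *\<^sub>C x \<in> K" by (simp add: K_def diff cl)
    from p(2)[OF this] have "cinner (\<phi> x *\<^sub>C u - \<phi> u *\<^sub>C x) u = 0" by (simp add: u_def)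
    then have "cinner u (\<phi> x *\<^sub>C u - \<phi> u *\<^sub>C x) = 0"
      by (metis cinner_commute complex_cnj_zero)
    then have "\<phi> x * cinner u u = \<phi> u * cinner u x"
      by (simp add: cinner.diff_right cinner_scaleC_right)
    then show ?thesis using u0 by (simp add: z_def cinner_scaleC_left field_simps)
  qed
  then show ?thesis by blast
qed

lemma ex_adjoint:
  fixes T :: "'a::complex_hilbert_space \<Rightarrow>\<^sub>L 'a"
  assumes T: "T \<in> bounded_ops"
  shows "\<exists>S\<in>bounded_ops. \<forall>x y. cinner (T x) y = cinner x (S y)"
proof -
  have "\<exists>z. \<forall>x. cinner (T x) y = cinner x z" for y
  proof -
    have "\<exists>z. \<forall>x. cinner y (T x) = cinner z x"
    proof (rule riesz_representation)
      show "bounded_linear (\<lambda>x. cinner y (T x))"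
        by (rule bounded_linear_compose[OF cinner.bounded_linear_right blinfun.bounded_linear_right])
      show "cinner y (T (c *\<^sub>C x)) = c * cinner y (T x)" for c x
        using T by (simp add: bounded_ops_def cinner_scaleC_right)
    qed
    then show ?thesis by (metis cinner_commute)
  qed
  then obtain s where s: "\<And>x y. cinner (T x) y = cinner x (s y)" by metis
  have add: "s (y + z) = s y + s z" for y z
    by (rule cinner_right_eqI) (simp add: s[symmetric] cinner_add_right)
  have scale: "s (c *\<^sub>C y) = c *\<^sub>C s y" for c y
    by (rule cinner_right_eqI) (simp add: s[symmetric] cinner_scaleC_right)
  have bound: "norm (s y) \<le> norm y * norm T" for y
  proof -
    have "norm (s y) * norm (s y) = cmod (cinner (s y) (s y))"
      by (simp add: cinner_self norm_power power2_eq_square norm_mult)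
    also have "\<dots> = cmod (cinner (T (s y)) y)" by (simp add: s)
    also have "\<dots> \<le> norm (T (s y)) * norm y" by (rule norm_cinner_le)
    also have "\<dots> \<le> (norm T * norm (s y)) * norm y"
      by (intro mult_right_mono norm_blinfun) simp
    finally have "norm (s y) * norm (s y) \<le> norm (s y) * (norm y * norm T)"
      by (simp add: mult_ac)
    then show ?thesis
      by (cases "norm (s y) = 0") (simp_all add: mult_le_cancel_left)
  qed
  have "bounded_linear s"
    by (rule bounded_linear_intro[OF add _ bound]) (simp add: scaleR_eq_scaleC scale)
  then have "Blinfun s \<in> bounded_ops" "\<forall>x y. cinner (T x) y = cinner x (Blinfun s y)"
    by (simp_all add: bounded_ops_def bounded_linear_Blinfun_apply scale s)
  then show ?thesis by blast
qed

lemma adj_unique: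
  fixes S T :: "'a::complex_inner \<Rightarrow>\<^sub>L 'a"
  assumes "\<And>x y. cinner (T x) y = cinner x (S y)" shows "adj T = S"
  unfolding adj_def
proof (rule the_equality)
  show "S' = S" if "\<forall>x y. cinner (T x) y = cinner x (S' y)" for S' :: "'a \<Rightarrow>\<^sub>L 'a"
    using that assms by (intro blinfun_eqI cinner_right_eqI) metis
qed (use assms in blast)

lemma cinner_adj_right:
  fixes T :: "'a::complex_hilbert_space \<Rightarrow>\<^sub>L 'a"
  assumes "T \<in> bounded_ops" shows "cinner x (adj T y) = cinner (T x) y"
  using ex_adjoint[OF assms] adj_unique by metis

lemma cinner_adj_left:
  fixes T :: "'a::complex_hilbert_space \<Rightarrow>\<^sub>L 'a"
  assumes "T \<in> bounded_ops" shows "cinner (adj T x) y = cinner x (T y)"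
  using cinner_adj_right[OF assms] by (metis cinner_commute)

lemma adj_bounded_ops:
  fixes T :: "'a::complex_hilbert_space \<Rightarrow>\<^sub>L 'a"
  assumes "T \<in> bounded_ops" shows "adj T \<in> bounded_ops"
  using ex_adjoint[OF assms] adj_unique by metis

lemma adj_adj:
  fixes T :: "'a::complex_hilbert_space \<Rightarrow>\<^sub>L 'a"
  assumes "T \<in> bounded_ops" shows "adj (adj T) = T"
  by (rule adj_unique) (rule cinner_adj_left[OF assms])

lemma adj_compose:
  fixes S T :: "'a::complex_hilbert_space \<Rightarrow>\<^sub>L 'a"
  assumes "S \<in> bounded_ops" "T \<in> bounded_ops" shows "adj (S o\<^sub>L T) = adj T o\<^sub>L adj S"
  by (rule adj_unique) (simp add: assms cinner_adj_right)

lemma bounded_ops_compose: "S \<in> bounded_ops \<Longrightarrow> T \<in> bounded_ops \<Longrightarrow> S o\<^sub>L T \<in> bounded_ops"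
  by (simp add: bounded_ops_def)

lemma csubspace_bounded_ops: "complex_vector.subspace bounded_ops"
  by (simp add: complex_vector.subspace_def bounded_ops_def blinfun.add_left
      scaleC_add_right scaleC_scaleC mult.commute)

definition unitary :: "('a::complex_inner \<Rightarrow>\<^sub>L 'a) \<Rightarrow> bool" where
  "unitary U \<longleftrightarrow> U \<in> bounded_ops \<and> adj U o\<^sub>L U = id_blinfun \<and> U o\<^sub>L adj U = id_blinfun"

definition cstar_subalgebra :: "('a::complex_inner \<Rightarrow>\<^sub>L 'a) set \<Rightarrow> bool" where
  "cstar_subalgebra A \<longleftrightarrow> A \<subseteq> bounded_ops \<and> complex_vector.subspace A \<and>
    (\<forall>S\<in>A. \<forall>T\<in>A. S o\<^sub>L T \<in> A) \<and> (\<forall>T\<in>A. adj T \<in> A) \<and> closed A"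

definition finite_dim_csubspace :: "'a::complex_vector set \<Rightarrow> bool" where
  "finite_dim_csubspace V \<longleftrightarrow> (\<exists>B. finite B \<and> V = complex_vector.span B)"

section \<open>Hilbert-Schmidt operators\<close>

text \<open>The trace is computed in an arbitrarily chosen orthonormal basis; for products of
  Hilbert-Schmidt operators the value does not depend on it (lemma \<open>ctrace_adj_compose\<close>).\<close>

definition ctrace :: "('a::complex_inner \<Rightarrow>\<^sub>L 'a) \<Rightarrow> complex" where
  "ctrace T = (\<Sum>\<^sub>\<infinity>e\<in>(SOME E. is_onb E). cinner e (T e))"

text \<open>Finiteness for one orthonormal basis is enough (lemma \<open>hilbert_schmidt_iff\<close>).\<close>

definition hilbert_schmidt :: "('a::complex_inner \<Rightarrow>\<^sub>L 'a) \<Rightarrow> bool" where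
  "hilbert_schmidt T \<longleftrightarrow> T \<in> bounded_ops \<and>
    (\<forall>E. is_onb E \<longrightarrow> (\<lambda>e. (norm (T e))\<^sup>2) summable_on E)"

abbreviation some_onb :: "'a::complex_inner set" where
  "some_onb \<equiv> (SOME E. is_onb E)"

lemma is_onb_some: "is_onb (some_onb :: 'a::complex_hilbert_space set)"
  using ex_onb by (rule someI_ex)

lemma hs_adj_has_sum:
  fixes T :: "'a::complex_hilbert_space \<Rightarrow>\<^sub>L 'a"
  assumes T: "T \<in> bounded_ops" and E: "is_onb E" and F: "is_onb F"
    and s: "((\<lambda>e. (norm (T e))\<^sup>2) has_sum s) E"
  shows "((\<lambda>f. (norm (adj T f))\<^sup>2) has_sum s) F"
proof -
  define g where "g = (\<lambda>(e, f). (cmod (cinner f (T e)))\<^sup>2)"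
  have g1: "((\<lambda>f. g (e, f)) has_sum (norm (T e))\<^sup>2) F" for e
    unfolding g_def by (simp add: parseval[OF F])
  have "g summable_on E \<times> F"
    by (rule summable_on_SigmaI[OF g1]) (use s in \<open>auto simp: g_def summable_on_def\<close>)
  then have "(g has_sum s) (E \<times> F)"
    using has_sum_SigmaI[OF g1 s] by blast
  then have sw: "((\<lambda>(f, e). g (e, f)) has_sum s) (F \<times> E)"
    by (rule iffD1[OF has_sum_swap])
  show ?thesis
  proof (rule has_sum_SigmaD[OF sw])
    fix f
    have "cmod (cinner f (T e)) = cmod (cinner e (adj T f))" for e
      using cinner_adj_right[OF T] cinner_commute[of f "T e"] by simp
    then show "((\<lambda>e. case (f, e) of (f, e) \<Rightarrow> g (e, f)) has_sum (norm (adj T f))\<^sup>2) E"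
      using parseval[OF E, of "adj T f"] by (simp add: g_def)
  qed
qed

lemma hs_has_sum_onb:
  fixes T :: "'a::complex_hilbert_space \<Rightarrow>\<^sub>L 'a"
  assumes T: "T \<in> bounded_ops" and E: "is_onb E" and F: "is_onb F"
    and s: "((\<lambda>e. (norm (T e))\<^sup>2) has_sum s) E"
  shows "((\<lambda>f. (norm (T f))\<^sup>2) has_sum s) F"
  using hs_adj_has_sum[OF adj_bounded_ops[OF T] F F hs_adj_has_sum[OF T E F s]]
  by (simp add: adj_adj[OF T])

lemma hilbert_schmidt_iff:
  fixes T :: "'a::complex_hilbert_space \<Rightarrow>\<^sub>L 'a"
  assumes "is_onb E"
  shows "hilbert_schmidt T \<longleftrightarrow> T \<in> bounded_ops \<and> (\<lambda>e. (norm (T e))\<^sup>2) summable_on E"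
proof
  assume *: "T \<in> bounded_ops \<and> (\<lambda>e. (norm (T e))\<^sup>2) summable_on E"
  then obtain s where "((\<lambda>e. (norm (T e))\<^sup>2) has_sum s) E" by (auto simp: summable_on_def)
  then have "((\<lambda>e. (norm (T e))\<^sup>2) has_sum s) F" if "is_onb F" for F
    using hs_has_sum_onb[OF _ assms that] * by blast
  then show "hilbert_schmidt T"
    using * unfolding hilbert_schmidt_def summable_on_def by blast
qed (use assms in \<open>simp add: hilbert_schmidt_def\<close>)

lemma hilbert_schmidt_adj:
  fixes T :: "'a::complex_hilbert_space \<Rightarrow>\<^sub>L 'a"
  assumes T: "hilbert_schmidt T" shows "hilbert_schmidt (adj T)"
proof -
  have T': "T \<in> bounded_ops" using T by (simp add: hilbert_schmidt_def)
  obtain s where s: "((\<lambda>e. (norm (T e))\<^sup>2) has_sum s) some_onb"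
    using T is_onb_some unfolding hilbert_schmidt_def summable_on_def by blast
  have "((\<lambda>f. (norm (adj T f))\<^sup>2) has_sum s) some_onb"
    by (rule hs_adj_has_sum[OF T' is_onb_some is_onb_some s])
  then show ?thesis
    unfolding hilbert_schmidt_iff[OF is_onb_some] summable_on_def
    using adj_bounded_ops[OF T'] by blast
qed

lemma summable_on_norm_sq_bound:
  fixes f :: "'a \<Rightarrow> 'b::real_normed_vector" and g :: "'a \<Rightarrow> 'c::real_normed_vector"
  assumes "(\<lambda>e. (norm (f e))\<^sup>2) summable_on E"
    and "\<And>e. e \<in> E \<Longrightarrow> norm (g e) \<le> C * norm (f e)"
  shows "(\<lambda>e. (norm (g e))\<^sup>2) summable_on E"
proof (rule summable_on_comparison_test)
  show "(\<lambda>e. C\<^sup>2 * (norm (f e))\<^sup>2) summable_on E"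
    by (rule summable_on_cmult_right) (rule assms)
  show "(norm (g e))\<^sup>2 \<le> C\<^sup>2 * (norm (f e))\<^sup>2" if "e \<in> E" for e
    using power_mono[OF assms(2)[OF that], of 2] by (simp add: power_mult_distrib)
qed simp

lemma hilbert_schmidt_compose_left:
  fixes S T :: "'a::complex_hilbert_space \<Rightarrow>\<^sub>L 'a"
  assumes "S \<in> bounded_ops" "hilbert_schmidt T" shows "hilbert_schmidt (S o\<^sub>L T)"
  unfolding hilbert_schmidt_def
proof (intro conjI allI impI)
  show "S o\<^sub>L T \<in> bounded_ops"
    using assms bounded_ops_compose unfolding hilbert_schmidt_def by blast
  fix E :: "'a set" assume "is_onb E"
  then have "(\<lambda>e. (norm (T e))\<^sup>2) summable_on E"
    using assms unfolding hilbert_schmidt_def by blast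
  then show "(\<lambda>e. (norm ((S o\<^sub>L T) e))\<^sup>2) summable_on E"
    by (rule summable_on_norm_sq_bound[where C = "norm S"]) (simp add: norm_blinfun)
qed

lemma hilbert_schmidt_compose_right:
  fixes S T :: "'a::complex_hilbert_space \<Rightarrow>\<^sub>L 'a"
  assumes S: "S \<in> bounded_ops" and T: "hilbert_schmidt T" shows "hilbert_schmidt (T o\<^sub>L S)"
proof -
  have T': "T \<in> bounded_ops" using T by (simp add: hilbert_schmidt_def)
  have "hilbert_schmidt (adj (adj S o\<^sub>L adj T))"
    by (intro hilbert_schmidt_adj hilbert_schmidt_compose_left adj_bounded_ops S T)
  then show ?thesis
    by (simp add: adj_compose adj_bounded_ops S T' adj_adj)
qed

lemma hilbert_schmidt_scaleC: "hilbert_schmidt T \<Longrightarrow> hilbert_schmidt (c *\<^sub>C T)"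
  unfolding hilbert_schmidt_def
proof (intro conjI allI impI)
  assume T: "T \<in> bounded_ops \<and> (\<forall>E. is_onb E \<longrightarrow> (\<lambda>e. (norm (T e))\<^sup>2) summable_on E)"
  then show "c *\<^sub>C T \<in> bounded_ops"
    by (simp add: complex_vector.subspace_scale[OF csubspace_bounded_ops])
  fix E :: "'a set" assume "is_onb E"
  with T have "(\<lambda>e. (norm (T e))\<^sup>2) summable_on E" by blast
  then show "(\<lambda>e. (norm ((c *\<^sub>C T) e))\<^sup>2) summable_on E"
    by (rule summable_on_norm_sq_bound[where C = "cmod c"]) (simp add: norm_scaleC)
qed

lemma hilbert_schmidt_scaleR: "hilbert_schmidt T \<Longrightarrow> hilbert_schmidt (r *\<^sub>R T)"
  by (simp add: scaleR_eq_scaleC hilbert_schmidt_scaleC)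

lemma hilbert_schmidt_uminus: "hilbert_schmidt T \<Longrightarrow> hilbert_schmidt (- T)"
  using hilbert_schmidt_scaleR[of T "-1"] by simp

lemma hilbert_schmidt_zero: "hilbert_schmidt 0"
  by (simp add: hilbert_schmidt_def complex_vector.subspace_0[OF csubspace_bounded_ops])

lemma hilbert_schmidt_add:
  assumes "hilbert_schmidt S" "hilbert_schmidt T" shows "hilbert_schmidt (S + T)"
  unfolding hilbert_schmidt_def
proof (intro conjI allI impI)
  show "S + T \<in> bounded_ops"
    using assms complex_vector.subspace_add[OF csubspace_bounded_ops]
    by (auto simp: hilbert_schmidt_def)
  fix E :: "'a set" assume E: "is_onb E"
  show "(\<lambda>e. (norm ((S + T) e))\<^sup>2) summable_on E"
  proof (rule summable_on_comparison_test)
    show "(\<lambda>e. 2 * (norm (S e))\<^sup>2 + 2 * (norm (T e))\<^sup>2) summable_on E"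
      using assms E unfolding hilbert_schmidt_def
      by (intro summable_on_add summable_on_cmult_right) auto
    show "(norm ((S + T) e))\<^sup>2 \<le> 2 * (norm (S e))\<^sup>2 + 2 * (norm (T e))\<^sup>2" for e
    proof -
      have "2 * (norm (S e))\<^sup>2 + 2 * (norm (T e))\<^sup>2 - (norm (S e + T e))\<^sup>2 = (norm (S e - T e))\<^sup>2"
        by (simp add: power2_norm_eq_inner algebra_simps inner_commute)
      then show ?thesis by (simp add: blinfun.add_left) (metis diff_ge_0_iff_ge zero_le_power2)
    qed
  qed simp
qed

lemma hilbert_schmidt_diff:
  "hilbert_schmidt S \<Longrightarrow> hilbert_schmidt T \<Longrightarrow> hilbert_schmidt (S - T)"
  using hilbert_schmidt_add[of S "- T"] by (simp add: hilbert_schmidt_uminus)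

lemma hs_summable_cinner:
  assumes "hilbert_schmidt S" "hilbert_schmidt T" and E: "is_onb E"
  shows "(\<lambda>e. cinner (S e) (T e)) summable_on E"
proof (rule abs_summable_summable, rule summable_on_comparison_test)
  show "(\<lambda>e. (norm (S e))\<^sup>2 + (norm (T e))\<^sup>2) summable_on E"
    using assms unfolding hilbert_schmidt_def by (intro summable_on_add) auto
  show "cmod (cinner (S e) (T e)) \<le> (norm (S e))\<^sup>2 + (norm (T e))\<^sup>2" for e
  proof -
    have "cmod (cinner (S e) (T e)) \<le> norm (S e) * norm (T e)" by (rule norm_cinner_le)
    also have "\<dots> \<le> (norm (S e))\<^sup>2 + (norm (T e))\<^sup>2"
      using sum_squares_bound[of "norm (S e)" "norm (T e)"]
        mult_nonneg_nonneg[OF norm_ge_zero[of "S e"] norm_ge_zero[of "T e"]] by linarith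
    finally show ?thesis .
  qed
qed simp

lemma inner_polarization: "inner x y = ((norm (x + y))\<^sup>2 - (norm (x - y))\<^sup>2) / 4"
  by (simp add: power2_norm_eq_inner algebra_simps inner_commute)

lemma hs_summable_inner:
  assumes "hilbert_schmidt S" "hilbert_schmidt T" and E: "is_onb E"
  shows "(\<lambda>e. inner (S e) (T e)) summable_on E"
  unfolding inner_eq_Re_cinner
  using summable_on_bounded_linear[OF bounded_linear_Re hs_summable_cinner[OF assms]]
  by (simp add: o_def)

lemma hs_infsum_inner_onb:
  fixes S T :: "'a::complex_hilbert_space \<Rightarrow>\<^sub>L 'a"
  assumes S: "hilbert_schmidt S" and T: "hilbert_schmidt T" and E: "is_onb E" and F: "is_onb F"
  shows "(\<Sum>\<^sub>\<infinity>e\<in>E. inner (S e) (T e)) = (\<Sum>\<^sub>\<infinity>f\<in>F. inner (S f) (T f))"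
    and "(\<Sum>\<^sub>\<infinity>e\<in>E. inner (S e) (T e)) = (\<Sum>\<^sub>\<infinity>f\<in>F. inner (adj S f) (adj T f))"
proof -
  have b: "S \<in> bounded_ops" "T \<in> bounded_ops"
    using S T by (simp_all add: hilbert_schmidt_def)
  obtain p q where
    p: "((\<lambda>e. (norm ((S + T) e))\<^sup>2) has_sum p) E" and q: "((\<lambda>e. (norm ((S - T) e))\<^sup>2) has_sum q) E"
    using hilbert_schmidt_add[OF S T] hilbert_schmidt_diff[OF S T] E
    unfolding hilbert_schmidt_def summable_on_def by blast
  have bo: "S + T \<in> bounded_ops" "S - T \<in> bounded_ops"
    using b complex_vector.subspace_add[OF csubspace_bounded_ops]
      complex_vector.subspace_diff[OF csubspace_bounded_ops] by auto
  have adjs: "adj (S + T) = adj S + adj T" "adj (S - T) = adj S - adj T"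
    by (rule adj_unique;
        simp add: b cinner_adj_right blinfun.add_left blinfun.diff_left cinner.add_left
          cinner.add_right cinner.diff_left cinner.diff_right)+
  have pol: "((\<lambda>e. inner (A e) (B e)) has_sum ((p - q) / 4)) G"
    if "((\<lambda>e. (norm ((A + B) e))\<^sup>2) has_sum p) G" "((\<lambda>e. (norm ((A - B) e))\<^sup>2) has_sum q) G"
    for A B :: "'a \<Rightarrow>\<^sub>L 'a" and G
    using has_sum_divide_const[OF has_sum_add[OF that(1) has_sum_uminusI[OF that(2)]], of 4]
    by (simp add: inner_polarization blinfun.add_left blinfun.diff_left)
  have 1: "(\<Sum>\<^sub>\<infinity>e\<in>E. inner (S e) (T e)) = (p - q) / 4"
    using pol[OF p q] by (rule infsumI)
  have 2: "(\<Sum>\<^sub>\<infinity>e\<in>F. inner (S e) (T e)) = (p - q) / 4"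
    using pol[OF hs_has_sum_onb[OF bo(1) E F p] hs_has_sum_onb[OF bo(2) E F q]] by (rule infsumI)
  have 3: "(\<Sum>\<^sub>\<infinity>e\<in>F. inner (adj S e) (adj T e)) = (p - q) / 4"
    using pol[of "adj S" "adj T"] hs_adj_has_sum[OF bo(1) E F p] hs_adj_has_sum[OF bo(2) E F q]
    by (intro infsumI) (simp add: adjs)
  from 1 2 show "(\<Sum>\<^sub>\<infinity>e\<in>E. inner (S e) (T e)) = (\<Sum>\<^sub>\<infinity>f\<in>F. inner (S f) (T f))" by simp
  from 1 3 show "(\<Sum>\<^sub>\<infinity>e\<in>E. inner (S e) (T e)) = (\<Sum>\<^sub>\<infinity>f\<in>F. inner (adj S f) (adj T f))" by simp
qed

lemma hs_infsum_cinner: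
  assumes S: "hilbert_schmidt S" and T: "hilbert_schmidt T" and E: "is_onb E"
  shows "(\<Sum>\<^sub>\<infinity>e\<in>E. cinner (S e) (T e)) =
    Complex (\<Sum>\<^sub>\<infinity>e\<in>E. inner (S e) (T e)) (\<Sum>\<^sub>\<infinity>e\<in>E. inner ((\<i> *\<^sub>C S) e) (T e))"
  using infsumI[OF has_sum_bounded_linear[OF bounded_linear_Re
      has_sum_infsum[OF hs_summable_cinner[OF assms]]]]
    infsumI[OF has_sum_bounded_linear[OF bounded_linear_Im
      has_sum_infsum[OF hs_summable_cinner[OF assms]]]]
  by (simp add: complex_eq_iff inner_eq_Re_cinner[symmetric] Im_cinner)

lemma ctrace_adj_compose:
  fixes S T :: "'a::complex_hilbert_space \<Rightarrow>\<^sub>L 'a"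
  assumes S: "hilbert_schmidt S" and T: "hilbert_schmidt T" and E: "is_onb E"
  shows "ctrace (adj S o\<^sub>L T) = (\<Sum>\<^sub>\<infinity>e\<in>E. cinner e ((adj S o\<^sub>L T) e))"
proof -
  have S': "S \<in> bounded_ops" using S by (simp add: hilbert_schmidt_def)
  have "(\<Sum>\<^sub>\<infinity>e\<in>some_onb. cinner (S e) (T e)) = (\<Sum>\<^sub>\<infinity>e\<in>E. cinner (S e) (T e))"
    unfolding hs_infsum_cinner[OF S T E] hs_infsum_cinner[OF S T is_onb_some]
    using hs_infsum_inner_onb(1)[OF S T is_onb_some E]
      hs_infsum_inner_onb(1)[OF hilbert_schmidt_scaleC[OF S] T is_onb_some E] by simp
  then show ?thesis
    by (simp add: ctrace_def cinner_adj_right[OF S'])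
qed

lemma self_adjoint_iff:
  fixes T :: "'a::complex_hilbert_space \<Rightarrow>\<^sub>L 'a"
  assumes "T \<in> bounded_ops"
  shows "adj T = T \<longleftrightarrow> (\<forall>x y. cinner (T x) y = cinner x (T y))"
  using adj_unique[of T T] cinner_adj_right[OF assms] by metis

lemma cinner_self_adjoint:
  fixes T :: "'a::complex_hilbert_space \<Rightarrow>\<^sub>L 'a"
  assumes "hilbert_schmidt T \<and> adj T = T"
  shows "cinner (T x) y = cinner x (T y)"
  using assms cinner_adj_left[of T x y] by (simp add: hilbert_schmidt_def)

lemma ctrace_self_adjoint:
  fixes S T :: "'a::complex_hilbert_space \<Rightarrow>\<^sub>L 'a"
  assumes S: "hilbert_schmidt S" "adj S = S" and T: "hilbert_schmidt T" "adj T = T"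
  shows "ctrace (T o\<^sub>L S) = complex_of_real (\<Sum>\<^sub>\<infinity>e\<in>some_onb. inner (T e) (S e))"
proof -
  have b: "S \<in> bounded_ops" "T \<in> bounded_ops"
    using S T by (simp_all add: hilbert_schmidt_def)
  let ?I = "\<Sum>\<^sub>\<infinity>e\<in>some_onb. inner ((\<i> *\<^sub>C T) e) (S e)"
  have "adj (\<i> *\<^sub>C T) = (- \<i>) *\<^sub>C T"
  proof (rule adj_unique)
    fix x y
    have "cinner (T x) y = cinner x (T y)" using cinner_adj_right[OF b(2)] T(2) by metis
    then show "cinner ((\<i> *\<^sub>C T) x) y = cinner x (((- \<i>) *\<^sub>C T) y)"
      by (simp add: cinner_scaleC_left cinner_scaleC_right blinfun.minus_left cinner.minus_right)
  qed
  then have "?I = (\<Sum>\<^sub>\<infinity>e\<in>some_onb. inner (((- \<i>) *\<^sub>C T) e) (S e))"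
    using hs_infsum_inner_onb(2)[OF hilbert_schmidt_scaleC[OF T(1)] S(1) is_onb_some is_onb_some,
        of \<i>] S(2) by simp
  also have "\<dots> = (\<Sum>\<^sub>\<infinity>e\<in>some_onb. - inner ((\<i> *\<^sub>C T) e) (S e))"
    by (simp add: complex_vector.scale_minus_left blinfun.minus_left)
  also have "\<dots> = - ?I" by (rule infsum_uminus)
  finally have "?I = 0" by simp
  moreover have "ctrace (T o\<^sub>L S) = (\<Sum>\<^sub>\<infinity>e\<in>some_onb. cinner (T e) (S e))"
    using cinner_adj_right[OF b(2)] T(2) by (simp add: ctrace_def)
  ultimately show ?thesis
    using hs_infsum_cinner[OF T(1) S(1) is_onb_some] by (simp add: complex_eq_iff)
qed

section \<open>The real Hilbert space of self-adjoint Hilbert-Schmidt operators\<close>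

typedef (overloaded) 'a hs_herm =
  "{T :: 'a::complex_hilbert_space \<Rightarrow>\<^sub>L 'a. hilbert_schmidt T \<and> adj T = T}"
  morphisms hs_op Abs_hs_herm
  by (rule exI[of _ 0]) (auto simp: hilbert_schmidt_zero intro!: adj_unique
      simp: cinner.zero_left cinner.zero_right)

setup_lifting type_definition_hs_herm

lemma hs_op: "hilbert_schmidt (hs_op T)" "adj (hs_op T) = hs_op T"
  using hs_op[of T] by auto

lemma hs_op_bounded_ops: "hs_op T \<in> bounded_ops"
  using hs_op(1)[of T] by (simp add: hilbert_schmidt_def)

instantiation hs_herm :: (complex_hilbert_space) real_vector
begin

lift_definition zero_hs_herm :: "'a hs_herm" is 0
  by (auto simp: hilbert_schmidt_zero cinner.zero_left cinner.zero_right intro!: adj_unique)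

lift_definition plus_hs_herm :: "'a hs_herm \<Rightarrow> 'a hs_herm \<Rightarrow> 'a hs_herm" is "(+)"
proof -
  fix S T :: "'a \<Rightarrow>\<^sub>L 'a"
  assume *: "hilbert_schmidt S \<and> adj S = S" "hilbert_schmidt T \<and> adj T = T"
  then have "adj (S + T) = S + T"
    by (intro adj_unique) (simp add: cinner_self_adjoint blinfun.add_left
        cinner.add_left cinner.add_right)
  with * show "hilbert_schmidt (S + T) \<and> adj (S + T) = S + T"
    by (simp add: hilbert_schmidt_add)
qed

lift_definition minus_hs_herm :: "'a hs_herm \<Rightarrow> 'a hs_herm \<Rightarrow> 'a hs_herm" is "(-)"
proof -
  fix S T :: "'a \<Rightarrow>\<^sub>L 'a"
  assume *: "hilbert_schmidt S \<and> adj S = S" "hilbert_schmidt T \<and> adj T = T"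
  then have "adj (S - T) = S - T"
    by (intro adj_unique) (simp add: cinner_self_adjoint blinfun.diff_left
        cinner.diff_left cinner.diff_right)
  with * show "hilbert_schmidt (S - T) \<and> adj (S - T) = S - T"
    by (simp add: hilbert_schmidt_diff)
qed

lift_definition uminus_hs_herm :: "'a hs_herm \<Rightarrow> 'a hs_herm" is uminus
proof -
  fix T :: "'a \<Rightarrow>\<^sub>L 'a"
  assume *: "hilbert_schmidt T \<and> adj T = T"
  then have "adj (- T) = - T"
    by (intro adj_unique) (simp add: cinner_self_adjoint blinfun.minus_left
        cinner.minus_left cinner.minus_right)
  with * show "hilbert_schmidt (- T) \<and> adj (- T) = - T"
    by (simp add: hilbert_schmidt_uminus)
qed

lift_definition scaleR_hs_herm :: "real \<Rightarrow> 'a hs_herm \<Rightarrow> 'a hs_herm" is scaleR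
proof -
  fix r :: real and T :: "'a \<Rightarrow>\<^sub>L 'a"
  assume *: "hilbert_schmidt T \<and> adj T = T"
  then have "adj (r *\<^sub>R T) = r *\<^sub>R T"
    by (intro adj_unique) (simp add: cinner_self_adjoint blinfun.scaleR_left
        cinner.scaleR_left cinner.scaleR_right)
  with * show "hilbert_schmidt (r *\<^sub>R T) \<and> adj (r *\<^sub>R T) = r *\<^sub>R T"
    by (simp add: hilbert_schmidt_scaleR)
qed

instance
  by standard (transfer; simp add: algebra_simps)+

end

lemma norm_le_hs_infsum:
  fixes T :: "'a::complex_hilbert_space \<Rightarrow>\<^sub>L 'a"
  assumes T: "hilbert_schmidt T" "adj T = T"
  shows "(norm T)\<^sup>2 \<le> (\<Sum>\<^sub>\<infinity>e\<in>some_onb. (norm (T e))\<^sup>2)"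
proof -
  let ?s = "\<Sum>\<^sub>\<infinity>e\<in>some_onb. (norm (T e))\<^sup>2"
  have b: "T \<in> bounded_ops" using T by (simp add: hilbert_schmidt_def)
  have summ: "(\<lambda>e. (norm (T e))\<^sup>2) summable_on some_onb"
    using T(1) is_onb_some unfolding hilbert_schmidt_def by blast
  have s0: "?s \<ge> 0" by (rule infsum_nonneg) simp
  have "norm (T v) \<le> sqrt ?s * norm v" for v
  proof -
    have "(norm (T v))\<^sup>2 \<le> ?s * (norm v)\<^sup>2"
    proof (rule has_sum_mono[OF parseval[OF is_onb_some]
          has_sum_cmult_left[OF has_sum_infsum[OF summ]]])
      fix e :: 'a
      have "cmod (cinner e (T v)) = cmod (cinner (T e) v)"
        using cinner_adj_right[OF b] T(2) by metis
      also have "\<dots> \<le> norm (T e) * norm v" by (rule norm_cinner_le)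
      finally show "(cmod (cinner e (T v)))\<^sup>2 \<le> (norm (T e))\<^sup>2 * (norm v)\<^sup>2"
        by (metis norm_ge_zero power_mono power_mult_distrib)
    qed
    also have "\<dots> = (sqrt ?s * norm v)\<^sup>2" using s0 by (simp add: power_mult_distrib)
    finally show ?thesis by (rule power2_le_imp_le) (use s0 in simp)
  qed
  then have "norm T \<le> sqrt ?s" by (intro norm_blinfun_bound) (use s0 in auto)
  then have "(norm T)\<^sup>2 \<le> (sqrt ?s)\<^sup>2" by (intro power_mono) auto
  then show ?thesis using s0 by simp
qed

text \<open>For self-adjoint \<open>S\<close>, \<open>T\<close> the trace of \<open>TS\<close> is real (lemma \<open>of_real_inner_hs_herm\<close>).\<close>

instantiation hs_herm :: (complex_hilbert_space) real_inner
begin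

definition inner_hs_herm :: "'a hs_herm \<Rightarrow> 'a hs_herm \<Rightarrow> real" where
  "inner S T = 4 * Re (ctrace (hs_op T o\<^sub>L hs_op S))"

definition norm_hs_herm :: "'a hs_herm \<Rightarrow> real" where
  "norm T = 2 * sqrt (Re (ctrace (adj (hs_op T) o\<^sub>L hs_op T)))"

definition sgn_hs_herm :: "'a hs_herm \<Rightarrow> 'a hs_herm" where
  "sgn T = inverse (norm T) *\<^sub>R (T :: 'a hs_herm)"

definition dist_hs_herm :: "'a hs_herm \<Rightarrow> 'a hs_herm \<Rightarrow> real" where
  "dist S T = norm (S - T :: 'a hs_herm)"

definition uniformity_hs_herm :: "('a hs_herm \<times> 'a hs_herm) filter" where
  "uniformity = (INF e\<in>{0<..}. principal {(x :: 'a hs_herm, y). dist x y < e})"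

definition open_hs_herm :: "'a hs_herm set \<Rightarrow> bool" where
  "open (U :: 'a hs_herm set) \<longleftrightarrow> (\<forall>x\<in>U. \<forall>\<^sub>F (x', y) in uniformity. x' = x \<longrightarrow> y \<in> U)"

lemma inner_hs_herm_eq:
  "inner S T = 4 * (\<Sum>\<^sub>\<infinity>e\<in>some_onb. inner (hs_op S e) (hs_op T e))"
  by (simp add: inner_hs_herm_def ctrace_self_adjoint hs_op inner_commute)

instance
proof
  fix R S T :: "'a hs_herm" and r :: real
  note summ = hs_summable_inner[OF hs_op(1) hs_op(1) is_onb_some]
  show "inner S T = inner T S" by (simp add: inner_hs_herm_eq inner_commute)
  show "inner (R + S) T = inner R T + inner S T"
    by (simp add: inner_hs_herm_eq plus_hs_herm.rep_eq blinfun.add_left inner_add_left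
        infsum_add[OF summ summ])
  show "inner (r *\<^sub>R S) T = r * inner S T"
    by (simp add: inner_hs_herm_eq scaleR_hs_herm.rep_eq blinfun.scaleR_left
        infsum_cmult_right[OF summ])
  have *: "4 * (norm (hs_op S))\<^sup>2 \<le> inner S S"
    using norm_le_hs_infsum[OF hs_op] by (simp add: inner_hs_herm_eq power2_norm_eq_inner)
  show "0 \<le> inner S S" using * by (smt (verit) zero_le_power2)
  show "inner S S = 0 \<longleftrightarrow> S = 0"
  proof
    assume "inner S S = 0"
    then have "hs_op S = 0" using * by simp
    then show "S = 0" by (metis hs_op_inverse zero_hs_herm.rep_eq)
  qed (simp add: inner_hs_herm_eq zero_hs_herm.rep_eq)
  show "norm S = sqrt (inner S S)"
    by (simp add: norm_hs_herm_def inner_hs_herm_def hs_op real_sqrt_mult)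
qed (rule dist_hs_herm_def sgn_hs_herm_def uniformity_hs_herm_def open_hs_herm_def)+

end

lemma of_real_inner_hs_herm: "complex_of_real (inner S T) = 4 * ctrace (hs_op T o\<^sub>L hs_op S)"
  by (simp add: inner_hs_herm_eq ctrace_self_adjoint hs_op inner_commute)

lemma norm_hs_herm_eq: "(norm T)\<^sup>2 = 4 * (\<Sum>\<^sub>\<infinity>e\<in>some_onb. (norm (hs_op T e))\<^sup>2)"
  by (simp add: power2_norm_eq_inner inner_hs_herm_eq)

lemma norm_hs_op_le: "2 * norm (hs_op T) \<le> norm T"
proof (rule power2_le_imp_le)
  show "(2 * norm (hs_op T))\<^sup>2 \<le> (norm T)\<^sup>2"
    using norm_le_hs_infsum[OF hs_op] by (simp add: norm_hs_herm_eq power_mult_distrib)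
qed simp

lemma bounded_linear_hs_op: "bounded_linear hs_op"
proof (rule bounded_linear_intro[where K = 1])
  show "norm (hs_op T) \<le> norm T * 1" for T :: "'a hs_herm"
    using norm_hs_op_le[of T] norm_ge_zero[of "hs_op T"] by linarith
qed (simp_all add: plus_hs_herm.rep_eq scaleR_hs_herm.rep_eq)

instance hs_herm :: (complex_hilbert_space) complete_space
proof
  fix X :: "nat \<Rightarrow> 'a hs_herm" assume X: "Cauchy X"
  have "Cauchy (\<lambda>n. hs_op (X n))"
    by (rule bounded_linear.Cauchy[OF bounded_linear_hs_op X])
  then obtain T where T: "(\<lambda>n. hs_op (X n)) \<longlonglongrightarrow> T"
    using Cauchy_convergent unfolding convergent_def by blast
  have Te: "(\<lambda>n. hs_op (X n) v) \<longlonglongrightarrow> T v" for v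
    by (rule blinfun.tendsto[OF T tendsto_const])
  have bT: "T \<in> bounded_ops"
    unfolding bounded_ops_def
  proof (intro CollectI allI)
    fix c v
    have "(\<lambda>n. c *\<^sub>C hs_op (X n) v) \<longlonglongrightarrow> c *\<^sub>C T v"
      by (rule bounded_linear.tendsto[OF bounded_linear_scaleC Te])
    moreover have "(\<lambda>n. hs_op (X n) (c *\<^sub>C v)) = (\<lambda>n. c *\<^sub>C hs_op (X n) v)"
      using hs_op_bounded_ops by (auto simp: bounded_ops_def)
    ultimately show "T (c *\<^sub>C v) = c *\<^sub>C T v"
      using Te[of "c *\<^sub>C v"] LIMSEQ_unique by metis
  qed
  have aT: "adj T = T"
  proof (rule adj_unique)
    fix x y
    have "cinner (hs_op (X n) x) y = cinner x (hs_op (X n) y)" for n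
      using self_adjoint_iff[OF hs_op_bounded_ops] hs_op(2) by metis
    moreover have "(\<lambda>n. cinner (hs_op (X n) x) y) \<longlonglongrightarrow> cinner (T x) y"
      "(\<lambda>n. cinner x (hs_op (X n) y)) \<longlonglongrightarrow> cinner x (T y)"
      by (rule cinner.tendsto[OF Te tendsto_const], rule cinner.tendsto[OF tendsto_const Te])
    ultimately show "cinner (T x) y = cinner x (T y)"
      using LIMSEQ_unique by simp
  qed
  have key: "\<exists>N. \<forall>n\<ge>N. \<forall>F. finite F \<and> F \<subseteq> some_onb \<longrightarrow>
      (\<Sum>e\<in>F. (norm ((hs_op (X n) - T) e))\<^sup>2) \<le> \<epsilon>\<^sup>2" if \<epsilon>: "\<epsilon> > 0" for \<epsilon>
  proof -
    obtain N where N: "\<And>m n. m \<ge> N \<Longrightarrow> n \<ge> N \<Longrightarrow> norm (X m - X n) < \<epsilon>"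
      using CauchyD[OF X \<epsilon>] by blast
    have "(\<Sum>e\<in>F. (norm ((hs_op (X n) - T) e))\<^sup>2) \<le> \<epsilon>\<^sup>2"
      if "n \<ge> N" and F: "finite F" "F \<subseteq> some_onb" for n F
    proof (rule LIMSEQ_le_const2)
      show "(\<lambda>m. \<Sum>e\<in>F. (norm (hs_op (X n) e - hs_op (X m) e))\<^sup>2)
          \<longlonglongrightarrow> (\<Sum>e\<in>F. (norm ((hs_op (X n) - T) e))\<^sup>2)"
        unfolding blinfun.diff_left by (intro tendsto_intros Te)
      have "(\<Sum>e\<in>F. (norm (hs_op (X n) e - hs_op (X m) e))\<^sup>2) \<le> \<epsilon>\<^sup>2" if "m \<ge> N" for m
      proof -
        have "(\<Sum>e\<in>F. (norm (hs_op (X n) e - hs_op (X m) e))\<^sup>2)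
            = (\<Sum>e\<in>F. (norm (hs_op (X n - X m) e))\<^sup>2)"
          by (simp add: minus_hs_herm.rep_eq blinfun.diff_left)
        also have "\<dots> \<le> (\<Sum>\<^sub>\<infinity>e\<in>some_onb. (norm (hs_op (X n - X m) e))\<^sup>2)"
          using hs_op(1) is_onb_some F unfolding hilbert_schmidt_def
          by (intro finite_sum_le_infsum) auto
        also have "\<dots> \<le> (norm (X n - X m))\<^sup>2"
          using norm_hs_herm_eq[of "X n - X m"] zero_le_power2[of "norm (X n - X m)"] by linarith
        also have "\<dots> \<le> \<epsilon>\<^sup>2"
          using N[OF \<open>n \<ge> N\<close> that] by (intro power_mono) auto
        finally show ?thesis .
      qed
      then show "\<exists>N. \<forall>m\<ge>N. (\<Sum>e\<in>F. (norm (hs_op (X n) e - hs_op (X m) e))\<^sup>2) \<le> \<epsilon>\<^sup>2" by blast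
    qed
    then show ?thesis by blast
  qed
  have hsd: "hilbert_schmidt (hs_op (X n) - T)"
    if "\<And>F. finite F \<Longrightarrow> F \<subseteq> some_onb \<Longrightarrow> (\<Sum>e\<in>F. (norm ((hs_op (X n) - T) e))\<^sup>2) \<le> C" for n C
    unfolding hilbert_schmidt_iff[OF is_onb_some]
  proof
    show "hs_op (X n) - T \<in> bounded_ops"
      by (rule complex_vector.subspace_diff[OF csubspace_bounded_ops hs_op_bounded_ops bT])
    show "(\<lambda>e. (norm ((hs_op (X n) - T) e))\<^sup>2) summable_on some_onb"
      by (rule nonneg_bdd_above_summable_on) (use that in \<open>auto intro!: bdd_aboveI2[where M = C]\<close>)
  qed
  obtain N where "\<forall>F. finite F \<and> F \<subseteq> some_onb \<longrightarrow>
      (\<Sum>e\<in>F. (norm ((hs_op (X N) - T) e))\<^sup>2) \<le> 1\<^sup>2"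
    using key[of 1] by auto
  then have "hilbert_schmidt (hs_op (X N) - T)" using hsd by blast
  from hilbert_schmidt_diff[OF hs_op(1) this, of "X N"] have "hilbert_schmidt T" by simp
  then obtain L where L: "hs_op L = T" using aT by (metis (mono_tags) Abs_hs_herm_inverse mem_Collect_eq)
  have "X \<longlonglongrightarrow> L"
  proof (rule LIMSEQ_I)
    fix r :: real assume r: "r > 0"
    then obtain N where N: "\<And>n F. n \<ge> N \<Longrightarrow> finite F \<Longrightarrow> F \<subseteq> some_onb \<Longrightarrow>
        (\<Sum>e\<in>F. (norm ((hs_op (X n) - T) e))\<^sup>2) \<le> (r/4)\<^sup>2"
      using key[of "r/4"] by auto
    have "norm (X n - L) < r" if "n \<ge> N" for n
    proof -
      have "(\<Sum>\<^sub>\<infinity>e\<in>some_onb. (norm (hs_op (X n - L) e))\<^sup>2) \<le> (r/4)\<^sup>2"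
      proof (rule infsum_le_finite_sums)
        show "(\<lambda>e. (norm (hs_op (X n - L) e))\<^sup>2) summable_on some_onb"
          using hs_op(1) is_onb_some unfolding hilbert_schmidt_def by blast
      qed (use N[OF that] in \<open>simp add: minus_hs_herm.rep_eq L\<close>)
      then have "(norm (X n - L))\<^sup>2 \<le> (r/2)\<^sup>2"
        unfolding norm_hs_herm_eq by (simp add: power2_eq_square)
      then have "norm (X n - L) \<le> r/2" by (rule power2_le_imp_le) (use r in simp)
      then show ?thesis using r by simp
    qed
    then show "\<exists>N. \<forall>n\<ge>N. norm (X n - L) < r" by blast
  qed
  then show "convergent X" by (rule convergentI)
qed

instance hs_herm :: (complex_hilbert_space) banach ..

definition unitary_orbit :: "'a::complex_hilbert_space hs_herm \<Rightarrow> 'a hs_herm set" where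
  "unitary_orbit a = {x. \<exists>U. unitary U \<and> hs_op x = U o\<^sub>L hs_op a o\<^sub>L adj U}"

text \<open>No conjugate is lost by working in the subtype:\<close>

lemma hs_op_unitary_orbit:
  "hs_op ` unitary_orbit a = {U o\<^sub>L hs_op a o\<^sub>L adj U | U. unitary U}"
proof (intro equalityI subsetI)
  fix T assume "T \<in> {U o\<^sub>L hs_op a o\<^sub>L adj U | U. unitary U}"
  then obtain U where U: "unitary U" "T = U o\<^sub>L hs_op a o\<^sub>L adj U" by blast
  then have b: "U \<in> bounded_ops" by (simp add: unitary_def)
  have "hilbert_schmidt T"
    unfolding U(2) by (intro hilbert_schmidt_compose_left hilbert_schmidt_compose_right
        adj_bounded_ops b hs_op)
  moreover have "adj T = T"
    by (simp add: U(2) adj_compose adj_adj adj_bounded_ops bounded_ops_compose b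
        hs_op_bounded_ops hs_op(2) blinfun_eqI)
  ultimately obtain x where "hs_op x = T"
    by (metis (mono_tags) Abs_hs_herm_inverse mem_Collect_eq)
  with U have "x \<in> unitary_orbit a" unfolding unitary_orbit_def by blast
  then show "T \<in> hs_op ` unitary_orbit a" using \<open>hs_op x = T\<close> by blast
qed (auto simp: unitary_orbit_def)

section \<open>Real analytic submanifolds of Banach spaces\<close>

text \<open>An \<open>n\<close>-linear map takes a sequence of arguments of which only the first \<open>n\<close> matter.\<close>

definition multilinear_bounded_by ::
  "nat \<Rightarrow> real \<Rightarrow> ((nat \<Rightarrow> 'a::real_normed_vector) \<Rightarrow> 'b::real_normed_vector) \<Rightarrow> bool" where
  "multilinear_bounded_by n C A \<longleftrightarrow>
    (\<forall>h h'. (\<forall>i<n. h i = h' i) \<longrightarrow> A h = A h') \<and>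
    (\<forall>h. \<forall>i<n. linear (\<lambda>v. A (h(i := v)))) \<and>
    0 \<le> C \<and> (\<forall>h. norm (A h) \<le> C * (\<Prod>i<n. norm (h i)))"

definition real_analytic_at :: "('a::banach \<Rightarrow> 'b::banach) \<Rightarrow> 'a \<Rightarrow> bool" where
  "real_analytic_at f x \<longleftrightarrow> (\<exists>r>0. \<exists>C A. (\<forall>n. multilinear_bounded_by n (C n) (A n)) \<and>
    summable (\<lambda>n. C n * r ^ n) \<and> (\<forall>h. norm h < r \<longrightarrow> (\<lambda>n. A n (\<lambda>_. h)) sums f (x + h)))"

definition analytic_diffeo :: "'a::banach set \<Rightarrow> 'b::banach set \<Rightarrow> ('a \<Rightarrow> 'b) \<Rightarrow> bool" where
  "analytic_diffeo V W f \<longleftrightarrow> open V \<and> open W \<and> f ` V = W \<and> (\<forall>x\<in>V. real_analytic_at f x) \<and>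
    (\<exists>g. (\<forall>x\<in>V. g (f x) = x) \<and> (\<forall>y\<in>W. real_analytic_at g y))"

definition closed_complements :: "'a::real_normed_vector set \<Rightarrow> 'a set \<Rightarrow> bool" where
  "closed_complements F G \<longleftrightarrow> subspace F \<and> closed F \<and> subspace G \<and> closed G \<and>
    F \<inter> G = {0} \<and> (\<forall>x. \<exists>u\<in>F. \<exists>v\<in>G. x = u + v)"

text \<open>Lang's definition: around each of its points \<open>M\<close> is the slice \<open>V\<^sub>1 \<times> {c}\<close> in some
  chart of the ambient space onto a product \<open>V\<^sub>1 \<times> V\<^sub>2\<close> of open subsets of Banach spaces.
  As the derivative of the chart is a toplinear isomorphism, the two factors may be taken to be
  complementary closed subspaces \<open>F\<close>, \<open>G\<close> of the ambient space, with \<open>F \<times> G\<close> identified with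
  it by addition.\<close>

definition analytic_submanifold :: "'a::banach set \<Rightarrow> bool" where
  "analytic_submanifold M \<longleftrightarrow> (\<forall>x\<in>M. \<exists>V (\<psi> :: 'a \<Rightarrow> 'a) F G V\<^sub>1 V\<^sub>2 c.
    x \<in> V \<and> closed_complements F G \<and>
    openin (top_of_set F) V\<^sub>1 \<and> openin (top_of_set G) V\<^sub>2 \<and> c \<in> V\<^sub>2 \<and>
    analytic_diffeo V {u + v | u v. u \<in> V\<^sub>1 \<and> v \<in> V\<^sub>2} \<psi> \<and>
    \<psi> ` (M \<inter> V) = {u + c | u. u \<in> V\<^sub>1})"

end

theory Submission
  imports Defs
begin

text \<open>By the spectral theorem \<open>a\<close> is diagonal in some orthonormal basis, and the \<open>C\<^sup>*\<close>-algebra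
  generated by \<open>a\<close> and \<open>1\<close> is finite dimensional iff \<open>a\<close> has finitely many eigenvalues.

  If the eigenvalues are finite in number, let \<open>p\<^sub>r\<close> be the spectral projections,
  \<open>D y = \<Sum>r. p\<^sub>r y p\<^sub>r\<close> the block diagonal part of \<open>y\<close> and
  \<open>K u = \<Sum>r\<noteq>s. (s - r)\<^sup>-\<^sup>1 p\<^sub>r u p\<^sub>s\<close>, which is skew-adjoint with \<open>[K u, a] = u - D u\<close>. The map
  \<open>y \<mapsto> exp (K y) (a + D y) exp (- K y)\<close> is a power series with derivative the identity at \<open>0\<close>, hence
  its local inverse is a chart by the analytic inverse function theorem; as a small block diagonal
  \<open>v\<close> with \<open>a + v\<close> in the orbit vanishes, the orbit is the slice \<open>D y = 0\<close>.

  If there are infinitely many eigenvalues, moving only very small ones to other basis vectors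
  gives operators arbitrarily close to \<open>a\<close>, in the closure of the orbit, whose kernel is trivial
  iff that of \<open>a\<close> is not. So the orbit is not locally closed at \<open>a\<close>.\<close>

section \<open>Bounded multilinear maps\<close>

text \<open>Finitely many eigenvalues have a gap. It bounds the denominators \<open>s - r\<close>,
  so that \<open>K\<close> is a bounded linear map with skew-adjoint values, and it isolates
  \<open>a\<close> among the block diagonal perturbations: if \<open>v\<close> commutes with the
  spectral projections and is smaller than the gap, it cannot carry an eigenvalue of one block to
  that of another, so equality of spectra forces \<open>v = 0\<close>. The summand
  \<open>D y\<close> is placed inside the exponential because the linear term of the parametrisation
  is then exactly \<open>[K y, a] + D y = y\<close>; hence only series with identity linear part
  have to be inverted. Their inverse is built degree by degree, and its convergence is read off from
  the same recursion on norms.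

  In the infinite case the contradiction comes from a slice being closed in the domain of its chart.
  Injectivity is a unitary invariant that norm limits do not respect. Square summability lets
  finitely many basis vectors carry almost the whole norm; separability makes the basis countable,
  so the remaining nonzero eigenvalues can be matched bijectively with whichever infinite set of
  remaining basis vectors gives the wrong kernel.\<close>

lemma multilinear_bounded_byD:
  assumes "multilinear_bounded_by n C A"
  shows multilinear_bounded_by_cong: "(\<And>i. i < n \<Longrightarrow> h i = h' i) \<Longrightarrow> A h = A h'"
    and multilinear_bounded_by_linear: "i < n \<Longrightarrow> linear (\<lambda>v. A (h(i := v)))"
    and multilinear_bounded_by_nonneg: "0 \<le> C"
    and multilinear_bounded_by_norm: "norm (A h) \<le> C * (\<Prod>i<n. norm (h i))"
  using assms unfolding multilinear_bounded_by_def by blast+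

lemma multilinear_bounded_byI:
  assumes "\<And>h h'. (\<And>i. i < n \<Longrightarrow> h i = h' i) \<Longrightarrow> A h = A h'"
    and "\<And>h i. i < n \<Longrightarrow> linear (\<lambda>v. A (h(i := v)))"
    and "0 \<le> C" "\<And>h. norm (A h) \<le> C * (\<Prod>i<n. norm (h i))"
  shows "multilinear_bounded_by n C A"
  using assms unfolding multilinear_bounded_by_def by blast

lemma sum_PiE_lessThan_Suc:
  fixes g :: "(nat \<Rightarrow> 'b) \<Rightarrow> 'c::comm_monoid_add"
  shows "sum g (PiE {..<Suc k} (\<lambda>_. J)) = (\<Sum>\<sigma>\<in>PiE {..<k} (\<lambda>_. J). \<Sum>j\<in>J. g (\<sigma>(k := j)))"
proof -
  have "PiE {..<Suc k} (\<lambda>_. J) = (\<lambda>(y, g). g(k := y)) ` (J \<times> PiE {..<k} (\<lambda>_. J))"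
    by (simp add: lessThan_Suc PiE_insert_eq)
  then have "sum g (PiE {..<Suc k} (\<lambda>_. J)) = (\<Sum>(y, \<sigma>)\<in>J \<times> PiE {..<k} (\<lambda>_. J). g (\<sigma>(k := y)))"
    using inj_combinator[of k "{..<k}" "\<lambda>_. J"] by (simp add: sum.reindex case_prod_unfold o_def)
  also have "\<dots> = (\<Sum>j\<in>J. \<Sum>\<sigma>\<in>PiE {..<k} (\<lambda>_. J). g (\<sigma>(k := j)))"
    by (simp add: sum.cartesian_product)
  finally show ?thesis by (simp add: sum.swap[of _ J])
qed

text \<open>Distributivity in all slots at once: a tuple \<open>\<sigma>\<close> records which
  summand is chosen in each of the \<open>n\<close> slots.\<close>

lemma multilinear_expand_sum:
  assumes A: "multilinear_bounded_by n C A" and J: "finite J"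
  shows "A (\<lambda>i. \<Sum>j\<in>J. w i j) = (\<Sum>\<sigma>\<in>PiE {..<n} (\<lambda>_. J). A (\<lambda>i. w i (\<sigma> i)))"
proof -
  \<comment> \<open>The first \<open>k\<close> slots are expanded and the others frozen at
    \<open>z\<close>. Generalising over \<open>z\<close> allows slot \<open>k\<close> to hold first
    its whole sum and then a single summand.\<close>
  have "k \<le> n \<Longrightarrow> A (\<lambda>i. if i < k then \<Sum>j\<in>J. w i j else z i)
      = (\<Sum>\<sigma>\<in>PiE {..<k} (\<lambda>_. J). A (\<lambda>i. if i < k then w i (\<sigma> i) else z i))" for k z
  proof (induction k arbitrary: z)
    case (Suc k)
    let ?z = "\<lambda>v. z(k := v)"
    have lin: "linear (\<lambda>v. A ((\<lambda>i. if i < k then w i (\<sigma> i) else z i)(k := v)))" for \<sigma>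
      using Suc.prems by (intro multilinear_bounded_by_linear[OF A]) simp
    have e: "(\<lambda>i. if i < k then w i (\<sigma> i) else ?z v i) = (\<lambda>i. if i < k then w i (\<sigma> i) else z i)(k := v)"
      for \<sigma> v by auto
    have "(\<lambda>i. if i < Suc k then \<Sum>j\<in>J. w i j else z i) =
        (\<lambda>i. if i < k then \<Sum>j\<in>J. w i j else ?z (\<Sum>j\<in>J. w k j) i)" by (auto simp: less_Suc_eq)
    then have "A (\<lambda>i. if i < Suc k then \<Sum>j\<in>J. w i j else z i)
        = (\<Sum>\<sigma>\<in>PiE {..<k} (\<lambda>_. J). A (\<lambda>i. if i < k then w i (\<sigma> i) else ?z (\<Sum>j\<in>J. w k j) i))"
      using Suc by simp
    also have "\<dots> = (\<Sum>\<sigma>\<in>PiE {..<k} (\<lambda>_. J). \<Sum>j\<in>J. A (\<lambda>i. if i < k then w i (\<sigma> i) else ?z (w k j) i))"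
      unfolding e linear_sum[OF lin] ..
    also have "\<dots> = (\<Sum>\<sigma>\<in>PiE {..<k} (\<lambda>_. J). \<Sum>j\<in>J. A (\<lambda>i. if i < Suc k then w i ((\<sigma>(k := j)) i) else z i))"
    proof (rule sum.cong[OF refl], rule sum.cong[OF refl])
      fix \<sigma> j
      have "(\<lambda>i. if i < k then w i (\<sigma> i) else ?z (w k j) i) =
          (\<lambda>i. if i < Suc k then w i ((\<sigma>(k := j)) i) else z i)" by (auto simp: less_Suc_eq)
      then show "A (\<lambda>i. if i < k then w i (\<sigma> i) else ?z (w k j) i) =
          A (\<lambda>i. if i < Suc k then w i ((\<sigma>(k := j)) i) else z i)" by simp
    qed
    finally show ?case by (simp add: sum_PiE_lessThan_Suc)
  qed simp
  from this[of n "\<lambda>_. 0"] have "A (\<lambda>i. if i < n then \<Sum>j\<in>J. w i j else 0)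
      = (\<Sum>\<sigma>\<in>PiE {..<n} (\<lambda>_. J). A (\<lambda>i. if i < n then w i (\<sigma> i) else 0))" by simp
  moreover have "A (\<lambda>i. if i < n then g i else 0) = A g" for g
    by (rule multilinear_bounded_by_cong[OF A]) simp
  ultimately show ?thesis by simp
qed

lemma multilinear_bounded_by_sum:
  assumes "finite S" "\<And>s. s \<in> S \<Longrightarrow> multilinear_bounded_by n (C s) (A s)"
  shows "multilinear_bounded_by n (\<Sum>s\<in>S. C s) (\<lambda>h. \<Sum>s\<in>S. A s h)"
proof (rule multilinear_bounded_byI)
  show "(\<Sum>s\<in>S. A s h) = (\<Sum>s\<in>S. A s h')" if "\<And>i. i < n \<Longrightarrow> h i = h' i" for h h'
    by (intro sum.cong refl multilinear_bounded_by_cong[OF assms(2)] that)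
  show "linear (\<lambda>v. \<Sum>s\<in>S. A s (h(i := v)))" if "i < n" for h i
    by (intro linear_compose_sum ballI multilinear_bounded_by_linear[OF assms(2)] that)
  show "0 \<le> sum C S" by (intro sum_nonneg multilinear_bounded_by_nonneg[OF assms(2)])
  show "norm (\<Sum>s\<in>S. A s h) \<le> sum C S * (\<Prod>i<n. norm (h i))" for h
    unfolding sum_distrib_right by (intro sum_norm_le multilinear_bounded_by_norm[OF assms(2)])
qed

lemma multilinear_bounded_by_summable:
  fixes A :: "nat \<Rightarrow> (nat \<Rightarrow> 'a::real_normed_vector) \<Rightarrow> 'b::banach"
  assumes "\<And>s. multilinear_bounded_by n (C s) (A s)" "summable C"
  shows "summable (\<lambda>s. norm (A s h))"
  by (rule summable_comparison_test'[OF summable_mult2[OF assms(2), of "\<Prod>i<n. norm (h i)"]])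
     (simp add: multilinear_bounded_by_norm[OF assms(1)])

text \<open>Needed when a power series is re-expanded at another point: the new coefficient of
  degree \<open>n\<close> collects contributions from infinitely many old degrees and must again be
  bounded and multilinear.\<close>

lemma multilinear_bounded_by_suminf:
  fixes A :: "nat \<Rightarrow> (nat \<Rightarrow> 'a::real_normed_vector) \<Rightarrow> 'b::banach"
  assumes A: "\<And>s. multilinear_bounded_by n (C s) (A s)" and C: "summable C"
  shows "multilinear_bounded_by n (\<Sum>s. C s) (\<lambda>h. \<Sum>s. A s h)"
proof (rule multilinear_bounded_byI)
  note sm = summable_norm_cancel[OF multilinear_bounded_by_summable[OF assms]]
  show "(\<Sum>s. A s h) = (\<Sum>s. A s h')" if "\<And>i. i < n \<Longrightarrow> h i = h' i" for h h'
    by (intro suminf_cong multilinear_bounded_by_cong[OF A] that)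
  show "linear (\<lambda>v. \<Sum>s. A s (h(i := v)))" if "i < n" for h i
  proof -
    note lin = multilinear_bounded_by_linear[OF A that, of _ h]
    show ?thesis
      by (intro linearI)
         (simp_all add: linear_add[OF lin] linear_scale[OF lin] suminf_add[OF sm sm] suminf_scaleR_right[OF sm])
  qed
  show "0 \<le> suminf C" by (intro suminf_nonneg C multilinear_bounded_by_nonneg[OF A])
  show "norm (\<Sum>s. A s h) \<le> suminf C * (\<Prod>i<n. norm (h i))" for h
  proof -
    have "norm (\<Sum>s. A s h) \<le> (\<Sum>s. norm (A s h))"
      by (rule summable_norm[OF multilinear_bounded_by_summable[OF assms]])
    also have "\<dots> \<le> (\<Sum>s. C s * (\<Prod>i<n. norm (h i)))"
      by (intro suminf_le multilinear_bounded_by_norm[OF A] multilinear_bounded_by_summable[OF assms]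
          summable_mult2 C)
    also have "\<dots> = suminf C * (\<Prod>i<n. norm (h i))" by (rule suminf_mult2[OF C, symmetric])
    finally show ?thesis .
  qed
qed

lemma multilinear_bounded_by_scale:
  assumes "multilinear_bounded_by n C A"
  shows "multilinear_bounded_by n (\<bar>c\<bar> * C) (\<lambda>h. c *\<^sub>R A h)"
proof (rule multilinear_bounded_byI)
  show "c *\<^sub>R A h = c *\<^sub>R A h'" if "\<And>i. i < n \<Longrightarrow> h i = h' i" for h h'
    using multilinear_bounded_by_cong[OF assms that] by simp
  show "linear (\<lambda>v. c *\<^sub>R A (h(i := v)))" if "i < n" for h i
    using multilinear_bounded_by_linear[OF assms that] by (rule linear_compose_scale_right)
  show "0 \<le> \<bar>c\<bar> * C" using multilinear_bounded_by_nonneg[OF assms] by simp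
  show "norm (c *\<^sub>R A h) \<le> \<bar>c\<bar> * C * (\<Prod>i<n. norm (h i))" for h
    using mult_left_mono[OF multilinear_bounded_by_norm[OF assms, of h], of "\<bar>c\<bar>"]
    by (simp add: mult_ac)
qed

section \<open>Composition of multilinear maps\<close>

text \<open>Numbers the arguments of a composition: \<open>(i, j)\<close> stands for argument
  \<open>j\<close> of the inner map in slot \<open>i\<close>. Any bijection serves, because norm
  bounds are symmetric in the arguments and the series are evaluated on constant sequences.\<close>

definition block_bij :: "nat \<Rightarrow> (nat \<Rightarrow> nat) \<Rightarrow> nat \<times> nat \<Rightarrow> nat" where
  "block_bij n \<sigma> = (SOME \<rho>. bij_betw \<rho> (SIGMA i:{..<n}. {..<\<sigma> i}) {..<sum \<sigma> {..<n}})"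

lemma block_bij: "bij_betw (block_bij n \<sigma>) (SIGMA i:{..<n}. {..<\<sigma> i}) {..<sum \<sigma> {..<n}}"
  unfolding block_bij_def
  by (rule someI_ex[of "\<lambda>\<rho>. bij_betw \<rho> (SIGMA i:{..<n}. {..<\<sigma> i}) {..<sum \<sigma> {..<n}}"],
      rule finite_same_card_bij) auto

text \<open>The inner map in slot \<open>i\<close> has degree \<open>\<sigma> i\<close>, and all
  inner maps receive separate arguments; the total degree is the sum of \<open>\<sigma>\<close>. The
  default \<open>0\<close> fills slots on which an \<open>n\<close>-linear \<open>A\<close> does not
  depend.\<close>

definition multilinear_compose ::
  "nat \<Rightarrow> ((nat \<Rightarrow> 'b::real_normed_vector) \<Rightarrow> 'c) \<Rightarrow> (nat \<Rightarrow> (nat \<Rightarrow> 'a) \<Rightarrow> 'b) \<Rightarrow> (nat \<Rightarrow> nat) \<Rightarrow> (nat \<Rightarrow> 'a) \<Rightarrow> 'c"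
where
  "multilinear_compose n A T \<sigma> h =
    A (\<lambda>i. if i < n then T (\<sigma> i) (\<lambda>j. h (block_bij n \<sigma> (i, j))) else 0)"

lemma multilinear_compose_diag:
  assumes "multilinear_bounded_by n C A"
  shows "multilinear_compose n A T \<sigma> (\<lambda>_. x) = A (\<lambda>i. T (\<sigma> i) (\<lambda>_. x))"
  unfolding multilinear_compose_def by (rule multilinear_bounded_by_cong[OF assms]) simp

text \<open>Every argument enters exactly one inner map, at exactly one place. Linearity in it is
  therefore linearity of that inner map followed by linearity of \<open>A\<close> in one slot, and
  the product of the inner norm bounds is reindexed along \<open>block_bij\<close>.\<close>

lemma multilinear_compose_bounded:
  assumes A: "multilinear_bounded_by n C A"
    and T: "\<And>i. i < n \<Longrightarrow> multilinear_bounded_by (\<sigma> i) (c (\<sigma> i)) (T (\<sigma> i))"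
    and k: "k = sum \<sigma> {..<n}"
  shows "multilinear_bounded_by k (C * (\<Prod>i<n. c (\<sigma> i))) (multilinear_compose n A T \<sigma>)"
proof (rule multilinear_bounded_byI)
  let ?\<rho> = "block_bij n \<sigma>"
  have lt: "?\<rho> (i, j) < k" if "i < n" "j < \<sigma> i" for i j
    using bij_betwE[OF block_bij[of n \<sigma>]] that k by simp
  show "multilinear_compose n A T \<sigma> h = multilinear_compose n A T \<sigma> h'" if "\<And>i. i < k \<Longrightarrow> h i = h' i" for h h'
    unfolding multilinear_compose_def
    by (rule multilinear_bounded_by_cong[OF A]) (auto intro!: multilinear_bounded_by_cong[OF T] that lt)
  show "0 \<le> C * (\<Prod>i<n. c (\<sigma> i))"
    by (auto intro!: mult_nonneg_nonneg prod_nonneg multilinear_bounded_by_nonneg[OF A]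
        multilinear_bounded_by_nonneg[OF T])
  show "norm (multilinear_compose n A T \<sigma> h) \<le> C * (\<Prod>i<n. c (\<sigma> i)) * (\<Prod>l<k. norm (h l))" for h
  proof -
    have "norm (multilinear_compose n A T \<sigma> h)
        \<le> C * (\<Prod>i<n. norm (T (\<sigma> i) (\<lambda>j. h (?\<rho> (i, j)))))"
      unfolding multilinear_compose_def
      by (rule order_trans[OF multilinear_bounded_by_norm[OF A]]) simp
    also have "\<dots> \<le> C * (\<Prod>i<n. c (\<sigma> i) * (\<Prod>j<\<sigma> i. norm (h (?\<rho> (i, j)))))"
      by (intro mult_left_mono prod_mono conjI multilinear_bounded_by_nonneg[OF A])
         (auto intro!: multilinear_bounded_by_norm[OF T])
    also have "\<dots> = C * (\<Prod>i<n. c (\<sigma> i)) * (\<Prod>i<n. \<Prod>j<\<sigma> i. norm (h (?\<rho> (i, j))))"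
      by (simp add: prod.distrib)
    also have "(\<Prod>i<n. \<Prod>j<\<sigma> i. norm (h (?\<rho> (i, j)))) =
        (\<Prod>p\<in>(SIGMA i:{..<n}. {..<\<sigma> i}). norm (h (?\<rho> p)))"
      by (subst prod.Sigma) (auto simp: case_prod_unfold)
    also have "\<dots> = (\<Prod>l<k. norm (h l))"
      unfolding k by (rule prod.reindex_bij_betw[OF block_bij])
    finally show ?thesis .
  qed
  show "linear (\<lambda>v. multilinear_compose n A T \<sigma> (h(l := v)))" if l: "l < k" for h l
  proof -
    obtain p q where pq: "p < n" "q < \<sigma> p" "?\<rho> (p, q) = l"
    proof -
      have "l \<in> ?\<rho> ` (SIGMA i:{..<n}. {..<\<sigma> i})"
        using block_bij[of n \<sigma>] l unfolding k bij_betw_def by simp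
      then show ?thesis using that by auto
    qed
    have uniq: "i = p \<and> j = q" if "i < n" "j < \<sigma> i" "?\<rho> (i, j) = l" for i j
      using inj_onD[OF bij_betw_imp_inj_on[OF block_bij[of n \<sigma>]], of "(i, j)" "(p, q)"] that pq by auto
    let ?w = "\<lambda>i. if i < n then T (\<sigma> i) (\<lambda>j. h (?\<rho> (i, j))) else 0"
    let ?u = "\<lambda>j. h (?\<rho> (p, j))"
    have "multilinear_compose n A T \<sigma> (h(l := v)) = A (?w(p := T (\<sigma> p) (?u(q := v))))" for v
      unfolding multilinear_compose_def
    proof (rule multilinear_bounded_by_cong[OF A])
      fix i assume i: "i < n"
      show "(if i < n then T (\<sigma> i) (\<lambda>j. (h(l := v)) (?\<rho> (i, j))) else 0) = (?w(p := T (\<sigma> p) (?u(q := v)))) i"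
      proof (cases "i = p")
        case True
        have "T (\<sigma> p) (\<lambda>j. (h(l := v)) (?\<rho> (p, j))) = T (\<sigma> p) (?u(q := v))"
        proof (rule multilinear_bounded_by_cong[OF T[OF pq(1)]])
          show "(h(l := v)) (?\<rho> (p, j)) = (?u(q := v)) j" if "j < \<sigma> p" for j
            using uniq[OF pq(1) that] pq(3) by (cases "j = q") auto
        qed
        then show ?thesis using True i by simp
      next
        case False
        have "T (\<sigma> i) (\<lambda>j. (h(l := v)) (?\<rho> (i, j))) = T (\<sigma> i) (\<lambda>j. h (?\<rho> (i, j)))"
        proof (rule multilinear_bounded_by_cong[OF T[OF i]])
          show "(h(l := v)) (?\<rho> (i, j)) = h (?\<rho> (i, j))" if "j < \<sigma> i" for j
            using uniq[OF i that] False by auto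
        qed
        then show ?thesis using False i by simp
      qed
    qed
    then have eq: "(\<lambda>v. multilinear_compose n A T \<sigma> (h(l := v))) =
        (\<lambda>z. A (?w(p := z))) \<circ> (\<lambda>v. T (\<sigma> p) (?u(q := v)))"
      by (simp add: fun_eq_iff)
    show ?thesis
      unfolding eq
      by (rule linear_compose[OF multilinear_bounded_by_linear[OF T[OF pq(1)] pq(2)]
          multilinear_bounded_by_linear[OF A pq(1)]])
  qed
qed

section \<open>Real analytic functions\<close>

text \<open>Every term of positive degree contains a factor \<open>norm h\<close>. Extracting it
  from the majorant series leaves the estimate
  \<open>norm (f (x + h) - f x) \<le> K * norm h\<close>.\<close>

lemma real_analytic_at_isCont:
  assumes "real_analytic_at f x"
  shows "isCont f x"
proof -
  obtain r C A where r: "r > 0" and A: "\<And>n. multilinear_bounded_by n (C n) (A n)"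
    and C: "summable (\<lambda>n. C n * r ^ n)" and f: "\<And>h. norm h < r \<Longrightarrow> (\<lambda>n. A n (\<lambda>_. h)) sums f (x + h)"
    using assms unfolding real_analytic_at_def by blast
  have nn: "0 \<le> C n * r ^ n" for n using multilinear_bounded_by_nonneg[OF A] r by simp
  define K where "K = (\<Sum>n. C n * r ^ n) / r"
  \<comment> \<open>At \<open>h = 0\<close> only the term of degree \<open>0\<close> survives, and a
    map of degree \<open>0\<close> depends on none of its arguments.\<close>
  have A0: "A 0 (\<lambda>_. h) = f x" for h
  proof -
    have z: "A n (\<lambda>_. 0) = 0" if "n \<noteq> 0" for n
      using multilinear_bounded_by_norm[OF A, of n "\<lambda>_. 0"] that by (simp add: power_0_left)
    have "(\<lambda>n. A n (\<lambda>_. 0)) sums A 0 (\<lambda>_. 0)"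
      using sums_finite[of "{0}" "\<lambda>n. A n (\<lambda>_. 0)"] z by simp
    moreover have "(\<lambda>n. A n (\<lambda>_. 0)) sums f x" using f[of 0] r by simp
    ultimately have "A 0 (\<lambda>_. 0) = f x" by (rule sums_unique2)
    moreover have "A 0 (\<lambda>_. h) = A 0 (\<lambda>_. 0)" by (rule multilinear_bounded_by_cong[OF A]) simp
    ultimately show ?thesis by simp
  qed
  have bound: "norm (f (x + h) - f x) \<le> norm h * K" if h: "norm h < r" for h
  proof -
    have le: "norm (A (Suc n) (\<lambda>_. h)) \<le> norm h / r * (C (Suc n) * r ^ Suc n)" for n
    proof -
      have "norm (A (Suc n) (\<lambda>_. h)) \<le> C (Suc n) * norm h ^ Suc n"
        using multilinear_bounded_by_norm[OF A, of "Suc n" "\<lambda>_. h"] by simp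
      also have "\<dots> \<le> C (Suc n) * (norm h * r ^ n)"
        using h by (auto intro!: mult_left_mono power_mono multilinear_bounded_by_nonneg[OF A])
      finally show ?thesis using r by (simp add: field_simps)
    qed
    have s: "summable (\<lambda>n. norm h / r * (C (Suc n) * r ^ Suc n))"
      by (intro summable_mult summable_ignore_initial_segment[of _ 1, simplified] C)
    have sn: "summable (\<lambda>n. norm (A (Suc n) (\<lambda>_. h)))"
      by (rule summable_comparison_test'[OF s]) (use le in simp)
    have "(\<lambda>n. A (Suc n) (\<lambda>_. h)) sums (f (x + h) - f x)"
      using f[OF h] A0[of h] by (subst sums_Suc_iff) simp
    then have "f (x + h) - f x = (\<Sum>n. A (Suc n) (\<lambda>_. h))" by (rule sums_unique)
    also have "norm \<dots> \<le> (\<Sum>n. norm (A (Suc n) (\<lambda>_. h)))" by (rule summable_norm[OF sn])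
    also have "\<dots> \<le> (\<Sum>n. norm h / r * (C (Suc n) * r ^ Suc n))" by (rule suminf_le[OF le sn s])
    also have "\<dots> = norm h / r * (\<Sum>n. C (Suc n) * r ^ Suc n)"
      using C summable_Suc_iff[of "\<lambda>n. C n * r ^ n"] by (intro suminf_mult) simp
    also have "\<dots> \<le> norm h / r * (\<Sum>n. C n * r ^ n)"
      using r suminf_split_head[OF C] nn[of 0] by (intro mult_left_mono) auto
    finally show ?thesis by (simp add: K_def)
  qed
  have "((\<lambda>h. f (x + h) - f x) \<longlongrightarrow> 0) (at 0)"
  proof (rule Lim_null_comparison)
    show "\<forall>\<^sub>F h in at 0. norm (f (x + h) - f x) \<le> norm h * K"
      using bound r by (auto simp: eventually_at dist_norm)
    show "((\<lambda>h. norm h * K) \<longlongrightarrow> 0) (at 0)" by (auto intro!: tendsto_eq_intros)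
  qed
  then show ?thesis using isCont_iff LIM_zero_iff by blast
qed

text \<open>Exchange of summation for a triangular array with majorant \<open>t\<close>. Rows
  \<open>n\<close> are finite and belong to the given series; columns \<open>k\<close> are the
  regrouped coefficients. It serves both the re-expansion of power series and Cauchy
  products.\<close>

lemma double_series:
  fixes a :: "nat \<Rightarrow> nat \<Rightarrow> 'b::banach"
  assumes le: "\<And>n k. norm (a n k) \<le> t n k" and z: "\<And>n k. n < k \<Longrightarrow> t n k = 0"
    and ts: "\<And>n. (\<Sum>k\<le>n. t n k) \<le> s n" and s: "summable s"
  shows "summable (\<lambda>n. t n k)"
    and "summable (\<lambda>k. \<Sum>n. t n k)"
    and "(\<lambda>k. \<Sum>n. a n k) sums (\<Sum>n. \<Sum>k\<le>n. a n k)"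
proof -
  have t0: "0 \<le> t n k" for n k by (rule order_trans[OF norm_ge_zero le])
  have fin: "(\<Sum>k<K. t n k) \<le> s n" for n K
  proof -
    have "(\<Sum>k<K. t n k) \<le> (\<Sum>k\<le>n + K. t n k)" by (intro sum_mono2) (auto simp: t0)
    also have "\<dots> = (\<Sum>k\<le>n. t n k)" by (rule sum.mono_neutral_right) (auto simp: z)
    finally show ?thesis using ts order_trans by blast
  qed
  have one: "t n k \<le> s n" for n k
    using member_le_sum[of k "{..<Suc k}" "t n"] t0 fin[of n "Suc k"] by (simp del: sum.lessThan_Suc)
  show sk: "summable (\<lambda>n. t n k)" for k
    by (rule summable_comparison_test'[OF s]) (use one t0 in auto)
  have part: "(\<Sum>k<K. \<Sum>n. t n k) \<le> suminf s" for K
  proof -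
    have "(\<Sum>k<K. \<Sum>n. t n k) = (\<Sum>n. \<Sum>k<K. t n k)" by (rule suminf_sum[symmetric]) (rule sk)
    also have "\<dots> \<le> suminf s" by (intro suminf_le fin summable_sum sk s)
    finally show ?thesis .
  qed
  show "summable (\<lambda>k. \<Sum>n. t n k)"
    by (rule summableI_nonneg_bounded[where x = "suminf s"]) (use part in \<open>auto intro!: suminf_nonneg sk t0\<close>)
  have s0: "0 \<le> s n" for n using one[of n 0] t0[of n 0] by linarith
  have "(\<lambda>(k, n). norm (a n k)) summable_on UNIV \<times> UNIV"
  proof (rule nonneg_bdd_above_summable_on)
    show "bdd_above (sum (\<lambda>(k, n). norm (a n k)) ` {F. F \<subseteq> UNIV \<times> UNIV \<and> finite F})"
    proof (rule bdd_aboveI2)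
      fix F :: "(nat \<times> nat) set" assume "F \<in> {F. F \<subseteq> UNIV \<times> UNIV \<and> finite F}"
      then have F: "finite F" by simp
      obtain K where K: "fst ` F \<subseteq> {..<K}" "snd ` F \<subseteq> {..<K}"
        using F finite_nat_iff_bounded[of "fst ` F \<union> snd ` F"] by auto
      have "F \<subseteq> {..<K} \<times> {..<K}" using K by force
      then have "(\<Sum>(k, n)\<in>F. norm (a n k)) \<le> (\<Sum>(k, n)\<in>{..<K} \<times> {..<K}. norm (a n k))"
        by (intro sum_mono2) auto
      also have "\<dots> = (\<Sum>k<K. \<Sum>n<K. norm (a n k))" by (simp add: sum.cartesian_product)
      also have "\<dots> \<le> (\<Sum>k<K. \<Sum>n. t n k)"
      proof (rule sum_mono)
        fix k
        have "(\<Sum>n<K. norm (a n k)) \<le> (\<Sum>n<K. t n k)" by (intro sum_mono le)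
        also have "\<dots> \<le> (\<Sum>n. t n k)" by (intro sum_le_suminf sk) (auto simp: t0)
        finally show "(\<Sum>n<K. norm (a n k)) \<le> (\<Sum>n. t n k)" .
      qed
      also have "\<dots> \<le> suminf s" by (rule part)
      finally show "(\<Sum>(k, n)\<in>F. norm (a n k)) \<le> suminf s" .
    qed
  qed (simp add: case_prod_unfold)
  then have "(\<lambda>p. norm (case p of (k, n) \<Rightarrow> a n k)) summable_on UNIV \<times> UNIV"
    unfolding case_prod_unfold .
  then have abs: "(\<lambda>(k, n). a n k) summable_on UNIV \<times> UNIV"
    by (rule abs_summable_summable)
  have inner: "(\<Sum>\<^sub>\<infinity>n. a n k) = (\<Sum>n. a n k)" for k
  proof (rule infsumI, rule norm_summable_imp_has_sum)
    show n: "summable (\<lambda>n. norm (a n k))"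
      by (rule summable_comparison_test'[OF sk[of k]]) (use le in simp)
    show "(\<lambda>n. a n k) sums (\<Sum>n. a n k)" by (rule summable_sums[OF summable_norm_cancel[OF n]])
  qed
  have outer: "(\<Sum>\<^sub>\<infinity>k. a n k) = (\<Sum>k\<le>n. a n k)" for n
  proof -
    have "a n k = 0" if "k \<notin> {..n}" for k using le[of n k] z[of n k] that by auto
    then have "(\<Sum>\<^sub>\<infinity>k. a n k) = (\<Sum>\<^sub>\<infinity>k\<in>{..n}. a n k)" by (intro infsum_cong_neutral) auto
    then show ?thesis by simp
  qed
  have "(\<lambda>k. \<Sum>\<^sub>\<infinity>n. a n k) summable_on UNIV"
    using summable_on_Sigma_banach[OF abs] by simp
  from has_sum_imp_sums[OF has_sum_infsum[OF this]]
  have "(\<lambda>k. \<Sum>n. a n k) sums (\<Sum>\<^sub>\<infinity>k. \<Sum>\<^sub>\<infinity>n. a n k)" by (simp add: inner)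
  also have "(\<Sum>\<^sub>\<infinity>k. \<Sum>\<^sub>\<infinity>n. a n k) = (\<Sum>\<^sub>\<infinity>n. \<Sum>\<^sub>\<infinity>k. a n k)"
    using infsum_swap_banach[OF abs] by simp
  also have "\<dots> = (\<Sum>\<^sub>\<infinity>n. \<Sum>k\<le>n. a n k)" by (simp add: outer)
  also have "\<dots> = (\<Sum>n. \<Sum>k\<le>n. a n k)"
  proof (rule infsumI, rule norm_summable_imp_has_sum)
    have "norm (\<Sum>k\<le>n. a n k) \<le> s n" for n
      using order_trans[OF sum_norm_le[of "{..n}" "a n" "t n"] ts] le by blast
    then show n: "summable (\<lambda>n. norm (\<Sum>k\<le>n. a n k))"
      by (intro summable_comparison_test'[OF s]) auto
    show "(\<lambda>n. \<Sum>k\<le>n. a n k) sums (\<Sum>n. \<Sum>k\<le>n. a n k)"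
      by (rule summable_sums[OF summable_norm_cancel[OF n]])
  qed
  finally show "(\<lambda>k. \<Sum>n. a n k) sums (\<Sum>n. \<Sum>k\<le>n. a n k)" .
qed

section \<open>Degree bookkeeping for composed power series\<close>

text \<open>The ways to choose the degrees of \<open>n\<close> inner terms from \<open>J\<close>
  with total degree \<open>k\<close>, that is, the index set of the degree \<open>k\<close> part of
  an \<open>n\<close>-linear map applied to a series. Extensionality makes the set finite for finite
  \<open>J\<close>.\<close>

definition index_tuples :: "nat set \<Rightarrow> nat \<Rightarrow> nat \<Rightarrow> (nat \<Rightarrow> nat) set" where
  "index_tuples J n k = {\<sigma> \<in> {..<n} \<rightarrow>\<^sub>E J. sum \<sigma> {..<n} = k}"

lemma finite_index_tuples: "finite J \<Longrightarrow> finite (index_tuples J n k)"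
  unfolding index_tuples_def by (rule finite_subset[OF _ finite_PiE[of "{..<n}" "\<lambda>_. J"]]) auto

lemma sum_index_tuples:
  assumes "finite J"
  shows "(\<Sum>k\<le>K. \<Sum>\<sigma>\<in>index_tuples J n k. g \<sigma>) = (\<Sum>\<sigma>\<in>{\<sigma> \<in> {..<n} \<rightarrow>\<^sub>E J. sum \<sigma> {..<n} \<le> K}. g \<sigma>)"
proof -
  have "index_tuples J n k = {\<sigma> \<in> {\<sigma> \<in> {..<n} \<rightarrow>\<^sub>E J. sum \<sigma> {..<n} \<le> K}. sum \<sigma> {..<n} = k}"
    if "k \<le> K" for k using that by (auto simp: index_tuples_def)
  then have "(\<Sum>k\<le>K. \<Sum>\<sigma>\<in>index_tuples J n k. g \<sigma>) =
      (\<Sum>k\<le>K. \<Sum>\<sigma>\<in>{\<sigma> \<in> {\<sigma> \<in> {..<n} \<rightarrow>\<^sub>E J. sum \<sigma> {..<n} \<le> K}. sum \<sigma> {..<n} = k}. g \<sigma>)"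
    by (intro sum.cong) auto
  also have "\<dots> = (\<Sum>\<sigma>\<in>{\<sigma> \<in> {..<n} \<rightarrow>\<^sub>E J. sum \<sigma> {..<n} \<le> K}. g \<sigma>)"
  proof (rule sum.group)
    show "finite {\<sigma> \<in> {..<n} \<rightarrow>\<^sub>E J. sum \<sigma> {..<n} \<le> K}"
      by (rule finite_subset[OF _ finite_PiE[of "{..<n}" "\<lambda>_. J"]]) (use assms in auto)
  qed auto
  finally show ?thesis .
qed

text \<open>Majorants compose like the series themselves: without a restriction on the total degree,
  the weights of all tuples add up to a full power of the inner majorant.\<close>

lemma sum_PiE_weights:
  fixes c :: "nat \<Rightarrow> real"
  assumes "finite J"
  shows "(\<Sum>\<sigma>\<in>{..<n} \<rightarrow>\<^sub>E J. C * (\<Prod>i<n. c (\<sigma> i)) * t ^ sum \<sigma> {..<n}) = C * (\<Sum>j\<in>J. c j * t ^ j) ^ n"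
proof -
  have "(\<Sum>j\<in>J. c j * t ^ j) ^ n = (\<Prod>i<n. \<Sum>j\<in>J. c j * t ^ j)" by simp
  also have "\<dots> = (\<Sum>\<sigma>\<in>{..<n} \<rightarrow>\<^sub>E J. \<Prod>i<n. c (\<sigma> i) * t ^ \<sigma> i)"
    by (rule prod_sum_PiE) (use assms in auto)
  finally show ?thesis by (simp add: sum_distrib_left prod.distrib power_sum mult_ac)
qed

text \<open>In \<open>A n\<close> at \<open>d + h\<close> each slot chooses \<open>d\<close> or
  \<open>h\<close>. Regrouping by the number \<open>k\<close> of slots that hold \<open>h\<close>
  gives the power series at the shifted point, convergent up to the distance
  \<open>r - norm d\<close> to the boundary of the ball.\<close>

theorem real_analytic_at_eventually:
  fixes f :: "'a::banach \<Rightarrow> 'b::banach"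
  assumes "real_analytic_at f x"
  shows "\<exists>r>0. \<forall>y. dist y x < r \<longrightarrow> real_analytic_at f y"
proof -
  obtain r C A where r: "r > 0" and A: "\<And>n. multilinear_bounded_by n (C n) (A n)"
    and C: "summable (\<lambda>n. C n * r ^ n)" and f: "\<And>h. norm h < r \<Longrightarrow> (\<lambda>n. A n (\<lambda>_. h)) sums f (x + h)"
    using assms unfolding real_analytic_at_def by blast
  have "real_analytic_at f (x + d)" if d: "norm d < r" for d
  proof -
    define \<rho> where "\<rho> = r - norm d"
    have \<rho>: "\<rho> > 0" using d by (simp add: \<rho>_def)
    \<comment> \<open>The translation \<open>d + h\<close> as a polynomial in \<open>h\<close>:
      \<open>T 0\<close> is the constant \<open>d\<close> and \<open>T 1\<close> the identity. Its
      majorant \<open>norm d + \<rho>\<close> equals \<open>r\<close>, so the regrouped bounds add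
      up to the given series \<open>C n * r ^ n\<close>.\<close>
    define T where "T m = (if m = 0 then (\<lambda>_. d) else (\<lambda>h :: nat \<Rightarrow> _. h 0))" for m :: nat
    define c where "c m = (if m = 0 then norm d else 1)" for m :: nat
    define J where "J = {0, 1::nat}"
    have J: "finite J" by (simp add: J_def)
    have T: "multilinear_bounded_by m (c m) (T m)" if "m \<in> J" for m
      using that by (auto simp: J_def T_def c_def multilinear_bounded_by_def linear_iff)
    define b where "b n k h = (\<Sum>\<sigma>\<in>index_tuples J n k. multilinear_compose n (A n) T \<sigma> h)" for n k h
    define e where "e n k = (\<Sum>\<sigma>\<in>index_tuples J n k. C n * (\<Prod>i<n. c (\<sigma> i)))" for n k
    have b: "multilinear_bounded_by k (e n k) (b n k)" for n k
      unfolding b_def[abs_def] e_def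
    proof (rule multilinear_bounded_by_sum[OF finite_index_tuples[OF J]], rule multilinear_compose_bounded[OF A])
      fix \<sigma> assume \<sigma>: "\<sigma> \<in> index_tuples J n k"
      then show "k = sum \<sigma> {..<n}" by (simp add: index_tuples_def)
      show "multilinear_bounded_by (\<sigma> i) (c (\<sigma> i)) (T (\<sigma> i))" if "i < n" for i
        by (rule T) (use \<sigma> that in \<open>auto simp: index_tuples_def PiE_iff\<close>)
    qed
    have le_n: "sum \<sigma> {..<n} \<le> n" if "\<sigma> \<in> {..<n} \<rightarrow>\<^sub>E J" for \<sigma> n
    proof -
      have "\<sigma> i \<le> 1" if "i \<in> {..<n}" for i
        using PiE_mem[OF \<open>\<sigma> \<in> {..<n} \<rightarrow>\<^sub>E J\<close> that] by (auto simp: J_def)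
      then have "sum \<sigma> {..<n} \<le> (\<Sum>i<n. 1)" by (rule sum_mono)
      then show ?thesis by simp
    qed
    then have all: "{\<sigma> \<in> {..<n} \<rightarrow>\<^sub>E J. sum \<sigma> {..<n} \<le> n} = {..<n} \<rightarrow>\<^sub>E J" for n by blast
    have e0: "e n k = 0" if "n < k" for n k
    proof -
      have "index_tuples J n k = {}"
        using le_n[of _ n] that unfolding index_tuples_def by (auto dest!: leD)
      then show ?thesis by (simp add: e_def)
    qed
    have e_sum: "(\<Sum>k\<le>n. e n k * \<rho> ^ k) = C n * r ^ n" for n
    proof -
      have "(\<Sum>k\<le>n. e n k * \<rho> ^ k) =
          (\<Sum>k\<le>n. \<Sum>\<sigma>\<in>index_tuples J n k. C n * (\<Prod>i<n. c (\<sigma> i)) * \<rho> ^ sum \<sigma> {..<n})"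
        unfolding e_def sum_distrib_right by (intro sum.cong) (auto simp: index_tuples_def)
      also have "\<dots> = C n * (\<Sum>j\<in>J. c j * \<rho> ^ j) ^ n"
        unfolding sum_index_tuples[OF J] all by (rule sum_PiE_weights[OF J])
      also have "(\<Sum>j\<in>J. c j * \<rho> ^ j) = r" by (simp add: J_def c_def \<rho>_def)
      finally show ?thesis .
    qed
    have e_nn: "0 \<le> e n k" for n k by (rule multilinear_bounded_by_nonneg[OF b])
    have le1: "norm (b n k (\<lambda>_. h)) \<le> e n k * \<rho> ^ k" if "norm h < \<rho>" for n k h
    proof -
      have "norm (b n k (\<lambda>_. h)) \<le> e n k * norm h ^ k"
        using multilinear_bounded_by_norm[OF b, of n k "\<lambda>_. h"] by simp
      also have "\<dots> \<le> e n k * \<rho> ^ k" using that by (intro mult_left_mono power_mono e_nn) auto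
      finally show ?thesis .
    qed
    have s1: "summable (\<lambda>n. e n k)" and s2: "summable (\<lambda>k. (\<Sum>n. e n k) * \<rho> ^ k)" for k
    proof -
      have q: "norm (e n k * \<rho> ^ k) \<le> e n k * \<rho> ^ k" for n k using e_nn \<rho> by simp
      have z: "n < k \<Longrightarrow> e n k * \<rho> ^ k = 0" for n k using e0 by simp
      note D = double_series[OF q z eq_refl[OF e_sum] C]
      show s1: "summable (\<lambda>n. e n k)" for k
        using summable_mult2[OF D(1)[of k], of "inverse (\<rho> ^ k)"] \<rho> by (simp add: mult.assoc)
      show "summable (\<lambda>k. (\<Sum>n. e n k) * \<rho> ^ k)"
        using D(2) by (simp add: suminf_mult2[OF s1])
    qed
    show ?thesis
      unfolding real_analytic_at_def
    proof (intro exI conjI allI impI)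
      show "\<rho> > 0" by (rule \<rho>)
      show "multilinear_bounded_by k (\<Sum>n. e n k) (\<lambda>h. \<Sum>n. b n k h)" for k
        by (rule multilinear_bounded_by_suminf[OF b s1])
      show "summable (\<lambda>k. (\<Sum>n. e n k) * \<rho> ^ k)" by (rule s2)
      fix h :: 'a assume h: "norm h < \<rho>"
      have z: "n < k \<Longrightarrow> e n k * \<rho> ^ k = 0" for n k using e0 by simp
      have "(\<lambda>k. \<Sum>n. b n k (\<lambda>_. h)) sums (\<Sum>n. \<Sum>k\<le>n. b n k (\<lambda>_. h))"
        by (rule double_series(3)[OF le1[OF h] z eq_refl[OF e_sum] C])
      also have "(\<Sum>k\<le>n. b n k (\<lambda>_. h)) = A n (\<lambda>_. d + h)" for n
      proof -
        have "(\<Sum>k\<le>n. b n k (\<lambda>_. h)) = (\<Sum>\<sigma>\<in>{..<n} \<rightarrow>\<^sub>E J. A n (\<lambda>i. T (\<sigma> i) (\<lambda>_. h)))"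
          unfolding b_def sum_index_tuples[OF J] all multilinear_compose_diag[OF A] ..
        also have "\<dots> = A n (\<lambda>i. \<Sum>j\<in>J. T j (\<lambda>_. h))"
          by (rule multilinear_expand_sum[OF A J, symmetric])
        finally show ?thesis by (simp add: J_def T_def)
      qed
      then have "(\<Sum>n. \<Sum>k\<le>n. b n k (\<lambda>_. h)) = (\<Sum>n. A n (\<lambda>_. d + h))" by simp
      also have "norm (d + h) < r" using h norm_triangle_ineq[of d h] by (simp add: \<rho>_def)
      then have "(\<Sum>n. A n (\<lambda>_. d + h)) = f (x + d + h)"
        using sums_unique[OF f] by (simp add: add.assoc)
      finally show "(\<lambda>k. \<Sum>n. b n k (\<lambda>_. h)) sums f (x + d + h)" .
    qed
  qed
  then have "real_analytic_at f y" if "dist y x < r" for y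
    using that by (metis add_diff_cancel_left' dist_norm add.commute diff_add_cancel)
  with r show ?thesis by blast
qed

section \<open>The analytic inverse function theorem\<close>

text \<open>At least two parts, each at least \<open>1\<close>: every part is smaller than the
  total. This is why the two recursions that follow terminate.\<close>

lemma index_tuples_less:
  assumes \<sigma>: "\<sigma> \<in> index_tuples {1..M} n m" and n: "2 \<le> n" and i: "i < n"
  shows "\<sigma> i < m"
proof -
  have ge: "1 \<le> \<sigma> j" if "j < n" for j using \<sigma> that by (auto simp: index_tuples_def PiE_iff)
  have "m = \<sigma> i + sum \<sigma> ({..<n} - {i})"
    using \<sigma> i by (simp add: index_tuples_def sum.remove[of "{..<n}" i])
  moreover have "card ({..<n} - {i}) \<le> sum \<sigma> ({..<n} - {i})"
    using sum_mono[of "{..<n} - {i}" "\<lambda>_. 1" \<sigma>] ge by simp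
  ultimately show ?thesis using n i by simp
qed

lemma index_tuples_empty:
  assumes "m < n" shows "index_tuples {1..M} n m = {}"
proof -
  have "n \<le> m" if \<sigma>: "\<sigma> \<in> index_tuples {1..M} n m" for \<sigma>
    using sum_mono[of "{..<n}" "\<lambda>_. 1" \<sigma>] \<sigma> by (auto simp: index_tuples_def PiE_iff)
  then show ?thesis using assms by fastforce
qed

text \<open>Parts of a total \<open>m\<close> are at most \<open>m - 1\<close>, so any cap from
  \<open>m - 1\<close> on gives the same tuples. The cap \<open>m\<close> of the recursions can thus
  be traded for one that is common to all degrees.\<close>

lemma index_tuples_bound:
  assumes "2 \<le> n" "m \<le> Suc M"
  shows "index_tuples {1..M} n m = index_tuples {1..m} n m"
proof -
  have "\<sigma> \<in> index_tuples {1..M'} n m" if \<sigma>: "\<sigma> \<in> index_tuples {1..M} n m" and "m \<le> Suc M'" for \<sigma> M M'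
  proof -
    have "\<sigma> i \<in> {1..M'}" if "i < n" for i
      using index_tuples_less[OF \<sigma> assms(1) that] \<sigma> \<open>m \<le> Suc M'\<close> that by (auto simp: index_tuples_def PiE_iff)
    then show ?thesis using \<sigma> by (simp add: index_tuples_def PiE_iff)
  qed
  from this[of _ M m] this[of _ m M] show ?thesis using assms(2) by auto
qed

text \<open>The coefficients of the compositional inverse \<open>g\<close> of \<open>\<Sum>n. A n\<close> with \<open>A 1\<close> the identity:
  compare the terms of degree \<open>m\<close> in \<open>g y = y - (\<Sum>n\<ge>2. A n (g y, \<dots>, g y))\<close>.\<close>

function inverse_coeff :: "(nat \<Rightarrow> (nat \<Rightarrow> 'a::real_normed_vector) \<Rightarrow> 'a) \<Rightarrow> nat \<Rightarrow> (nat \<Rightarrow> 'a) \<Rightarrow> 'a" where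
  "inverse_coeff A m h = (if m = 0 then 0 else if m = 1 then h 0 else
    - (\<Sum>n\<in>{2..m}. \<Sum>\<sigma>\<in>index_tuples {1..m} n m.
        A n (\<lambda>i. if i < n then inverse_coeff A (\<sigma> i) (\<lambda>j. h (block_bij n \<sigma> (i, j))) else 0)))"
  by auto
termination
  by (relation "Wellfounded.measure (\<lambda>(A, m, h). m)") (auto intro: index_tuples_less simp del: One_nat_def)

text \<open>The recursion of \<open>inverse_coeff\<close> with norm bounds for maps and without the
  sign: a majorant of the inverse series.\<close>

function inverse_bound :: "(nat \<Rightarrow> real) \<Rightarrow> nat \<Rightarrow> real" where
  "inverse_bound C m = (if m = 0 then 0 else if m = 1 then 1 else
    (\<Sum>n\<in>{2..m}. \<Sum>\<sigma>\<in>index_tuples {1..m} n m. C n * (\<Prod>i\<in>{..<n}. inverse_bound C (\<sigma> i))))"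
  by auto
termination
  by (relation "Wellfounded.measure (\<lambda>(C, m). m)") (auto intro: index_tuples_less simp del: One_nat_def)

declare inverse_coeff.simps [simp del] inverse_bound.simps [simp del]

lemma inverse_coeff_01 [simp]:
  "inverse_coeff A 0 h = 0" "inverse_coeff A (Suc 0) h = h 0"
  by (simp_all add: inverse_coeff.simps)

lemma inverse_bound_01 [simp]:
  "inverse_bound C 0 = 0" "inverse_bound C (Suc 0) = 1"
  by (simp_all add: inverse_bound.simps)

lemma inverse_coeff_bounded:
  assumes A: "\<And>n. multilinear_bounded_by n (C n) (A n)"
  shows "multilinear_bounded_by m (inverse_bound C m) (inverse_coeff A m)"
proof (induction m rule: less_induct)
  case (less m)
  consider "m = 0" | "m = 1" | "m \<ge> 2" by linarith
  then show ?case
  proof cases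
    case 3
    have "inverse_coeff A m = (\<lambda>h. (-1) *\<^sub>R (\<Sum>n\<in>{2..m}. \<Sum>\<sigma>\<in>index_tuples {1..m} n m.
        multilinear_compose n (A n) (inverse_coeff A) \<sigma> h))"
      using 3 by (simp add: fun_eq_iff inverse_coeff.simps[of A m] multilinear_compose_def)
    moreover have "inverse_bound C m = \<bar>- 1\<bar> * (\<Sum>n\<in>{2..m}. \<Sum>\<sigma>\<in>index_tuples {1..m} n m.
        C n * (\<Prod>i<n. inverse_bound C (\<sigma> i)))"
      using 3 by (simp add: inverse_bound.simps[of C m])
    moreover have "multilinear_bounded_by m (\<bar>- 1\<bar> * (\<Sum>n\<in>{2..m}. \<Sum>\<sigma>\<in>index_tuples {1..m} n m.
        C n * (\<Prod>i<n. inverse_bound C (\<sigma> i)))) (\<lambda>h. (-1) *\<^sub>R (\<Sum>n\<in>{2..m}. \<Sum>\<sigma>\<in>index_tuples {1..m} n m.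
        multilinear_compose n (A n) (inverse_coeff A) \<sigma> h))"
    proof (intro multilinear_bounded_by_scale multilinear_bounded_by_sum finite_index_tuples)
      fix n \<sigma> assume n: "n \<in> {2..m}" and \<sigma>: "\<sigma> \<in> index_tuples {1..m} n m"
      show "multilinear_bounded_by m (C n * (\<Prod>i<n. inverse_bound C (\<sigma> i)))
          (multilinear_compose n (A n) (inverse_coeff A) \<sigma>)"
      proof (rule multilinear_compose_bounded[OF A])
        show "m = sum \<sigma> {..<n}" using \<sigma> by (simp add: index_tuples_def)
        show "multilinear_bounded_by (\<sigma> i) (inverse_bound C (\<sigma> i)) (inverse_coeff A (\<sigma> i))"
          if "i < n" for i
          using less index_tuples_less[OF \<sigma> _ that] n by simp
      qed
    qed auto
    ultimately show ?thesis by simp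
  qed (auto simp: multilinear_bounded_by_def linear_iff)
qed

text \<open>If the partial sum up to degree \<open>M\<close> is at most \<open>2 * t\<close>, the
  terms of degree at least \<open>2\<close> of the next one are dominated by the sum of
  \<open>C n * (2 * t) ^ n\<close> over \<open>n \<ge> 2\<close>, hence by \<open>t\<close>. The
  linear term contributes another \<open>t\<close>, which restores the bound
  \<open>2 * t\<close>.\<close>

lemma inverse_bound_partial_sum:
  assumes C: "\<And>n. 0 \<le> C n" and t: "0 \<le> t"
    and small: "\<And>N. (\<Sum>n\<in>{2..N}. C n * (2 * t) ^ n) \<le> t"
  shows "(\<Sum>m\<in>{1..N}. inverse_bound C m * t ^ m) \<le> 2 * t"
proof (induction N)
  case 0
  then show ?case using t by simp
next
  case (Suc M)
  let ?b = "inverse_bound C" let ?N = "Suc M"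
  have b0: "0 \<le> ?b m" for m
  proof (induction m rule: less_induct)
    case (less m)
    consider "m = 0" | "m = 1" | "m \<ge> 2" by linarith
    then show ?case
    proof cases
      case 3
      have "0 \<le> C n * (\<Prod>i\<in>{..<n}. ?b (\<sigma> i))"
        if "n \<in> {2..m}" "\<sigma> \<in> index_tuples {1..m} n m" for n \<sigma>
        using that index_tuples_less[OF that(2)] less by (intro mult_nonneg_nonneg C prod_nonneg) auto
      then show ?thesis using 3 by (auto simp: inverse_bound.simps[of C m] intro!: sum_nonneg)
    qed auto
  qed
  let ?S = "\<Sum>m\<in>{1..M}. ?b m * t ^ m"
  have S0: "0 \<le> ?S" by (intro sum_nonneg mult_nonneg_nonneg b0) (use t in auto)
  let ?w = "\<lambda>n \<sigma>. C n * (\<Prod>i<n. ?b (\<sigma> i)) * t ^ sum \<sigma> {..<n}"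
  have w0: "0 \<le> ?w n \<sigma>" for n \<sigma> by (intro mult_nonneg_nonneg C prod_nonneg b0) (use t in auto)
  \<comment> \<open>Cap and range of \<open>n\<close> are made independent of \<open>m\<close>, so
    that the sums over \<open>m\<close> and \<open>n\<close> can be exchanged. Tuples of total at
    most \<open>Suc M\<close> have entries at most \<open>M\<close>, so only coefficients occurring
    in \<open>?S\<close> appear.\<close>
  have "?b m * t ^ m = (\<Sum>n\<in>{2..?N}. \<Sum>\<sigma>\<in>index_tuples {1..M} n m. ?w n \<sigma>)" if m: "m \<in> {2..?N}" for m
  proof -
    have "?b m * t ^ m = (\<Sum>n\<in>{2..m}. \<Sum>\<sigma>\<in>index_tuples {1..m} n m. ?w n \<sigma>)"
      using m inverse_bound.simps[of C m] by (simp add: sum_distrib_right index_tuples_def)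
    also have "\<dots> = (\<Sum>n\<in>{2..m}. \<Sum>\<sigma>\<in>index_tuples {1..M} n m. ?w n \<sigma>)"
      using m by (intro sum.cong refl index_tuples_bound[symmetric]) auto
    also have "\<dots> = (\<Sum>n\<in>{2..?N}. \<Sum>\<sigma>\<in>index_tuples {1..M} n m. ?w n \<sigma>)"
    proof (rule sum.mono_neutral_left)
      show "\<forall>n\<in>{2..?N} - {2..m}. (\<Sum>\<sigma>\<in>index_tuples {1..M} n m. ?w n \<sigma>) = 0"
        by (auto simp: index_tuples_empty simp del: One_nat_def)
    qed (use m in auto)
    finally show ?thesis .
  qed
  then have "(\<Sum>m\<in>{2..?N}. ?b m * t ^ m) = (\<Sum>m\<in>{2..?N}. \<Sum>n\<in>{2..?N}. \<Sum>\<sigma>\<in>index_tuples {1..M} n m. ?w n \<sigma>)"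
    by simp
  also have "\<dots> = (\<Sum>n\<in>{2..?N}. \<Sum>m\<in>{2..?N}. \<Sum>\<sigma>\<in>index_tuples {1..M} n m. ?w n \<sigma>)" by (rule sum.swap)
  also have "\<dots> \<le> (\<Sum>n\<in>{2..?N}. C n * (2 * t) ^ n)"
  proof (rule sum_mono)
    fix n assume "n \<in> {2..?N}"
    have "(\<Sum>m\<in>{2..?N}. \<Sum>\<sigma>\<in>index_tuples {1..M} n m. ?w n \<sigma>) \<le> (\<Sum>m\<le>?N. \<Sum>\<sigma>\<in>index_tuples {1..M} n m. ?w n \<sigma>)"
      by (intro sum_mono2) (auto intro!: sum_nonneg w0)
    also have "\<dots> = (\<Sum>\<sigma>\<in>{\<sigma> \<in> {..<n} \<rightarrow>\<^sub>E {1..M}. sum \<sigma> {..<n} \<le> ?N}. ?w n \<sigma>)"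
      by (rule sum_index_tuples) simp
    \<comment> \<open>Dropping the bound on the total degree completes the sum to the power
      \<open>?S ^ n\<close>, to which the induction hypothesis applies.\<close>
    also have "\<dots> \<le> (\<Sum>\<sigma>\<in>{..<n} \<rightarrow>\<^sub>E {1..M}. ?w n \<sigma>)"
      by (intro sum_mono2 w0 finite_PiE) auto
    also have "\<dots> = C n * ?S ^ n" by (rule sum_PiE_weights) simp
    also have "\<dots> \<le> C n * (2 * t) ^ n" by (intro mult_left_mono power_mono Suc.IH S0 C)
    finally show "(\<Sum>m\<in>{2..?N}. \<Sum>\<sigma>\<in>index_tuples {1..M} n m. ?w n \<sigma>) \<le> C n * (2 * t) ^ n" .
  qed
  also have "\<dots> \<le> t" by (rule small)
  finally have "(\<Sum>m\<in>{2..?N}. ?b m * t ^ m) \<le> t" .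
  moreover have "{1..?N} = insert 1 {2..?N}" by auto
  ultimately show ?case by simp
qed

text \<open>Analyticity at \<open>0\<close> with value \<open>0\<close> and derivative the identity,
  phrased through the coefficients themselves because the inverse is computed from them.\<close>

definition tangent_to_id :: "('a::banach \<Rightarrow> 'a) \<Rightarrow> bool" where
  "tangent_to_id f \<longleftrightarrow> (\<exists>r>0. \<exists>C A. (\<forall>n. multilinear_bounded_by n (C n) (A n)) \<and>
    summable (\<lambda>n. C n * r ^ n) \<and> (\<forall>h. norm h < r \<longrightarrow> (\<lambda>n. A n (\<lambda>_. h)) sums f h) \<and>
    (\<forall>h. A 0 h = 0) \<and> (\<forall>h. A 1 h = h 0))"

lemma tangent_to_id_analytic:
  assumes "tangent_to_id f"
  shows "real_analytic_at f 0"
proof -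
  obtain r C A where "r > 0" "\<forall>n. multilinear_bounded_by n (C n) (A n)"
    "summable (\<lambda>n. C n * r ^ n)" "\<forall>h. norm h < r \<longrightarrow> (\<lambda>n. A n (\<lambda>_. h)) sums f h"
    using assms unfolding tangent_to_id_def by blast
  then show ?thesis
    unfolding real_analytic_at_def by (intro exI[of _ r] conjI exI[of _ C] exI[of _ A]) auto
qed

lemma tangent_to_id_zero:
  assumes "tangent_to_id f"
  shows "f 0 = 0"
proof -
  obtain r C A where r: "r > 0" and A: "\<And>n. multilinear_bounded_by n (C n) (A n)"
    and f: "\<And>h. norm h < r \<Longrightarrow> (\<lambda>n. A n (\<lambda>_. h)) sums f h" and A0: "\<And>h. A 0 h = 0"
    using assms unfolding tangent_to_id_def by blast
  have "A n (\<lambda>_. 0) = 0" for n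
    using multilinear_bounded_by_norm[OF A, of n "\<lambda>_. 0"] A0 by (cases n) auto
  then show ?thesis using f[of 0] r sums_unique2[of "\<lambda>_. 0"] by auto
qed

text \<open>The series with coefficients \<open>inverse_coeff A\<close> converges by the majorant
  estimate. That it inverts \<open>f\<close> is checked on partial sums \<open>G N\<close>: in
  \<open>f (G N)\<close> the recursion cancels everything up to degree \<open>N\<close> except
  \<open>y\<close>, and the rest decays like \<open>(1/2) ^ N\<close>.\<close>

lemma tangent_to_id_right_inverse:
  fixes f :: "'a::banach \<Rightarrow> 'a"
  assumes "tangent_to_id f"
  shows "\<exists>g. tangent_to_id g \<and> (\<forall>\<^sub>F y in nhds 0. f (g y) = y)"
proof -
  obtain r C A where r: "r > 0" and A: "\<And>n. multilinear_bounded_by n (C n) (A n)"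
    and C: "summable (\<lambda>n. C n * r ^ n)" and f: "\<And>h. norm h < r \<Longrightarrow> (\<lambda>n. A n (\<lambda>_. h)) sums f h"
    and A0: "\<And>h. A 0 h = 0" and A1: "\<And>h. A 1 h = h 0"
    using assms unfolding tangent_to_id_def by blast
  have C0: "0 \<le> C n" for n by (rule multilinear_bounded_by_nonneg[OF A])
  define K where "K = (\<Sum>n. C n * r ^ n) / r\<^sup>2"
  have K0: "0 \<le> K" unfolding K_def by (intro divide_nonneg_nonneg suminf_nonneg C) (use C0 r in auto)
  obtain r' where r': "r' > 0" "\<And>z. norm z < r' \<Longrightarrow> real_analytic_at f z"
    using real_analytic_at_eventually[OF tangent_to_id_analytic[OF assms]] by (auto simp: dist_norm)
  \<comment> \<open>\<open>2 * t\<close> must stay inside the convergence radius \<open>r\<close>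
    and inside the ball of radius \<open>r'\<close> where \<open>f\<close> is analytic, because
    \<open>norm (g y) \<le> 2 * t\<close>. The bound \<open>4 * K * t \<le> 1\<close> makes the
    nonlinear majorant at \<open>2 * t\<close> at most \<open>t\<close>; the summand
    \<open>4\<close> in the denominator covers \<open>K = 0\<close>.\<close>
  define t where "t = min (min (r / 4) (r' / 4)) (1 / (4 * K + 4))"
  have t: "0 < t" "2 * t < r" "4 * K * t \<le> 1" "2 * t < r'"
  proof -
    show "0 < t" "2 * t < r" "2 * t < r'" using r r' K0 by (auto simp: t_def)
    have "t \<le> 1 / (4 * K + 4)" by (simp add: t_def)
    then have "t * (4 * K + 4) \<le> 1" using K0 by (simp add: field_simps)
    then show "4 * K * t \<le> 1" using \<open>0 < t\<close> by (simp add: algebra_simps)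
  qed
  have small: "(\<Sum>n\<in>{2..N}. C n * (2 * t) ^ n) \<le> t" for N
  proof -
    have "(\<Sum>n\<in>{2..N}. C n * (2 * t) ^ n) \<le> (\<Sum>n\<in>{2..N}. (2 * t)\<^sup>2 / r\<^sup>2 * (C n * r ^ n))"
    proof (rule sum_mono)
      fix n assume n: "n \<in> {2..N}"
      then have e: "s ^ n = s\<^sup>2 * s ^ (n - 2)" for s :: real
        by (metis atLeastAtMost_iff le_add_diff_inverse power_add)
      have "(2 * t) ^ n \<le> (2 * t)\<^sup>2 * r ^ (n - 2)"
        unfolding e[of "2 * t"] using t by (intro mult_left_mono power_mono) auto
      also have "\<dots> = (2 * t)\<^sup>2 / r\<^sup>2 * r ^ n" unfolding e[of r] using r by simp
      finally show "C n * (2 * t) ^ n \<le> (2 * t)\<^sup>2 / r\<^sup>2 * (C n * r ^ n)"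
        using mult_left_mono[OF _ C0[of n], of "(2 * t) ^ n" "(2 * t)\<^sup>2 / r\<^sup>2 * r ^ n"]
        by (simp only: mult_ac)
    qed
    also have "\<dots> \<le> (2 * t)\<^sup>2 / r\<^sup>2 * (\<Sum>n. C n * r ^ n)"
      unfolding sum_distrib_left[symmetric] by (intro mult_left_mono sum_le_suminf C) (use C0 r in auto)
    also have "\<dots> = 4 * K * t * t" by (simp add: K_def power2_eq_square)
    also have "\<dots> \<le> t" using mult_right_mono[OF t(3), of t] t(1) by simp
    finally show ?thesis .
  qed
  define b where "b = inverse_bound C"
  define T where "T = inverse_coeff A"
  have T: "multilinear_bounded_by m (b m) (T m)" for m
    unfolding b_def T_def by (rule inverse_coeff_bounded[OF A])
  have b0: "0 \<le> b m" for m by (rule multilinear_bounded_by_nonneg[OF T])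
  have bsum: "(\<Sum>m\<in>{1..N}. b m * t ^ m) \<le> 2 * t" for N
    unfolding b_def using t by (intro inverse_bound_partial_sum C0 small) auto
  have bs: "summable (\<lambda>m. b m * t ^ m)"
  proof (rule summableI_nonneg_bounded)
    show "(\<Sum>m<N. b m * t ^ m) \<le> 2 * t" for N
    proof -
      have "(\<Sum>m<N. b m * t ^ m) \<le> (\<Sum>m\<in>insert 0 {1..N}. b m * t ^ m)"
        using t b0 by (intro sum_mono2) auto
      also have "\<dots> \<le> 2 * t" using bsum by (simp add: b_def)
      finally show ?thesis .
    qed
  qed (use b0 t in auto)
  define g where "g y = (\<Sum>m. T m (\<lambda>_. y))" for y
  have Tle: "norm (T m (\<lambda>_. y)) \<le> b m * s ^ m" if "norm y \<le> s" for y m s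
  proof -
    have "norm (T m (\<lambda>_. y)) \<le> b m * norm y ^ m"
      using multilinear_bounded_by_norm[OF T, of m "\<lambda>_. y"] by simp
    also have "\<dots> \<le> b m * s ^ m" using that by (intro mult_left_mono power_mono b0) auto
    finally show ?thesis .
  qed
  have gs: "(\<lambda>m. T m (\<lambda>_. y)) sums g y" if "norm y < t" for y
    unfolding g_def
    by (rule summable_sums[OF summable_comparison_test'[OF bs]]) (use Tle that in auto)
  have tan: "tangent_to_id g"
    unfolding tangent_to_id_def
    by (intro exI[of _ t] conjI exI[of _ b] exI[of _ T] allI impI T bs gs t(1)) (auto simp: T_def)
  \<comment> \<open>Half of the radius \<open>t\<close> is given away: each degree then gains a
    factor \<open>1/2\<close> over the majorant at \<open>t\<close>.\<close>
  have fg: "f (g y) = y" if y: "norm y < t / 2" for y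
  proof -
    define G where "G N = (\<Sum>m\<in>{1..N}. T m (\<lambda>_. y))" for N
    have yt: "norm y < t" using y t by simp
    have "(\<lambda>N. \<Sum>m<Suc N. T m (\<lambda>_. y)) \<longlonglongrightarrow> g y"
      using gs[OF yt] unfolding sums_def by (rule LIMSEQ_Suc)
    moreover have "(\<Sum>m<Suc N. T m (\<lambda>_. y)) = G N" for N
      unfolding G_def lessThan_Suc_atMost atMost_atLeast0
      by (subst sum.atLeast_Suc_atMost) (simp_all add: T_def)
    ultimately have Gg: "G \<longlonglongrightarrow> g y" by simp
    have Gt: "norm (G N) \<le> 2 * t" for N
      unfolding G_def by (rule order_trans[OF sum_norm_le bsum]) (use Tle[of y t] yt in auto)
    then have gt: "norm (g y) \<le> 2 * t"
      by (intro LIMSEQ_le_const2[OF tendsto_norm[OF Gg]]) auto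
    have "isCont f (g y)"
      using gt t(4) by (intro real_analytic_at_isCont r'(2)) simp
    then have lim1: "(\<lambda>N. f (G N)) \<longlonglongrightarrow> f (g y)" using Gg by (rule isCont_tendsto_compose)
    have est: "norm (f (G N) - y) \<le> (1/2) ^ N * (\<Sum>n. C n * r ^ n)" if N: "N \<ge> 1" for N
    proof -
      let ?J = "{1..N}"
      let ?a = "\<lambda>n \<sigma>. A n (\<lambda>i. T (\<sigma> i) (\<lambda>_. y))"
      \<comment> \<open>The expansion of \<open>A n\<close> at \<open>G N\<close> is split by total
        degree: \<open>P\<close> has the degrees up to \<open>N\<close>, on which the recursion
        acts, and \<open>R\<close> the surplus created by truncation.\<close>
      define P where "P n = (\<Sum>\<sigma>\<in>{\<sigma> \<in> {..<n} \<rightarrow>\<^sub>E ?J. sum \<sigma> {..<n} \<le> N}. ?a n \<sigma>)" for n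
      define R where "R n = (\<Sum>\<sigma>\<in>{\<sigma> \<in> {..<n} \<rightarrow>\<^sub>E ?J. \<not> sum \<sigma> {..<n} \<le> N}. ?a n \<sigma>)" for n
      have fin: "finite ({..<n} \<rightarrow>\<^sub>E ?J)" for n :: nat by (rule finite_PiE) auto
      have PR: "A n (\<lambda>_. G N) = P n + R n" for n
      proof -
        have "A n (\<lambda>_. G N) = (\<Sum>\<sigma>\<in>{..<n} \<rightarrow>\<^sub>E ?J. ?a n \<sigma>)"
          unfolding G_def by (rule multilinear_expand_sum[OF A]) simp
        also have "\<dots> = P n + R n"
          unfolding P_def R_def
          by (subst sum.union_disjoint[symmetric]) (use fin in \<open>auto intro!: sum.cong\<close>)
        finally show ?thesis .
      qed
      have P_eq: "P n = (\<Sum>m\<le>N. \<Sum>\<sigma>\<in>index_tuples ?J n m. ?a n \<sigma>)" for n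
        unfolding P_def by (rule sum_index_tuples[symmetric]) simp
      have Pz: "P n = 0" if "N < n" for n
        unfolding P_eq using that
        by (intro sum.neutral ballI) (auto simp: index_tuples_empty simp del: One_nat_def)
      have R0: "R 0 = 0" by (simp add: R_def)
      have R1: "R 1 = 0"
      proof -
        have "sum \<sigma> {..<1} \<le> N" if "\<sigma> \<in> {..<1} \<rightarrow>\<^sub>E ?J" for \<sigma> :: "nat \<Rightarrow> nat"
          using PiE_mem[OF that, of 0] by simp
        then show ?thesis unfolding R_def by (intro sum.neutral ballI) blast
      qed
      have P0: "P 0 = 0" using PR[of 0] A0 R0 by simp
      have P1: "P 1 = G N" using PR[of 1] A1 R1 by simp
      \<comment> \<open>For \<open>n \<ge> 2\<close> the part of degree \<open>m\<close> is, summed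
        over \<open>n\<close>, the defining expression of \<open>- T m\<close>. Together with
        \<open>P 1 = G N\<close> only the linear term \<open>y\<close> remains.\<close>
      have P2: "(\<Sum>n\<in>{2..N}. P n) = (\<Sum>m\<in>{2..N}. - T m (\<lambda>_. y))"
      proof -
        have "(\<Sum>n\<in>{2..N}. P n) = (\<Sum>m\<le>N. \<Sum>n\<in>{2..N}. \<Sum>\<sigma>\<in>index_tuples ?J n m. ?a n \<sigma>)"
          unfolding P_eq by (rule sum.swap)
        also have "\<dots> = (\<Sum>m\<in>{2..N}. \<Sum>n\<in>{2..N}. \<Sum>\<sigma>\<in>index_tuples ?J n m. ?a n \<sigma>)"
          by (intro sum.mono_neutral_right ballI sum.neutral)
             (auto simp: index_tuples_empty simp del: One_nat_def)
        also have "\<dots> = (\<Sum>m\<in>{2..N}. - T m (\<lambda>_. y))"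
        proof (rule sum.cong[OF refl])
          fix m assume m: "m \<in> {2..N}"
          have "(\<Sum>n\<in>{2..N}. \<Sum>\<sigma>\<in>index_tuples ?J n m. ?a n \<sigma>) =
              (\<Sum>n\<in>{2..m}. \<Sum>\<sigma>\<in>index_tuples ?J n m. ?a n \<sigma>)"
            using m by (intro sum.mono_neutral_right ballI)
              (auto simp: index_tuples_empty simp del: One_nat_def)
          also have "\<dots> = (\<Sum>n\<in>{2..m}. \<Sum>\<sigma>\<in>index_tuples {1..m} n m. ?a n \<sigma>)"
            using m by (intro sum.cong refl index_tuples_bound) auto
          also have "\<dots> = (\<Sum>n\<in>{2..m}. \<Sum>\<sigma>\<in>index_tuples {1..m} n m.
              A n (\<lambda>i. if i < n then T (\<sigma> i) (\<lambda>_. y) else 0))"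
            by (intro sum.cong refl multilinear_bounded_by_cong[OF A]) simp
          also have "\<dots> = - T m (\<lambda>_. y)"
            using m unfolding T_def by (subst (2) inverse_coeff.simps) simp
          finally show "(\<Sum>n\<in>{2..N}. \<Sum>\<sigma>\<in>index_tuples ?J n m. ?a n \<sigma>) = - T m (\<lambda>_. y)" .
        qed
        finally show ?thesis .
      qed
      have "(\<Sum>n\<le>N. P n) = y"
      proof -
        have e: "{..N} = insert 0 (insert 1 {2..N})" "{1..N} = insert 1 {2..N}"
          using N by auto
        have "G N = y + (\<Sum>m\<in>{2..N}. T m (\<lambda>_. y))"
          unfolding G_def e(2) by (simp add: T_def)
        then show ?thesis
          unfolding e(1) using P0 P1 P2 by (simp add: sum_negf)
      qed
      moreover have "P sums (\<Sum>n\<le>N. P n)"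
        by (rule sums_finite) (use Pz in auto)
      ultimately have "P sums y" by simp
      moreover have "(\<lambda>n. A n (\<lambda>_. G N)) sums f (G N)"
        using Gt[of N] t by (intro f) simp
      ultimately have "(\<lambda>n. A n (\<lambda>_. G N) - P n) sums (f (G N) - y)"
        by (intro sums_diff)
      then have Rs: "R sums (f (G N) - y)" by (simp add: PR)
      have Rle: "norm (R n) \<le> (1/2) ^ N * (C n * r ^ n)" for n
      proof -
        let ?w = "\<lambda>\<sigma>. C n * (\<Prod>i<n. b (\<sigma> i)) * t ^ sum \<sigma> {..<n}"
        have w0: "0 \<le> ?w \<sigma>" for \<sigma>
          using t by (intro mult_nonneg_nonneg C0 prod_nonneg b0) auto
        have "norm (R n) \<le> (\<Sum>\<sigma>\<in>{\<sigma> \<in> {..<n} \<rightarrow>\<^sub>E ?J. \<not> sum \<sigma> {..<n} \<le> N}. (1/2) ^ N * ?w \<sigma>)"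
          unfolding R_def
        proof (rule sum_norm_le)
          fix \<sigma> assume "\<sigma> \<in> {\<sigma> \<in> {..<n} \<rightarrow>\<^sub>E ?J. \<not> sum \<sigma> {..<n} \<le> N}"
          then have big: "N \<le> sum \<sigma> {..<n}" by simp
          have "norm (?a n \<sigma>) \<le> C n * (\<Prod>i<n. norm (T (\<sigma> i) (\<lambda>_. y)))"
            by (rule multilinear_bounded_by_norm[OF A])
          also have "\<dots> \<le> C n * (\<Prod>i<n. b (\<sigma> i) * (t / 2) ^ \<sigma> i)"
            using y by (intro mult_left_mono prod_mono C0 conjI Tle) auto
          \<comment> \<open>The powers of \<open>1/2\<close> collect to the total degree, which
            exceeds \<open>N\<close> on the tuples of \<open>R\<close>.\<close>
          also have "\<dots> = (1/2) ^ sum \<sigma> {..<n} * ?w \<sigma>"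
            by (simp add: prod.distrib prod_dividef power_sum power_divide)
          also have "\<dots> \<le> (1/2) ^ N * ?w \<sigma>"
            by (intro mult_right_mono w0 power_decreasing big) auto
          finally show "norm (?a n \<sigma>) \<le> (1/2) ^ N * ?w \<sigma>" .
        qed
        also have "\<dots> \<le> (\<Sum>\<sigma>\<in>{..<n} \<rightarrow>\<^sub>E ?J. (1/2) ^ N * ?w \<sigma>)"
        proof (rule sum_mono2[OF fin])
          show "0 \<le> (1/2) ^ N * ?w \<sigma>" for \<sigma> by (rule mult_nonneg_nonneg[OF _ w0]) simp
        qed blast
        also have "\<dots> = (1/2) ^ N * (C n * (\<Sum>j\<in>?J. b j * t ^ j) ^ n)"
          unfolding sum_distrib_left[symmetric] by (subst sum_PiE_weights) simp_all
        also have "\<dots> \<le> (1/2) ^ N * (C n * r ^ n)"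
        proof (intro mult_left_mono power_mono C0)
          show "(\<Sum>j\<in>?J. b j * t ^ j) \<le> r" using bsum[of N] t by linarith
          show "0 \<le> (\<Sum>j\<in>?J. b j * t ^ j)" using t by (intro sum_nonneg mult_nonneg_nonneg b0) auto
        qed auto
        finally show ?thesis .
      qed
      have s: "summable (\<lambda>n. (1/2) ^ N * (C n * r ^ n))" by (rule summable_mult[OF C])
      have sn: "summable (\<lambda>n. norm (R n))"
        by (rule summable_comparison_test'[OF s]) (use Rle in simp)
      have "norm (f (G N) - y) \<le> (\<Sum>n. norm (R n))"
        using summable_norm[OF sn] sums_unique[OF Rs] by simp
      also have "\<dots> \<le> (\<Sum>n. (1/2) ^ N * (C n * r ^ n))" by (rule suminf_le[OF Rle sn s])
      also have "\<dots> = (1/2) ^ N * (\<Sum>n. C n * r ^ n)" by (rule suminf_mult[OF C])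
      finally show ?thesis .
    qed
    have lim2: "(\<lambda>N. f (G N)) \<longlonglongrightarrow> y"
    proof (rule LIM_zero_cancel, rule Lim_null_comparison)
      show "\<forall>\<^sub>F N in sequentially. norm (f (G N) - y) \<le> (1/2) ^ N * (\<Sum>n. C n * r ^ n)"
        by (rule eventually_mono[OF eventually_ge_at_top[of 1]]) (rule est)
      show "(\<lambda>N. (1/2) ^ N * (\<Sum>n. C n * r ^ n)) \<longlonglongrightarrow> 0"
        by (auto intro!: tendsto_eq_intros LIMSEQ_power_zero)
    qed
    show ?thesis by (rule LIMSEQ_unique[OF lim1 lim2])
  qed
  then have "\<forall>\<^sub>F y in nhds 0. f (g y) = y"
    using t unfolding eventually_nhds_metric by (intro exI[of _ "t / 2"]) (simp add: dist_norm)
  with tan show ?thesis by blast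
qed

text \<open>The right inverse \<open>g\<close> has a right inverse \<open>h\<close> of its own. Near
  \<open>0\<close>, applying \<open>f\<close> to \<open>g (h y) = y\<close> gives
  \<open>f y = h y\<close>, so \<open>g\<close> is a left inverse of \<open>f\<close> too.\<close>

theorem tangent_to_id_inverse:
  fixes f :: "'a::banach \<Rightarrow> 'a"
  assumes f: "tangent_to_id f"
  shows "\<exists>g. tangent_to_id g \<and> (\<forall>\<^sub>F y in nhds 0. f (g y) = y) \<and> (\<forall>\<^sub>F y in nhds 0. g (f y) = y)"
proof -
  obtain g where g: "tangent_to_id g" and fg: "\<forall>\<^sub>F y in nhds 0. f (g y) = y"
    using tangent_to_id_right_inverse[OF f] by blast
  obtain h where h: "tangent_to_id h" and gh: "\<forall>\<^sub>F y in nhds 0. g (h y) = y"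
    using tangent_to_id_right_inverse[OF g] by blast
  have "isCont h 0" by (rule real_analytic_at_isCont[OF tangent_to_id_analytic[OF h]])
  then have "filterlim h (nhds 0) (nhds 0)"
    using tangent_to_id_zero[OF h] tendsto_at_iff_tendsto_nhds[of h 0] by (simp add: isCont_def)
  from eventually_compose_filterlim[OF fg this]
  have "\<forall>\<^sub>F y in nhds 0. f (g (h y)) = h y" .
  with gh have "\<forall>\<^sub>F y in nhds 0. g (f y) = y" by eventually_elim metis
  with g fg show ?thesis by blast
qed

section \<open>Submanifold charts from normal coordinates\<close>

lemma real_analytic_at_translate:
  fixes g :: "'a::banach \<Rightarrow> 'b::banach"
  assumes "real_analytic_at g (x - a)"
  shows "real_analytic_at (\<lambda>x. g (x - a)) x"
  using assms unfolding real_analytic_at_def by (simp add: algebra_simps)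

lemma real_analytic_at_add_const:
  fixes f :: "'a::banach \<Rightarrow> 'b::banach"
  assumes "real_analytic_at f x"
  shows "real_analytic_at (\<lambda>x. a + f x) x"
proof -
  obtain r C A where r: "r > 0" and A: "\<And>n. multilinear_bounded_by n (C n) (A n)"
    and C: "summable (\<lambda>n. C n * r ^ n)" and f: "\<And>h. norm h < r \<Longrightarrow> (\<lambda>n. A n (\<lambda>_. h)) sums f (x + h)"
    using assms unfolding real_analytic_at_def by blast
  define C' where "C' n = (if n = 0 then norm a else 0) + C n" for n :: nat
  define A' where "A' n h = (if n = 0 then a else 0) + A n h" for n :: nat and h
  have single: "(\<lambda>n::nat. if n = 0 then z else 0) sums z" for z :: "'c::real_normed_vector"
    using sums_single[of 0 "\<lambda>_. z"] by simp
  show ?thesis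
    unfolding real_analytic_at_def
  proof (intro exI conjI allI impI)
    show "multilinear_bounded_by n (C' n) (A' n)" for n
    proof (cases n)
      case 0
      have "A 0 h = A 0 h'" for h h' by (rule multilinear_bounded_by_cong[OF A]) simp
      then show ?thesis
        using multilinear_bounded_by_norm[OF A, of 0] multilinear_bounded_by_nonneg[OF A, of 0] 0
        by (intro multilinear_bounded_byI) (auto simp: A'_def C'_def intro: order_trans[OF norm_triangle_ineq] add_mono)
    next
      case (Suc k)
      then have "A' n = A n" "C' n = C n" by (simp_all add: A'_def[abs_def] C'_def)
      then show ?thesis using A by simp
    qed
    have "(\<lambda>n. (if n = 0 then norm a else 0) + C n * r ^ n) = (\<lambda>n. C' n * r ^ n)"
      by (auto simp: C'_def)
    then show "summable (\<lambda>n. C' n * r ^ n)"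
      using summable_add[OF sums_summable[OF single[of "norm a"]] C] by simp
    show "(\<lambda>n. A' n (\<lambda>_. h)) sums (a + f (x + h))" if "norm h < r" for h
      unfolding A'_def by (rule sums_add[OF single f[OF that]])
  qed (rule r)
qed

section \<open>The exponential series of a bilinear action\<close>

text \<open>The \<open>n\<close>-linear map whose values on constant sequences are the powers of
  \<open>br u\<close>. The last argument acts first, so that one more argument can enter through the
  innermost vector \<open>y\<close>.\<close>

primrec iterate_bilinear :: "('a \<Rightarrow> 'b \<Rightarrow> 'b) \<Rightarrow> nat \<Rightarrow> (nat \<Rightarrow> 'a) \<Rightarrow> 'b \<Rightarrow> 'b" where
  "iterate_bilinear br 0 h y = y"
| "iterate_bilinear br (Suc n) h y = iterate_bilinear br n h (br (h n) y)"

lemma iterate_bilinear_diag: "iterate_bilinear br n (\<lambda>_. u) y = (br u ^^ n) y"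
  by (induction n arbitrary: y) (simp_all add: funpow_swap1)

lemma iterate_bilinear_cong:
  "(\<And>i. i < n \<Longrightarrow> h i = h' i) \<Longrightarrow> iterate_bilinear br n h y = iterate_bilinear br n h' y"
  by (induction n arbitrary: y) auto

lemma
  assumes br: "bounded_bilinear br"
  shows iterate_bilinear_linear: "linear (iterate_bilinear br n h)"
    and iterate_bilinear_linear_arg: "i < n \<Longrightarrow> linear (\<lambda>v. iterate_bilinear br n (h(i := v)) y)"
proof -
  interpret br: bounded_bilinear br by (rule br)
  have l: "linear (br u)" and l': "linear (\<lambda>u. br u y)" for u y
    by (simp_all add: linear_iff br.add_right br.add_left br.scaleR_left br.scaleR_right)
  show 1: "linear (iterate_bilinear br n h)" for n
  proof (induction n)
    case 0
    then show ?case by (simp add: linear_iff)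
  next
    case (Suc n)
    then show ?case using linear_compose[OF l Suc] by (simp add: o_def)
  qed
  show "linear (\<lambda>v. iterate_bilinear br n (h(i := v)) y)" if "i < n" for n y
    using that
  proof (induction n arbitrary: y)
    case (Suc n)
    show ?case
    proof (cases "i = n")
      case True
      have eq: "(\<lambda>v. iterate_bilinear br (Suc n) (h(i := v)) y) = iterate_bilinear br n h \<circ> (\<lambda>v. br v y)"
        using True by (simp add: fun_eq_iff iterate_bilinear_cong[of n "h(n := _)" h])
      show ?thesis unfolding eq by (rule linear_compose[OF l' 1])
    next
      case False
      then show ?thesis using Suc by simp
    qed
  qed simp
qed

lemma iterate_bilinear_norm:
  assumes K: "\<And>u y. norm (br u y) \<le> K * norm u * norm y" and "0 \<le> K"
  shows "norm (iterate_bilinear br n h y) \<le> K ^ n * (\<Prod>i<n. norm (h i)) * norm y"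
proof (induction n arbitrary: y)
  case (Suc n)
  have "norm (iterate_bilinear br (Suc n) h y) \<le> K ^ n * (\<Prod>i<n. norm (h i)) * norm (br (h n) y)"
    using Suc by simp
  also have "\<dots> \<le> K ^ n * (\<Prod>i<n. norm (h i)) * (K * norm (h n) * norm y)"
    using \<open>0 \<le> K\<close> by (intro mult_left_mono K mult_nonneg_nonneg prod_nonneg) auto
  finally show ?case by (simp add: mult_ac)
qed simp

text \<open>For \<open>br u\<close> the commutator with \<open>K u\<close>, this is conjugation of
  \<open>y\<close> by the exponential of \<open>K u\<close>.\<close>

definition exp_action :: "('a \<Rightarrow> 'b \<Rightarrow> 'b::real_normed_vector) \<Rightarrow> 'a \<Rightarrow> 'b \<Rightarrow> 'b" where
  "exp_action br u y = (\<Sum>n. (1 / fact n) *\<^sub>R (br u ^^ n) y)"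

lemma exp_action_sums:
  fixes br :: "'a::real_normed_vector \<Rightarrow> 'b \<Rightarrow> 'b::banach"
  assumes br: "bounded_bilinear br"
  shows "(\<lambda>n. (1 / fact n) *\<^sub>R (br u ^^ n) y) sums exp_action br u y"
proof -
  obtain K where K: "0 \<le> K" "\<And>u y. norm (br u y) \<le> K * norm u * norm y"
    using bounded_bilinear.nonneg_bounded[OF br] by (metis mult.commute mult.left_commute)
  have "norm ((1 / fact n) *\<^sub>R (br u ^^ n) y) \<le> (K * norm u) ^ n /\<^sub>R fact n * norm y" for n
    using iterate_bilinear_norm[where br = br, OF K(2,1), of n "\<lambda>_. u" y]
    by (simp add: iterate_bilinear_diag power_mult_distrib divide_simps)
  then have "summable (\<lambda>n. (1 / fact n) *\<^sub>R (br u ^^ n) y)"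
    by (intro summable_comparison_test'[OF summable_mult2[OF summable_exp_generic]])
  then show ?thesis unfolding exp_action_def by (rule summable_sums)
qed

text \<open>The parametrisation of the orbit of \<open>a\<close> in normal coordinates: \<open>D\<close> is the part of the
  argument which is not in the image of \<open>\<lambda>u. br u a\<close>.\<close>

lemma tangent_to_id_exp_action:
  fixes br :: "'a::banach \<Rightarrow> 'a \<Rightarrow> 'a"
  assumes br: "bounded_bilinear br" and D: "bounded_linear D" and id: "\<And>u. br u a + D u = u"
  shows "tangent_to_id (\<lambda>u. exp_action br u (a + D u) - a)"
proof -
  interpret br: bounded_bilinear br by (rule br)
  interpret D: bounded_linear D by (rule D)
  obtain K where K: "0 \<le> K" "\<And>u y. norm (br u y) \<le> K * norm u * norm y"
    using br.nonneg_bounded by (metis mult.commute mult.left_commute)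
  obtain L where L: "0 \<le> L" "\<And>u. norm (D u) \<le> L * norm u"
    using D.nonneg_bounded by (metis mult.commute)
  \<comment> \<open>In degree \<open>n + 1\<close> the series of \<open>a\<close> contributes
    \<open>n + 1\<close> factors \<open>br u\<close>, that of \<open>D u\<close> only
    \<open>n\<close>, as \<open>D u\<close> is itself linear in \<open>u\<close>. With
    \<open>n\<close> outer factors split off both, \<open>Q n\<close> is the common innermost linear
    factor.\<close>
  define Q where "Q n v = (1 / fact (Suc n)) *\<^sub>R br v a + (1 / fact n) *\<^sub>R D v" for n v
  define A where "A n h = (case n of 0 \<Rightarrow> 0 | Suc n \<Rightarrow> iterate_bilinear br n h (Q n (h n)))" for n h
  define C where "C n = (case n of 0 \<Rightarrow> 0 | Suc n \<Rightarrow> K ^ n * ((K * norm a + L) / fact n))" for n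
  have Ql: "linear (Q n)" for n
    by (simp add: linear_iff Q_def br.add_left br.scaleR_left D.add D.scaleR algebra_simps)
  have Qn: "norm (Q n v) \<le> (K * norm a + L) / fact n * norm v" for n v
  proof -
    have "norm (Q n v) \<le> 1 / fact (Suc n) * norm (br v a) + 1 / fact n * norm (D v)"
      unfolding Q_def by (rule order_trans[OF norm_triangle_ineq]) simp
    also have "\<dots> \<le> 1 / fact n * (K * norm v * norm a) + 1 / fact n * (L * norm v)"
    proof (intro add_mono mult_mono K L)
      show "1 / fact (Suc n) \<le> (1 / fact n :: real)"
        by (intro divide_left_mono fact_mono) auto
    qed auto
    finally show ?thesis by (simp add: algebra_simps add_divide_distrib)
  qed
  have Am: "multilinear_bounded_by n (C n) (A n)" for n
  proof (cases n)
    case 0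
    then show ?thesis by (simp add: A_def C_def multilinear_bounded_by_def)
  next
    case (Suc k)
    have "multilinear_bounded_by (Suc k) (K ^ k * ((K * norm a + L) / fact k)) (\<lambda>h. iterate_bilinear br k h (Q k (h k)))"
    proof (rule multilinear_bounded_byI)
      show "iterate_bilinear br k h (Q k (h k)) = iterate_bilinear br k h' (Q k (h' k))"
        if "\<And>i. i < Suc k \<Longrightarrow> h i = h' i" for h h'
        using that by (simp add: iterate_bilinear_cong[of k h h'])
      show "linear (\<lambda>v. iterate_bilinear br k (h(i := v)) (Q k ((h(i := v)) k)))" if "i < Suc k" for h i
      proof (cases "i = k")
        case True
        have eq: "(\<lambda>v. iterate_bilinear br k (h(i := v)) (Q k ((h(i := v)) k))) = iterate_bilinear br k h \<circ> Q k"
          using True by (simp add: fun_eq_iff iterate_bilinear_cong[of k "h(k := _)" h])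
        show ?thesis unfolding eq by (rule linear_compose[OF Ql iterate_bilinear_linear[OF br]])
      next
        case False
        then show ?thesis using that iterate_bilinear_linear_arg[OF br, of i k h "Q k (h k)"] by simp
      qed
      show "0 \<le> K ^ k * ((K * norm a + L) / fact k)" using K L by simp
      show "norm (iterate_bilinear br k h (Q k (h k))) \<le> K ^ k * ((K * norm a + L) / fact k) * (\<Prod>i<Suc k. norm (h i))" for h
      proof -
        have "norm (iterate_bilinear br k h (Q k (h k))) \<le> K ^ k * (\<Prod>i<k. norm (h i)) * norm (Q k (h k))"
          by (rule iterate_bilinear_norm[OF K(2,1)])
        also have "\<dots> \<le> K ^ k * (\<Prod>i<k. norm (h i)) * ((K * norm a + L) / fact k * norm (h k))"
          using K by (intro mult_left_mono Qn mult_nonneg_nonneg prod_nonneg) auto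
        finally show ?thesis by (simp add: mult_ac)
      qed
    qed
    moreover have "A n = (\<lambda>h. iterate_bilinear br k h (Q k (h k)))" by (simp add: fun_eq_iff A_def Suc)
    ultimately show ?thesis by (simp add: C_def Suc)
  qed
  have s: "summable (\<lambda>n. C n * 1 ^ n)"
  proof -
    have "summable (\<lambda>n. K ^ n /\<^sub>R fact n * (K * norm a + L))"
      by (intro summable_mult2 summable_exp_generic)
    then have "summable (\<lambda>n. C (Suc n))" by (simp add: C_def field_simps)
    then show ?thesis by (subst summable_Suc_iff[symmetric]) simp
  qed
  have sums: "(\<lambda>n. A n (\<lambda>_. u)) sums (exp_action br u (a + D u) - a)" for u
  proof -
    note l = iterate_bilinear_linear[OF br, of _ "\<lambda>_. u", unfolded iterate_bilinear_diag]
    have lin: "(br u ^^ n) (r *\<^sub>R x + y) = r *\<^sub>R (br u ^^ n) x + (br u ^^ n) y" for n r x y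
      using l[of n] by (simp add: linear_iff iterate_bilinear_diag[abs_def])
    have "(\<lambda>n. (1 / fact n) *\<^sub>R (br u ^^ n) (a + D u)) = (\<lambda>n. (1 / fact n) *\<^sub>R (br u ^^ n) a + (1 / fact n) *\<^sub>R (br u ^^ n) (D u))"
      using lin[of _ 1 a "D u"] by (simp add: scaleR_add_right)
    then have e: "exp_action br u (a + D u) = exp_action br u a + exp_action br u (D u)"
      using sums_unique2[OF sums_add[OF exp_action_sums[OF br, of u a] exp_action_sums[OF br, of u "D u"]]]
        exp_action_sums[OF br, of u "a + D u"] by simp
    have "A (Suc n) (\<lambda>_. u) = (1 / fact (Suc n)) *\<^sub>R (br u ^^ Suc n) a + (1 / fact n) *\<^sub>R (br u ^^ n) (D u)" for n
    proof -
      have "A (Suc n) (\<lambda>_. u) = (br u ^^ n) ((1 / fact (Suc n)) *\<^sub>R br u a + ((1 / fact n) *\<^sub>R D u + 0))"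
        by (simp only: A_def Q_def iterate_bilinear_diag nat.case add_0_right)
      also have "\<dots> = (1 / fact (Suc n)) *\<^sub>R (br u ^^ n) (br u a) + (1 / fact n) *\<^sub>R (br u ^^ n) (D u)"
        unfolding lin using lin[of n 0 0 0] lin[of n 1 0 0] by simp
      finally show ?thesis by (simp only: funpow_Suc_right o_apply)
    qed
    moreover have "(\<lambda>n. (1 / fact (Suc n)) *\<^sub>R (br u ^^ Suc n) a) sums (exp_action br u a - a)"
      using exp_action_sums[OF br, of u a] by (subst sums_Suc_iff) simp
    ultimately have "(\<lambda>n. A (Suc n) (\<lambda>_. u)) sums (exp_action br u a - a + exp_action br u (D u))"
      using sums_add[OF _ exp_action_sums[OF br, of u "D u"]] by simp
    then have "(\<lambda>n. A (Suc n) (\<lambda>_. u)) sums (exp_action br u (a + D u) - a - A 0 (\<lambda>_. u))"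
      by (simp add: e A_def algebra_simps)
    then show ?thesis by (subst (asm) sums_Suc_iff) simp
  qed
  \<comment> \<open>The linear coefficient is \<open>Q 0 v = br v a + D v\<close>, the identity by
    \<open>id\<close>.\<close>
  show ?thesis
    unfolding tangent_to_id_def
    by (intro exI[of _ 1] conjI exI[of _ C] exI[of _ A] allI impI Am s sums)
       (auto simp: A_def Q_def id)
qed

text \<open>The local inverse of \<open>f\<close>, moved to \<open>a\<close>, is the chart. The
  projection \<open>D\<close> splits the space into its kernel \<open>F\<close> and its range
  \<open>G\<close>, and the condition on \<open>M\<close> says that the chart maps \<open>M\<close>
  to the slice over \<open>c = 0\<close>.\<close>

lemma submanifold_chart:
  fixes f :: "'a::banach \<Rightarrow> 'a"
  assumes f: "tangent_to_id f" and D: "bounded_linear D" and DD: "\<And>y. D (D y) = D y"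
    and \<delta>: "\<delta> > 0" and M: "\<And>y. norm y < \<delta> \<Longrightarrow> a + f y \<in> M \<longleftrightarrow> D y = 0"
  shows "\<exists>V (\<psi> :: 'a \<Rightarrow> 'a) F G V\<^sub>1 V\<^sub>2 c.
    a \<in> V \<and> closed_complements F G \<and>
    openin (top_of_set F) V\<^sub>1 \<and> openin (top_of_set G) V\<^sub>2 \<and> c \<in> V\<^sub>2 \<and>
    analytic_diffeo V {u + v | u v. u \<in> V\<^sub>1 \<and> v \<in> V\<^sub>2} \<psi> \<and>
    \<psi> ` (M \<inter> V) = {u + c | u. u \<in> V\<^sub>1}"
proof -
  interpret D: bounded_linear D by (rule D)
  obtain g where g: "tangent_to_id g" and fg: "\<forall>\<^sub>F y in nhds 0. f (g y) = y"
    and gf: "\<forall>\<^sub>F y in nhds 0. g (f y) = y"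
    using tangent_to_id_inverse[OF f] by blast
  have an: "\<forall>\<^sub>F y in nhds 0. real_analytic_at h y" if "tangent_to_id h" for h :: "'a \<Rightarrow> 'a"
    using real_analytic_at_eventually[OF tangent_to_id_analytic[OF that]]
    unfolding eventually_nhds_metric .
  have "\<forall>\<^sub>F y in nhds 0. real_analytic_at g y \<and> f (g y) = y"
    using an[OF g] fg by eventually_elim simp
  then obtain \<eta> where \<eta>: "\<eta> > 0" "\<And>z. norm z < \<eta> \<Longrightarrow> real_analytic_at g z" "\<And>z. norm z < \<eta> \<Longrightarrow> f (g z) = z"
    unfolding eventually_nhds_metric by (auto simp: dist_norm)
  have "isCont f 0" by (rule real_analytic_at_isCont[OF tangent_to_id_analytic[OF f]])
  then have "\<forall>\<^sub>F y in nhds 0. norm (f y) < \<eta>"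
    using tangent_to_id_zero[OF f] \<eta>(1) tendsto_at_iff_tendsto_nhds[of f 0]
    by (auto simp: isCont_def tendsto_iff dist_norm)
  moreover have "\<forall>\<^sub>F y in nhds 0. norm y < \<delta>"
    using \<delta> unfolding eventually_nhds_metric by (auto simp: dist_norm)
  ultimately have "\<forall>\<^sub>F y in nhds 0. norm (f y) < \<eta> \<and> norm y < \<delta> \<and> real_analytic_at f y \<and> g (f y) = y"
    using an[OF f] gf by eventually_elim simp
  then obtain \<epsilon> where "\<epsilon> > 0" "\<And>z. norm z < \<epsilon> \<Longrightarrow>
      norm (f z) < \<eta> \<and> norm z < \<delta> \<and> real_analytic_at f z \<and> g (f z) = z"
    unfolding eventually_nhds_metric dist_norm diff_0_right by blast
  then have \<epsilon>: "\<epsilon> > 0" "\<And>z. norm z < \<epsilon> \<Longrightarrow> real_analytic_at f z"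
    "\<And>z. norm z < \<epsilon> \<Longrightarrow> g (f z) = z" "\<And>z. norm z < \<epsilon> \<Longrightarrow> norm (f z) < \<eta>" "\<And>z :: 'a. norm z < \<epsilon> \<Longrightarrow> norm z < \<delta>"
    by blast+
  define F where "F = {y. D y = 0}"
  define G where "G = {y. D y = y}"
  define V1 where "V1 = {u \<in> F. norm u < \<epsilon> / 2}"
  define V2 where "V2 = {v \<in> G. norm v < \<epsilon> / 2}"
  \<comment> \<open>The box \<open>V1 + V2\<close> expressed through \<open>D\<close>, which shows
    that it is open. The halves of \<open>\<epsilon>\<close> keep it within the ball where
    \<open>f\<close> and \<open>g\<close> are mutually inverse.\<close>
  define W where "W = {y. norm (y - D y) < \<epsilon> / 2 \<and> norm (D y) < \<epsilon> / 2}"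
  have W_eq: "{u + v | u v. u \<in> V1 \<and> v \<in> V2} = W"
  proof (intro equalityI subsetI)
    fix y assume "y \<in> W"
    then have "y = (y - D y) + D y" "y - D y \<in> V1" "D y \<in> V2"
      by (auto simp: W_def V1_def V2_def F_def G_def D.diff DD)
    then show "y \<in> {u + v | u v. u \<in> V1 \<and> v \<in> V2}" by blast
  qed (auto simp: W_def V1_def V2_def F_def G_def D.add)
  have W_norm: "norm y < \<epsilon>" if "y \<in> W" for y
    using that norm_triangle_ineq[of "y - D y" "D y"] by (simp add: W_def)
  have cD: "continuous_on UNIV D" by (rule linear_continuous_on[OF D])
  have oW: "open W"
    unfolding W_def by (intro open_Collect_conj open_Collect_less continuous_intros cD)
  \<comment> \<open>The restriction to radius \<open>\<eta>\<close> is where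
    \<open>f (g z) = z\<close> holds, so \<open>g\<close> is injective there and maps
    \<open>V\<close> exactly onto \<open>W\<close>.\<close>
  define V where "V = (\<lambda>x. x - a) -` ({z. norm z < \<eta>} \<inter> g -` W)"
  have "continuous_on {z. norm z < \<eta>} g"
    by (intro continuous_at_imp_continuous_on ballI real_analytic_at_isCont \<eta>(2)) simp
  then have "open ({z. norm z < \<eta>} \<inter> g -` W)"
    by (intro continuous_open_preimage oW open_Collect_less continuous_intros)
  then have oV: "open V"
    unfolding V_def by (intro open_vimage continuous_intros)
  have inV: "a + f y \<in> V \<and> g (a + f y - a) = y" if "y \<in> W" for y
    using that \<epsilon>(3,4)[OF W_norm[OF that]] by (simp add: V_def)
  have Vx: "a + f (g (x - a)) = x" "g (x - a) \<in> W" "norm (x - a) < \<eta>" if "x \<in> V" for x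
    using that \<eta>(3) by (auto simp: V_def)
  have W0: "0 \<in> W" using \<epsilon>(1) by (simp add: W_def D.zero)
  show ?thesis
  proof (rule exI[of _ V], rule exI[of _ "\<lambda>x. g (x - a)"], rule exI[of _ F], rule exI[of _ G],
      rule exI[of _ V1], rule exI[of _ V2], rule exI[of _ 0], intro conjI)
    show "a \<in> V" using inV[OF W0] tangent_to_id_zero[OF f] by simp
    have "closed F" "closed G"
      unfolding F_def G_def by (intro closed_Collect_eq continuous_intros cD)+
    moreover have "\<exists>u\<in>F. \<exists>v\<in>G. x = u + v" for x
      by (rule bexI[of _ "x - D x"], rule bexI[of _ "D x"]) (auto simp: F_def G_def D.diff DD)
    moreover have "subspace F" "subspace G" "F \<inter> G = {0}"
      by (auto simp: subspace_def F_def G_def D.zero D.add D.scaleR)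
    ultimately show "closed_complements F G"
      unfolding closed_complements_def by blast
    have "V1 = F \<inter> {x. norm x < \<epsilon> / 2}" "V2 = G \<inter> {x. norm x < \<epsilon> / 2}"
      by (auto simp: V1_def V2_def)
    moreover have "open {x::'a. norm x < \<epsilon> / 2}" by (intro open_Collect_less continuous_intros)
    ultimately show "openin (top_of_set F) V1" "openin (top_of_set G) V2"
      by (simp_all add: openin_open_Int)
    show "0 \<in> V2" using \<epsilon>(1) by (simp add: V2_def G_def D.zero)
    show "analytic_diffeo V {u + v | u v. u \<in> V1 \<and> v \<in> V2} (\<lambda>x. g (x - a))"
      unfolding W_eq analytic_diffeo_def
    proof (intro conjI oV oW ballI exI[of _ "\<lambda>y. a + f y"])
      show "(\<lambda>x. g (x - a)) ` V = W"
      proof (intro equalityI subsetI)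
        show "y \<in> (\<lambda>x. g (x - a)) ` V" if "y \<in> W" for y
          using inV[OF that] by (intro image_eqI[of _ _ "a + f y"]) simp_all
      qed (use Vx(2) in blast)
      show "real_analytic_at (\<lambda>x. g (x - a)) x" if "x \<in> V" for x
        by (intro real_analytic_at_translate \<eta>(2) Vx(3) that)
      show "a + f (g (x - a)) = x" if "x \<in> V" for x by (rule Vx(1)[OF that])
      show "real_analytic_at (\<lambda>y. a + f y) y" if "y \<in> W" for y
        by (intro real_analytic_at_add_const \<epsilon>(2) W_norm that)
    qed
    have V1W: "u \<in> W" if "u \<in> V1" for u using that \<epsilon>(1) by (simp add: V1_def W_def F_def)
    have "g (x - a) \<in> V1" if "x \<in> M" "x \<in> V" for x
    proof -
      have "a + f (g (x - a)) \<in> M" using that Vx(1) by simp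
      then have "D (g (x - a)) = 0" using M[OF \<epsilon>(5)[OF W_norm[OF Vx(2)[OF that(2)]]]] by simp
      then show ?thesis using Vx(2)[OF that(2)] by (simp add: W_def V1_def F_def)
    qed
    moreover have "\<exists>x\<in>M \<inter> V. g (x - a) = u" if "u \<in> V1" for u
      using inV[OF V1W[OF that]] M[OF \<epsilon>(5)[OF W_norm[OF V1W[OF that]]]] that
      by (intro bexI[of _ "a + f u"]) (auto simp: V1_def F_def)
    ultimately show "(\<lambda>x. g (x - a)) ` (M \<inter> V) = {u + 0 | u. u \<in> V1}"
      unfolding image_def by auto
  qed
qed

section \<open>Orthonormal bases and unitary operators\<close>

lemma bounded_ops_scaleC: "T \<in> bounded_ops \<Longrightarrow> T (c *\<^sub>C x) = c *\<^sub>C T x"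
  by (simp add: bounded_ops_def)

lemma id_blinfun_bounded_ops: "id_blinfun \<in> bounded_ops"
  by (simp add: bounded_ops_def)

lemma onb_cinner: "is_onb E \<Longrightarrow> e \<in> E \<Longrightarrow> f \<in> E \<Longrightarrow> cinner e f = (if e = f then 1 else 0)"
  by (simp add: is_onb_def)

lemma onb_norm:
  assumes "is_onb E" "e \<in> E" shows "norm e = 1"
proof -
  have "complex_of_real ((norm e)\<^sup>2) = complex_of_real 1"
    using cinner_self[of e] onb_cinner[OF assms assms(2)] by simp
  then have "(norm e)\<^sup>2 = 1\<^sup>2" unfolding of_real_eq_iff by simp
  then show ?thesis by (rule power2_eq_imp_eq) auto
qed

lemma onb_vector_eqI:
  assumes E: "is_onb E" and "\<And>e. e \<in> E \<Longrightarrow> cinner e x = cinner e y"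
  shows "x = y"
proof -
  have "((\<lambda>e. (cmod (cinner e (x - y)))\<^sup>2) has_sum 0) E"
    using assms(2) by (intro has_sum_0) (simp add: cinner.diff_right)
  then have "(norm (x - y))\<^sup>2 = 0"
    using has_sum_unique[OF parseval[OF E]] by blast
  then show ?thesis by simp
qed

lemma onb_operator_eqI:
  assumes E: "is_onb E" and S: "S \<in> bounded_ops" and T: "T \<in> bounded_ops"
    and eq: "\<And>e. e \<in> E \<Longrightarrow> S e = T e"
  shows "S = T"
proof (rule blinfun_eqI)
  fix x
  have "complex_vector.subspace {x. S x = T x}"
    using bounded_ops_scaleC[OF S] bounded_ops_scaleC[OF T]
    by (auto simp: complex_vector.subspace_def blinfun.add_right blinfun.zero_right)
  then have "complex_vector.span E \<subseteq> {x. S x = T x}"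
    using eq by (intro complex_vector.span_minimal) auto
  moreover have "closed {x. S x = T x}"
    by (intro closed_Collect_eq continuous_intros)
  ultimately have "closure (complex_vector.span E) \<subseteq> {x. S x = T x}"
    by (rule closure_minimal)
  then show "S x = T x" using E by (auto simp: is_onb_def)
qed

lemma orthogonal_norm_sum:
  fixes f :: "'e \<Rightarrow> 'a::complex_inner"
  assumes "finite F" "\<And>d e. d \<in> F \<Longrightarrow> e \<in> F \<Longrightarrow> d \<noteq> e \<Longrightarrow> cinner (f d) (f e) = 0"
  shows "(norm (\<Sum>e\<in>F. f e))\<^sup>2 = (\<Sum>e\<in>F. (norm (f e))\<^sup>2)"
proof -
  have "cinner (\<Sum>e\<in>F. f e) (\<Sum>e\<in>F. f e) = (\<Sum>d\<in>F. \<Sum>e\<in>F. if d = e then cinner (f d) (f d) else 0)"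
    unfolding cinner.sum_left[of _ F "\<Sum>e\<in>F. f e"] cinner.sum_right[of "f _"]
  proof (rule sum.cong[OF refl], rule sum.cong[OF refl])
    show "cinner (f d) (f e) = (if d = e then cinner (f d) (f d) else 0)" if "d \<in> F" "e \<in> F" for d e
      using assms(2)[OF that] by simp
  qed
  also have "\<dots> = (\<Sum>d\<in>F. cinner (f d) (f d))" using assms(1) by simp
  also have "\<dots> = complex_of_real (\<Sum>e\<in>F. (norm (f e))\<^sup>2)" by (simp add: cinner_self)
  finally show ?thesis unfolding cinner_self using of_real_eq_iff by blast
qed

lemma summable_on_small_tail:
  fixes f :: "'e \<Rightarrow> real"
  assumes f: "f summable_on E" and \<epsilon>: "\<epsilon> > 0"
  obtains F where "finite F" "F \<subseteq> E"
    "\<And>Y. finite Y \<Longrightarrow> Y \<subseteq> E \<Longrightarrow> Y \<inter> F = {} \<Longrightarrow> \<bar>sum f Y\<bar> < \<epsilon>"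
proof -
  obtain L where L: "(f has_sum L) E" using f by (auto simp: summable_on_def)
  have "\<forall>\<^sub>F F in finite_subsets_at_top E. dist (sum f F) L < \<epsilon> / 2"
    using tendstoD[OF L[unfolded has_sum_def], of "\<epsilon> / 2"] \<epsilon> by simp
  then obtain F where F: "finite F" "F \<subseteq> E"
    and near: "\<forall>Y. finite Y \<and> F \<subseteq> Y \<and> Y \<subseteq> E \<longrightarrow> dist (sum f Y) L < \<epsilon> / 2"
    unfolding eventually_finite_subsets_at_top by (elim exE conjE)
  have "\<bar>sum f Y\<bar> < \<epsilon>" if Y: "finite Y" "Y \<subseteq> E" "Y \<inter> F = {}" for Y
  proof -
    have "\<bar>sum f (Y \<union> F) - L\<bar> < \<epsilon> / 2" "\<bar>sum f F - L\<bar> < \<epsilon> / 2"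
      using near F Y by (simp_all add: dist_real_def)
    moreover have "sum f (Y \<union> F) = sum f Y + sum f F" using F Y by (simp add: sum.union_disjoint)
    ultimately show ?thesis by linarith
  qed
  with F that show thesis by blast
qed

text \<open>By Pythagoras, tails of the vector sum are as small as tails of the squared norms.
  Completeness is sequential, so the net of finite partial sums is sampled along sets
  \<open>F n\<close>; two samples are compared through their union.\<close>

lemma orthogonal_summable_on:
  fixes f :: "'e \<Rightarrow> 'a::complex_hilbert_space"
  assumes orth: "\<And>d e. d \<in> E \<Longrightarrow> e \<in> E \<Longrightarrow> d \<noteq> e \<Longrightarrow> cinner (f d) (f e) = 0"
    and summ: "(\<lambda>e. (norm (f e))\<^sup>2) summable_on E"
  shows "f summable_on E"
proof -
  have "\<exists>F. finite F \<and> F \<subseteq> E \<and> (\<forall>Y. finite Y \<and> F \<subseteq> Y \<and> Y \<subseteq> E \<longrightarrow> norm (sum f Y - sum f F) < \<epsilon>)"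
    if \<epsilon>: "\<epsilon> > 0" for \<epsilon>
  proof -
    have "\<epsilon>\<^sup>2 > 0" using \<epsilon> by simp
    then obtain F where F: "finite F" "F \<subseteq> E"
      and tail: "\<And>Y. finite Y \<Longrightarrow> Y \<subseteq> E \<Longrightarrow> Y \<inter> F = {} \<Longrightarrow> \<bar>\<Sum>e\<in>Y. (norm (f e))\<^sup>2\<bar> < \<epsilon>\<^sup>2"
      by (rule summable_on_small_tail[OF summ]) blast
    have "norm (sum f Y - sum f F) < \<epsilon>" if Y: "finite Y" "F \<subseteq> Y" "Y \<subseteq> E" for Y
    proof -
      have "(norm (sum f Y - sum f F))\<^sup>2 = (norm (sum f (Y - F)))\<^sup>2"
        using Y by (simp add: sum_diff)
      also have "\<dots> = (\<Sum>e\<in>Y - F. (norm (f e))\<^sup>2)"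
        using Y by (intro orthogonal_norm_sum orth) auto
      also have "\<dots> < \<epsilon>\<^sup>2" using tail[of "Y - F"] Y by (auto simp: abs_less_iff)
      finally show ?thesis using \<epsilon> by (simp add: power2_less_imp_less)
    qed
    with F show ?thesis by blast
  qed
  then have "\<forall>n. \<exists>F. finite F \<and> F \<subseteq> E \<and> (\<forall>Y. finite Y \<and> F \<subseteq> Y \<and> Y \<subseteq> E \<longrightarrow>
      norm (sum f Y - sum f F) < 1 / real (Suc n))" by simp
  then obtain F where F: "\<And>n. finite (F n)" "\<And>n. F n \<subseteq> E"
    "\<And>n Y. finite Y \<Longrightarrow> F n \<subseteq> Y \<Longrightarrow> Y \<subseteq> E \<Longrightarrow> norm (sum f Y - sum f (F n)) < 1 / real (Suc n)"
    by metis
  define s where "s n = sum f (F n)" for n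
  have near: "norm (s m - s n) < 2 / real (Suc N)" if "m \<ge> N" "n \<ge> N" for m n N
  proof -
    let ?Y = "F m \<union> F n"
    have "norm (sum f ?Y - s m) < 1 / real (Suc m)" "norm (sum f ?Y - s n) < 1 / real (Suc n)"
      unfolding s_def by (rule F(3); use F(1,2) in auto)+
    moreover have "1 / real (Suc m) \<le> 1 / real (Suc N)" "1 / real (Suc n) \<le> 1 / real (Suc N)"
      using that by (auto intro!: divide_left_mono)
    moreover have "norm (s m - s n) \<le> norm (sum f ?Y - s m) + norm (sum f ?Y - s n)"
      using norm_triangle_ineq4[of "sum f ?Y - s n" "sum f ?Y - s m"] by (simp add: add.commute)
    ultimately show ?thesis by simp
  qed
  have "Cauchy s"
  proof (rule metric_CauchyI)
    fix e :: real assume "e > 0"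
    then obtain N where "1 / real (Suc N) < e / 2" using nat_approx_posE[of "e / 2"] by auto
    then have "dist (s m) (s n) < e" if "m \<ge> N" "n \<ge> N" for m n
      using near[OF that] by (simp add: dist_norm)
    then show "\<exists>M. \<forall>m\<ge>M. \<forall>n\<ge>M. dist (s m) (s n) < e" by blast
  qed
  then obtain x where x: "s \<longlonglongrightarrow> x" using Cauchy_convergent convergent_def by blast
  have "(f has_sum x) E"
    unfolding has_sum_def tendsto_iff eventually_finite_subsets_at_top
  proof (intro allI impI)
    fix e :: real assume e: "e > 0"
    obtain N where N: "\<And>n. n \<ge> N \<Longrightarrow> dist (s n) x < e / 2"
      using metric_LIMSEQ_D[OF x, of "e / 2"] e by auto
    obtain N' where N': "1 / real (Suc N') < e / 2" using nat_approx_posE[of "e / 2"] e by auto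
    define n where "n = max N N'"
    have n: "dist (s n) x < e / 2" "1 / real (Suc n) < e / 2"
    proof -
      show "dist (s n) x < e / 2" by (rule N) (simp add: n_def)
      have "1 / real (Suc n) \<le> 1 / real (Suc N')" by (auto simp: n_def intro!: divide_left_mono)
      then show "1 / real (Suc n) < e / 2" using N' by simp
    qed
    have "dist (sum f Y) x < e" if "finite Y" "F n \<subseteq> Y" "Y \<subseteq> E" for Y
      using F(3)[OF that] n dist_triangle[of "sum f Y" x "s n"] by (simp add: dist_norm s_def)
    then show "\<exists>X. finite X \<and> X \<subseteq> E \<and> (\<forall>Y. finite Y \<and> X \<subseteq> Y \<and> Y \<subseteq> E \<longrightarrow> dist (sum f Y) x < e)"
      using F(1,2) by (intro exI[of _ "F n"]) simp
  qed
  then show ?thesis by (auto simp: summable_on_def)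
qed

text \<open>Send \<open>x\<close> to the sum of \<open>cinner e x *\<^sub>C w e\<close>, which
  converges by orthogonality of the images and Parseval. The images may vanish or permute the basis,
  so this yields spectral projections, diagonal operators and permutation unitaries alike.\<close>

lemma onb_extension:
  fixes w :: "'a::complex_hilbert_space \<Rightarrow> 'a"
  assumes E: "is_onb E"
    and orth: "\<And>d e. d \<in> E \<Longrightarrow> e \<in> E \<Longrightarrow> d \<noteq> e \<Longrightarrow> cinner (w d) (w e) = 0"
    and C: "\<And>e. e \<in> E \<Longrightarrow> norm (w e) \<le> C"
  shows "\<exists>T\<in>bounded_ops. \<forall>e\<in>E. T e = w e"
proof -
  define f where "f x e = cinner e x *\<^sub>C w e" for x e
  have fo: "cinner (f x d) (f x e) = 0" if "d \<in> E" "e \<in> E" "d \<noteq> e" for x d e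
    using orth[OF that] by (simp add: f_def cinner_scaleC_left cinner_scaleC_right)
  have fn: "(norm (f x e))\<^sup>2 \<le> C\<^sup>2 * (cmod (cinner e x))\<^sup>2" if "e \<in> E" for x e
  proof -
    have "norm (f x e) \<le> C * cmod (cinner e x)"
      using mult_right_mono[OF C[OF that], of "cmod (cinner e x)"] by (simp add: f_def norm_scaleC mult.commute)
    from power_mono[OF this, of 2] show ?thesis by (simp add: power_mult_distrib)
  qed
  have fs: "f x summable_on E" for x
  proof (rule orthogonal_summable_on[OF fo])
    have "(\<lambda>e. C\<^sup>2 * (cmod (cinner e x))\<^sup>2) summable_on E"
      using parseval[OF E, of x] by (intro summable_on_cmult_right) (auto simp: summable_on_def)
    then show "(\<lambda>e. (norm (f x e))\<^sup>2) summable_on E"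
      by (rule summable_on_comparison_test) (use fn in auto)
  qed
  define t where "t x = (\<Sum>\<^sub>\<infinity>e\<in>E. f x e)" for x
  have ts: "(f x has_sum t x) E" for x unfolding t_def using fs by simp
  have add: "t (x + y) = t x + t y" for x y
  proof -
    have "f (x + y) = (\<lambda>e. f x e + f y e)"
      by (simp add: fun_eq_iff f_def cinner_add_right scaleC_add_left)
    then show ?thesis
      using has_sum_unique[OF ts[of "x + y"]] has_sum_add[OF ts[of x] ts[of y]] by simp
  qed
  have scale: "t (c *\<^sub>C x) = c *\<^sub>C t x" for c x
  proof -
    have "f (c *\<^sub>C x) = (\<lambda>e. c *\<^sub>C f x e)"
      by (simp add: fun_eq_iff f_def cinner_scaleC_right scaleC_scaleC)
    then show ?thesis
      using has_sum_unique[OF ts[of "c *\<^sub>C x"]]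
        has_sum_bounded_linear[OF bounded_linear_scaleC ts[of x], of c] by simp
  qed
  \<comment> \<open>The absolute value is for empty \<open>E\<close>, where \<open>C\<close> may be
    negative.\<close>
  have bound: "norm (t x) \<le> norm x * \<bar>C\<bar>" for x
  proof (rule tendsto_upperbound)
    show "((\<lambda>F. norm (sum (f x) F)) \<longlongrightarrow> norm (t x)) (finite_subsets_at_top E)"
      using ts[of x] unfolding has_sum_def by (rule tendsto_norm)
    have "norm (sum (f x) F) \<le> norm x * \<bar>C\<bar>" if F: "finite F" "F \<subseteq> E" for F
    proof (rule power2_le_imp_le)
      have "(norm (sum (f x) F))\<^sup>2 = (\<Sum>e\<in>F. (norm (f x e))\<^sup>2)"
        using F by (intro orthogonal_norm_sum fo) auto
      also have "\<dots> \<le> (\<Sum>e\<in>F. C\<^sup>2 * (cmod (cinner e x))\<^sup>2)"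
        using F by (intro sum_mono fn) auto
      also have "\<dots> = C\<^sup>2 * (\<Sum>e\<in>F. (cmod (cinner e x))\<^sup>2)" by (simp add: sum_distrib_left)
      also have "\<dots> \<le> C\<^sup>2 * (norm x)\<^sup>2"
        using F by (intro mult_left_mono has_sum_mono2[OF has_sum_finite parseval[OF E]]) auto
      finally show "(norm (sum (f x) F))\<^sup>2 \<le> (norm x * \<bar>C\<bar>)\<^sup>2"
        by (simp add: power_mult_distrib mult.commute)
    qed simp
    then show "\<forall>\<^sub>F F in finite_subsets_at_top E. norm (sum (f x) F) \<le> norm x * \<bar>C\<bar>"
      by (intro eventually_finite_subsets_at_top_weakI)
  qed simp
  have bl: "bounded_linear t"
    by (rule bounded_linear_intro[OF add _ bound]) (simp add: scaleR_eq_scaleC scale)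
  have "t e = w e" if e: "e \<in> E" for e
  proof -
    have "f e d = 0" if "d \<in> E - {e}" for d
      using that e onb_cinner[OF E, of d e] by (simp add: f_def)
    then have "t e = (\<Sum>\<^sub>\<infinity>d\<in>{e}. f e d)"
      unfolding t_def using e by (intro infsum_cong_neutral) auto
    also have "\<dots> = w e" using onb_cinner[OF E e e] by (simp add: f_def)
    finally show ?thesis .
  qed
  then show ?thesis
    using bl by (intro bexI[of _ "Blinfun t"]) (auto simp: bounded_ops_def bounded_linear_Blinfun_apply scale)
qed

lemma onb_adj_eqI:
  assumes E: "is_onb E" and S: "S \<in> bounded_ops" and T: "T \<in> bounded_ops"
    and eq: "\<And>e f. e \<in> E \<Longrightarrow> f \<in> E \<Longrightarrow> cinner (T e) f = cinner e (S f)"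
  shows "adj T = (S :: 'a::complex_hilbert_space \<Rightarrow>\<^sub>L 'a)"
  by (rule onb_operator_eqI[OF E adj_bounded_ops[OF T] S], rule onb_vector_eqI[OF E])
     (simp add: cinner_adj_right[OF T] eq)

lemma norm_hs_herm_onb:
  assumes E: "is_onb E"
  shows "(norm T)\<^sup>2 = 4 * (\<Sum>\<^sub>\<infinity>e\<in>E. (norm (hs_op T e))\<^sup>2)"
  using hs_infsum_inner_onb(1)[OF hs_op(1) hs_op(1) is_onb_some E, of T T]
  by (simp add: norm_hs_herm_eq power2_norm_eq_inner)

lemma unitary_cancel:
  assumes "unitary U" shows "adj U (U x) = x" "U (adj U x) = x"
  using assms unfolding unitary_def by (metis blinfun_apply_blinfun_compose id_blinfun.rep_eq)+

lemma unitary_cinner: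
  assumes "unitary U"
  shows "cinner (U x) (U y) = cinner x (y :: 'a::complex_hilbert_space)"
  using assms cinner_adj_right[of U x "U y"] by (simp add: unitary_cancel unitary_def)

lemma unitary_adj: "unitary U \<Longrightarrow> unitary (adj U)" for U :: "'a::complex_hilbert_space \<Rightarrow>\<^sub>L 'a"
  by (simp add: unitary_def adj_adj adj_bounded_ops)

lemma unitary_compose:
  fixes U V :: "'a::complex_hilbert_space \<Rightarrow>\<^sub>L 'a"
  assumes "unitary U" "unitary V" shows "unitary (U o\<^sub>L V)"
proof -
  have "adj V (adj U (U (V x))) = x" "U (V (adj V (adj U x))) = x" for x
    using assms unfolding unitary_def by (metis blinfun_apply_blinfun_compose id_blinfun.rep_eq)+
  then show ?thesis
    using assms unfolding unitary_def
    by (auto simp: adj_compose bounded_ops_compose intro!: blinfun_eqI)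
qed

lemma unitary_onb:
  assumes U: "unitary U" and E: "is_onb (E :: 'a::complex_hilbert_space set)"
  shows "is_onb (blinfun_apply U ` E)"
  unfolding is_onb_def
proof
  have "U e = U f \<longleftrightarrow> e = f" for e f using unitary_cancel(1)[OF U] by metis
  then show "\<forall>e\<in>U ` E. \<forall>f\<in>U ` E. cinner e f = (if e = f then 1 else 0)"
    using onb_cinner[OF E] by (auto simp: unitary_cinner[OF U])
  let ?S = "closure (complex_vector.span (U ` E))"
  have sub: "complex_vector.subspace ?S" by (rule closed_csubspace_closure) simp
  have Ub: "U \<in> bounded_ops" using U by (simp add: unitary_def)
  have "complex_vector.subspace {x. U x \<in> ?S}"
    using sub bounded_ops_scaleC[OF Ub] unfolding complex_vector.subspace_def
    by (auto simp: blinfun.add_right blinfun.zero_right)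
  moreover have "E \<subseteq> {x. U x \<in> ?S}"
    using complex_vector.span_superset closure_subset by fastforce
  ultimately have "complex_vector.span E \<subseteq> {x. U x \<in> ?S}"
    by (intro complex_vector.span_minimal)
  moreover have "closed {x. U x \<in> ?S}"
    unfolding vimage_def[symmetric] by (intro closed_vimage closed_closure continuous_intros)
  ultimately have "closure (complex_vector.span E) \<subseteq> {x. U x \<in> ?S}" by (rule closure_minimal)
  then have "U (adj U x) \<in> ?S" for x using E by (auto simp: is_onb_def)
  then show "?S = UNIV" by (auto simp: unitary_cancel[OF U])
qed

section \<open>The spectral theorem for self-adjoint Hilbert-Schmidt operators\<close>

text \<open>Each functional maps the unit ball into a compact disc of the complex plane. Refining
  the cells by small discs for one functional after another gives the finite cover; this is the
  finite-dimensional part of compactness.\<close>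

lemma unit_ball_cover_functionals:
  fixes F :: "'a::complex_inner set"
  assumes "finite F" "\<delta> > 0"
  shows "\<exists>\<P>. finite \<P> \<and> cball 0 1 \<subseteq> \<Union>\<P> \<and>
    (\<forall>P\<in>\<P>. \<forall>x\<in>P. \<forall>y\<in>P. \<forall>f\<in>F. cmod (cinner f x - cinner f y) < \<delta>)"
  using assms(1)
proof induction
  case empty
  show ?case by (intro exI[of _ "{UNIV}"]) simp
next
  case (insert f F)
  obtain \<P> where \<P>: "finite \<P>" "cball 0 1 \<subseteq> \<Union>\<P>"
    and \<P>_close: "\<forall>P\<in>\<P>. \<forall>x\<in>P. \<forall>y\<in>P. \<forall>g\<in>F. cmod (cinner g x - cinner g y) < \<delta>"
    using insert.IH by (elim exE conjE)
  have "compact (cball (0::complex) (norm f))" by simp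
  then have "\<exists>k. finite k \<and> cball (0::complex) (norm f) \<subseteq> (\<Union>z\<in>k. ball z (\<delta> / 2))"
    using assms(2) unfolding compact_eq_totally_bounded by simp
  then obtain k where k: "finite k" "cball (0::complex) (norm f) \<subseteq> (\<Union>z\<in>k. ball z (\<delta> / 2))"
    by blast
  define \<P>' where "\<P>' = (\<lambda>(P, z). P \<inter> {x. cinner f x \<in> ball z (\<delta> / 2)}) ` (\<P> \<times> k)"
  have "finite \<P>'" using \<P>(1) k(1) by (simp add: \<P>'_def)
  moreover have "x \<in> \<Union>\<P>'" if x: "x \<in> cball 0 1" for x
  proof -
    have "cmod (cinner f x) \<le> norm f * norm x" by (rule norm_cinner_le)
    also have "\<dots> \<le> norm f" using x by (simp add: mult_left_le)
    finally have "cinner f x \<in> cball 0 (norm f)" by simp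
    then obtain z where z: "z \<in> k" "cinner f x \<in> ball z (\<delta> / 2)" using k(2) by blast
    obtain P where "P \<in> \<P>" "x \<in> P" using \<P>(2) x by blast
    with z show ?thesis by (auto simp: \<P>'_def)
  qed
  moreover have "cmod (cinner g x - cinner g y) < \<delta>"
    if "P \<in> \<P>'" "x \<in> P" "y \<in> P" "g \<in> insert f F" for P x y g
  proof -
    obtain Q z where Q: "Q \<in> \<P>" "z \<in> k" "P = Q \<inter> {x. cinner f x \<in> ball z (\<delta> / 2)}"
      using \<open>P \<in> \<P>'\<close> by (auto simp: \<P>'_def)
    show ?thesis
    proof (cases "g = f")
      case True
      then have "dist z (cinner g x) < \<delta> / 2" "dist z (cinner g y) < \<delta> / 2" using that Q by auto
      then show ?thesis using dist_triangle3[of "cinner g x" "cinner g y" z] by (simp add: dist_norm)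
    next
      case False
      then show ?thesis using that Q by (intro \<P>_close[rule_format, OF Q(1)]) auto
    qed
  qed
  ultimately show ?case by (intro exI[of _ \<P>']) blast
qed

text \<open>Total boundedness. By self-adjointness the coefficient of the image of \<open>z\<close>
  at \<open>e\<close> is \<open>cinner (hs_op a e) z\<close>. Square summability makes all but
  finitely many coefficients small uniformly on the ball, and the others are controlled by finitely
  many cells.\<close>

lemma hs_herm_compact_image:
  "compact (closure (hs_op a ` cball 0 1))"
proof -
  let ?T = "hs_op a" and ?E = "some_onb :: 'a set"
  have sT: "(\<lambda>e. (norm (?T e))\<^sup>2) summable_on ?E"
    using hs_op(1)[of a] is_onb_some by (auto simp: hilbert_schmidt_def)
  have "\<exists>k. finite k \<and> closure (?T ` cball 0 1) \<subseteq> (\<Union>x\<in>k. ball x \<epsilon>)" if \<epsilon>: "\<epsilon> > 0" for \<epsilon>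
  proof -
    define \<eta> where "\<eta> = (\<epsilon> / 4)\<^sup>2"
    have \<eta>: "\<eta> > 0" using \<epsilon> by (simp add: \<eta>_def)
    obtain F where F: "finite F" "F \<subseteq> ?E"
      "\<And>Y. finite Y \<Longrightarrow> Y \<subseteq> ?E \<Longrightarrow> Y \<inter> F = {} \<Longrightarrow> \<bar>\<Sum>e\<in>Y. (norm (?T e))\<^sup>2\<bar> < \<eta> / 8"
    proof (rule summable_on_small_tail[OF sT])
      show "0 < \<eta> / 8" using \<eta> by simp
    qed blast
    \<comment> \<open>The coefficients in \<open>F\<close> contribute at most
      \<open>card F * \<delta>\<^sup>2 \<le> \<eta> / 2\<close>. The rest contributes at most
      \<open>4 * (\<eta> / 8)\<close>, because differences of unit ball vectors have norm at most
      \<open>2\<close>.\<close>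
    define \<delta> where "\<delta> = sqrt (\<eta> / (2 * (real (card F) + 1)))"
    have \<delta>: "\<delta> > 0" using \<eta> by (simp add: \<delta>_def)
    have card: "real (card F) * \<delta>\<^sup>2 \<le> \<eta> / 2"
      using \<eta> by (simp add: \<delta>_def field_simps)
    obtain \<P> where \<P>: "finite \<P>" "cball 0 1 \<subseteq> \<Union>\<P>"
      and \<P>_close: "\<forall>P\<in>\<P>. \<forall>x\<in>P. \<forall>y\<in>P. \<forall>f\<in>?T ` F. cmod (cinner f x - cinner f y) < \<delta>"
      using unit_ball_cover_functionals[OF finite_imageI[OF F(1), of ?T] \<delta>] by (elim exE conjE)
    have close: "norm (?T x - ?T y) \<le> \<epsilon> / 4"
      if P: "P \<in> \<P>" "x \<in> P" "y \<in> P" and xy: "norm x \<le> 1" "norm y \<le> 1" for P x y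
    proof (rule power2_le_imp_le)
      let ?z = "x - y"
      have z: "norm ?z \<le> 2" using norm_triangle_ineq4[of x y] xy by simp
      have swap: "cinner e (?T ?z) = cinner (?T e) ?z" for e
        using cinner_self_adjoint[of ?T e ?z] hs_op by metis
      have tail: "(cmod (cinner e (?T ?z)))\<^sup>2 \<le> 4 * (norm (?T e))\<^sup>2" for e
      proof -
        have "cmod (cinner e (?T ?z)) \<le> norm (?T e) * 2"
          unfolding swap by (rule order_trans[OF norm_cinner_le]) (use z in \<open>simp add: mult_left_mono\<close>)
        from power_mono[OF this, of 2] show ?thesis by (simp add: power_mult_distrib)
      qed
      have head: "(cmod (cinner e (?T ?z)))\<^sup>2 \<le> \<delta>\<^sup>2" if "e \<in> F" for e
        unfolding swap using \<P>_close[rule_format, OF P imageI[OF that]] by (intro power_mono) (simp_all add: cinner.diff_right)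
      have "(norm (?T ?z))\<^sup>2 \<le> \<eta>"
      proof (rule has_sum_le_finite_sums[OF parseval[OF is_onb_some]])
        fix Y assume Y: "finite Y" "Y \<subseteq> ?E"
        have "(\<Sum>e\<in>Y. (cmod (cinner e (?T ?z)))\<^sup>2) =
            (\<Sum>e\<in>Y \<inter> F. (cmod (cinner e (?T ?z)))\<^sup>2) + (\<Sum>e\<in>Y - F. (cmod (cinner e (?T ?z)))\<^sup>2)"
          using Y by (simp add: sum.Int_Diff)
        also have "\<dots> \<le> (\<Sum>e\<in>Y \<inter> F. \<delta>\<^sup>2) + (\<Sum>e\<in>Y - F. 4 * (norm (?T e))\<^sup>2)"
          by (intro add_mono sum_mono head tail) auto
        also have "(\<Sum>e\<in>Y \<inter> F. \<delta>\<^sup>2) \<le> real (card F) * \<delta>\<^sup>2"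
          using F(1) by (simp add: mult_right_mono card_mono)
        also have "(\<Sum>e\<in>Y - F. 4 * (norm (?T e))\<^sup>2) \<le> \<eta> / 2"
        proof -
          have "\<bar>\<Sum>e\<in>Y - F. (norm (?T e))\<^sup>2\<bar> < \<eta> / 8"
            by (rule F(3)) (use Y in auto)
          then show ?thesis by (simp add: sum_distrib_left[symmetric] abs_less_iff)
        qed
        finally show "(\<Sum>e\<in>Y. (cmod (cinner e (?T ?z)))\<^sup>2) \<le> \<eta>" using card by simp
      qed
      then show "(norm (?T x - ?T y))\<^sup>2 \<le> (\<epsilon> / 4)\<^sup>2" by (simp add: \<eta>_def blinfun.diff_right)
    qed (use \<epsilon> in simp)
    \<comment> \<open>A cell that misses the unit ball merely adds an arbitrary extra
      centre.\<close>
    define pick where "pick P = (SOME x. x \<in> P \<inter> cball 0 1)" for P :: "'a set"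
    define k where "k = (\<lambda>P. ?T (pick P)) ` \<P>"
    have "?T ` cball 0 1 \<subseteq> (\<Union>y\<in>k. cball y (\<epsilon> / 4))"
    proof
      fix y assume "y \<in> ?T ` cball 0 1"
      then obtain x where x: "x \<in> cball 0 1" "y = ?T x" by blast
      obtain P where P: "P \<in> \<P>" "x \<in> P" using \<P>(2) x(1) by blast
      have "pick P \<in> P \<inter> cball 0 1" unfolding pick_def by (rule someI[of _ x]) (use P x in simp)
      then have "norm (?T (pick P) - ?T x) \<le> \<epsilon> / 4" using close[OF P(1)] P x by simp
      then show "y \<in> (\<Union>y\<in>k. cball y (\<epsilon> / 4))" using P(1) x(2) by (auto simp: k_def dist_norm)
    qed
    moreover have k: "finite k" using \<P>(1) by (simp add: k_def)
    ultimately have "closure (?T ` cball 0 1) \<subseteq> (\<Union>y\<in>k. cball y (\<epsilon> / 4))"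
      by (intro closure_minimal closed_UN) auto
    also have "\<dots> \<subseteq> (\<Union>y\<in>k. ball y \<epsilon>)" using \<epsilon> by fastforce
    finally show ?thesis using k by blast
  qed
  then show ?thesis by (simp add: compact_eq_totally_bounded complete_eq_closed)
qed

text \<open>Let \<open>s\<close> be the norm of the operator on \<open>W\<close>. On a maximising
  sequence of unit vectors \<open>T\<^sup>2 - s\<^sup>2\<close> tends to \<open>0\<close>, and
  compactness extracts a limit \<open>u\<close> with \<open>T\<^sup>2 u = s\<^sup>2 u\<close>. An
  invariant subspace \<open>W\<close> is allowed so that the result applies to orthogonal
  complements.\<close>

lemma hs_herm_eigenvector:
  assumes W: "complex_vector.subspace W" "closed W" "W \<noteq> {0}"
    and inv: "\<And>x. x \<in> W \<Longrightarrow> hs_op a x \<in> W"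
  shows "\<exists>x\<in>W. norm x = 1 \<and> (\<exists>r. hs_op a x = complex_of_real r *\<^sub>C x)"
proof -
  let ?T = "hs_op a"
  have Tb: "?T \<in> bounded_ops" by (rule hs_op_bounded_ops)
  define B where "B = {x \<in> W. norm x = 1}"
  obtain w where w: "w \<in> W" "w \<noteq> 0"
    using W(3) complex_vector.subspace_0[OF W(1)] by auto
  have normalize: "inverse (norm y) *\<^sub>R y \<in> W \<and> norm (inverse (norm y) *\<^sub>R y) = 1"
    if "y \<in> W" "y \<noteq> 0" for y
    using that subspace_scale[OF csubspace_imp_subspace[OF W(1)]] by simp
  have unit: "\<exists>x\<in>B. hs_op a x = complex_of_real r *\<^sub>C x"
    if y: "y \<in> W" "y \<noteq> 0" "hs_op a y = complex_of_real r *\<^sub>C y" for y r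
  proof (rule bexI[of _ "inverse (norm y) *\<^sub>R y"])
    show "?T (inverse (norm y) *\<^sub>R y) = complex_of_real r *\<^sub>C inverse (norm y) *\<^sub>R y"
      using y by (simp add: blinfun.scaleR_right flip: scaleR_eq_scaleC)
    show "inverse (norm y) *\<^sub>R y \<in> B"
      using y by (simp add: B_def normalize)
  qed
  have Bne: "B \<noteq> {}"
    using normalize[OF w] by (auto simp: B_def)
  define s where "s = (SUP x\<in>B. norm (?T x))"
  have bdd: "bdd_above ((\<lambda>x. norm (?T x)) ` B)"
    
  proof (rule bdd_aboveI2)
    show "norm (?T x) \<le> norm ?T" if "x \<in> B" for x
      using norm_blinfun[of ?T x] that by (simp add: B_def)
  qed
  have le1: "norm (?T x) \<le> s" if "x \<in> B" for x
    unfolding s_def using that bdd by (rule cSUP_upper)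
  have s0: "0 \<le> s" using Bne le1 by (meson equals0I norm_ge_zero order_trans)
  have le: "norm (?T x) \<le> s * norm x" if x: "x \<in> W" for x
  proof (cases "x = 0")
    case False
    have "inverse (norm x) *\<^sub>R x \<in> B" using normalize[OF x False] by (simp add: B_def)
    from le1[OF this] show ?thesis
      using False by (simp add: blinfun.scaleR_right field_simps)
  qed (simp add: blinfun.zero_right)
  show ?thesis
  proof (cases "s = 0")
    case True
    then have "?T w = complex_of_real 0 *\<^sub>C w" using le[OF w(1)] by simp
    from unit[OF w this] show ?thesis by (auto simp: B_def)
  next
    case False
    then have s: "s > 0" using s0 by simp
    have "\<exists>x\<in>B. s - 1 / real (Suc n) < norm (?T x)" for n
    proof -
      have "\<exists>x\<in>(\<lambda>x. norm (?T x)) ` B. s - 1 / real (Suc n) < x"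
        by (rule less_cSupD) (use Bne in \<open>auto simp: s_def\<close>)
      then show ?thesis by blast
    qed
    then obtain x where x: "\<And>n. x n \<in> B" "\<And>n. s - 1 / real (Suc n) < norm (?T (x n))" by metis
    have "?T (x n) \<in> closure (?T ` cball 0 1)" for n
      using x(1)[of n] closure_subset by (fastforce simp: B_def)
    then obtain y \<rho> where y: "strict_mono \<rho>" "(\<lambda>n. ?T (x (\<rho> n))) \<longlonglongrightarrow> y"
      using hs_herm_compact_image[of a, unfolded compact_def, rule_format, of "\<lambda>n. ?T (x n)"]
      by (auto simp: o_def)
    have nT: "(\<lambda>n. norm (?T (x n))) \<longlonglongrightarrow> s"
    proof (rule tendsto_sandwich)
      have "(\<lambda>n. s - 1 / real (Suc n)) \<longlonglongrightarrow> s - 0"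
        by (intro tendsto_intros LIMSEQ_Suc lim_1_over_n)
      then show "(\<lambda>n. s - 1 / real (Suc n)) \<longlonglongrightarrow> s" by simp
      show "\<forall>\<^sub>F n in sequentially. s - 1 / real (Suc n) \<le> norm (?T (x n))"
        by (intro always_eventually allI less_imp_le x(2))
      show "\<forall>\<^sub>F n in sequentially. norm (?T (x n)) \<le> s"
        by (intro always_eventually allI le1 x(1))
    qed (rule tendsto_const)
    \<comment> \<open>Expanding the square, the cross term is
      \<open>inner (T (T x)) x = (norm (T x))\<^sup>2\<close> by self-adjointness; the first term is
      bounded by invariance of \<open>W\<close>.\<close>
    have est: "(norm (?T (?T (x n)) - s\<^sup>2 *\<^sub>R x n))\<^sup>2 \<le> s\<^sup>2 * (s\<^sup>2 - (norm (?T (x n)))\<^sup>2)" for n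
    proof -
      have xn: "x n \<in> W" "norm (x n) = 1" using x(1)[of n] by (auto simp: B_def)
      have "norm (?T (?T (x n))) \<le> s * norm (?T (x n))" by (rule le[OF inv[OF xn(1)]])
      from power_mono[OF this, of 2]
      have 1: "(norm (?T (?T (x n))))\<^sup>2 \<le> s\<^sup>2 * (norm (?T (x n)))\<^sup>2" by (simp add: power_mult_distrib)
      have 2: "inner (?T (?T (x n))) (x n) = (norm (?T (x n)))\<^sup>2"
        using cinner_self_adjoint[of ?T "?T (x n)" "x n"] hs_op[of a]
        by (simp add: inner_eq_Re_cinner cinner_self)
      have "(norm (?T (?T (x n)) - s\<^sup>2 *\<^sub>R x n))\<^sup>2 =
          (norm (?T (?T (x n))))\<^sup>2 - 2 * s\<^sup>2 * inner (?T (?T (x n))) (x n) + (s\<^sup>2)\<^sup>2 * (norm (x n))\<^sup>2"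
        unfolding power2_norm_eq_inner by (simp add: inner_diff_left inner_diff_right inner_commute algebra_simps power2_eq_square)
      also have "\<dots> \<le> s\<^sup>2 * (norm (?T (x n)))\<^sup>2 - 2 * s\<^sup>2 * (norm (?T (x n)))\<^sup>2 + (s\<^sup>2)\<^sup>2"
        using 1 2 xn by simp
      also have "\<dots> = s\<^sup>2 * (s\<^sup>2 - (norm (?T (x n)))\<^sup>2)" by (simp add: algebra_simps power2_eq_square)
      finally show ?thesis .
    qed
    have lim0: "(\<lambda>n. ?T (?T (x n)) - s\<^sup>2 *\<^sub>R x n) \<longlonglongrightarrow> 0"
    proof -
      have "(\<lambda>n. s\<^sup>2 * (s\<^sup>2 - (norm (?T (x n)))\<^sup>2)) \<longlonglongrightarrow> s\<^sup>2 * (s\<^sup>2 - s\<^sup>2)"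
        by (intro tendsto_intros nT)
      then have g: "(\<lambda>n. s\<^sup>2 * (s\<^sup>2 - (norm (?T (x n)))\<^sup>2)) \<longlonglongrightarrow> 0" by simp
      have "(\<lambda>n. (norm (?T (?T (x n)) - s\<^sup>2 *\<^sub>R x n))\<^sup>2) \<longlonglongrightarrow> 0"
      proof (rule Lim_null_comparison[OF _ g], rule always_eventually, rule allI)
        show "norm ((norm (?T (?T (x n)) - s\<^sup>2 *\<^sub>R x n))\<^sup>2) \<le> s\<^sup>2 * (s\<^sup>2 - (norm (?T (x n)))\<^sup>2)" for n
          using est[of n] by simp
      qed
      then have "(\<lambda>n. norm (?T (?T (x n)) - s\<^sup>2 *\<^sub>R x n)) \<longlonglongrightarrow> 0"
        by (subst (asm) power_tendsto_0_iff) simp_all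
      then show ?thesis by (rule tendsto_norm_zero_cancel)
    qed
    have Ty: "(\<lambda>n. ?T (?T (x (\<rho> n)))) \<longlonglongrightarrow> ?T y" by (intro blinfun.tendsto tendsto_const y(2))
    have "(\<lambda>n. ?T (?T (x (\<rho> n))) - (?T (?T (x (\<rho> n))) - s\<^sup>2 *\<^sub>R x (\<rho> n))) \<longlonglongrightarrow> ?T y - 0"
      by (intro tendsto_diff Ty LIMSEQ_subseq_LIMSEQ[OF lim0 y(1), unfolded o_def])
    then have "(\<lambda>n. (1 / s\<^sup>2) *\<^sub>R s\<^sup>2 *\<^sub>R x (\<rho> n)) \<longlonglongrightarrow> (1 / s\<^sup>2) *\<^sub>R ?T y"
      by (intro tendsto_scaleR tendsto_const) simp
    then have xl: "(\<lambda>n. x (\<rho> n)) \<longlonglongrightarrow> (1 / s\<^sup>2) *\<^sub>R ?T y" using s by simp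
    define u where "u = (1 / s\<^sup>2) *\<^sub>R ?T y"
    have uW: "u \<in> W" using closed_sequentially[OF W(2) _ xl] x(1) by (auto simp: u_def B_def)
    have "(\<lambda>n. norm (x (\<rho> n))) \<longlonglongrightarrow> norm u" using xl unfolding u_def by (rule tendsto_norm)
    then have "(\<lambda>n::nat. 1::real) \<longlonglongrightarrow> norm u" using x(1) by (simp add: B_def)
    then have nu: "norm u = 1" using LIMSEQ_unique tendsto_const by metis
    have "(\<lambda>n. ?T (?T (x (\<rho> n))) - s\<^sup>2 *\<^sub>R x (\<rho> n)) \<longlonglongrightarrow> ?T (?T u) - s\<^sup>2 *\<^sub>R u"
      by (intro tendsto_intros xl[folded u_def])
    then have "?T (?T u) - s\<^sup>2 *\<^sub>R u = 0"
      using LIMSEQ_unique LIMSEQ_subseq_LIMSEQ[OF lim0 y(1), unfolded o_def] by blast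
    then have TT: "?T (?T u) = s\<^sup>2 *\<^sub>R u" by simp
    \<comment> \<open>\<open>(T - s) (T + s) u = 0\<close>: if \<open>z\<close> vanishes,
      \<open>u\<close> has eigenvalue \<open>- s\<close>, otherwise \<open>z\<close> has eigenvalue
      \<open>s\<close>.\<close>
    define z where "z = ?T u + s *\<^sub>R u"
    show ?thesis
    proof (cases "z = 0")
      case True
      then have "?T u = complex_of_real (- s) *\<^sub>C u"
        by (simp add: z_def flip: scaleR_eq_scaleC) (simp add: add_eq_0_iff2)
      then show ?thesis using uW nu by blast
    next
      case False
      have "?T z = complex_of_real s *\<^sub>C z"
        unfolding scaleR_eq_scaleC[symmetric]
        by (simp add: z_def blinfun.add_right blinfun.scaleR_right TT scaleR_add_right power2_eq_square)
      moreover have "z \<in> W"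
        unfolding z_def scaleR_eq_scaleC using uW inv
        by (intro complex_vector.subspace_add complex_vector.subspace_scale W(1)) auto
      ultimately show ?thesis using unit[of z s] False by (auto simp: B_def)
    qed
  qed
qed


definition eigenbasis :: "'a::complex_hilbert_space hs_herm \<Rightarrow> 'a set \<Rightarrow> ('a \<Rightarrow> real) \<Rightarrow> bool" where
  "eigenbasis a E \<mu> \<longleftrightarrow> is_onb E \<and> (\<forall>e\<in>E. hs_op a e = complex_of_real (\<mu> e) *\<^sub>C e)"

text \<open>Take a maximal orthonormal set of eigenvectors. Its orthogonal complement is closed and,
  by self-adjointness, invariant; if it were nonzero it would contain a further eigenvector.\<close>

theorem ex_eigenbasis: "\<exists>E \<mu>. eigenbasis a E \<mu>"
proof -
  let ?T = "hs_op a"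
  define \<A> where "\<A> = {E. (\<forall>e\<in>E. \<forall>f\<in>E. cinner e f = (if e = f then 1 else 0)) \<and>
    (\<forall>e\<in>E. \<exists>r. ?T e = complex_of_real r *\<^sub>C e)}"
  have "\<Union>\<C> \<in> \<A>" if \<C>: "subset.chain \<A> \<C>" for \<C>
  proof -
    have sub: "\<C> \<subseteq> \<A>" and lin: "\<And>X Y. X \<in> \<C> \<Longrightarrow> Y \<in> \<C> \<Longrightarrow> X \<subseteq> Y \<or> Y \<subseteq> X"
      using \<C> by (auto simp: subset_chain_def)
    have "cinner e f = (if e = f then 1 else 0)" if ef: "e \<in> \<Union>\<C>" "f \<in> \<Union>\<C>" for e f
    proof -
      obtain X Y where XY: "X \<in> \<C>" "e \<in> X" "Y \<in> \<C>" "f \<in> Y" using ef by blast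
      then have "X \<union> Y \<in> \<C>" using lin[OF XY(1,3)] by (auto simp: sup.absorb1 sup.absorb2)
      then have "X \<union> Y \<in> \<A>" using sub by blast
      then show ?thesis using XY by (simp add: \<A>_def)
    qed
    moreover have "\<exists>r. ?T e = complex_of_real r *\<^sub>C e" if "e \<in> \<Union>\<C>" for e
      using that sub by (auto simp: \<A>_def)
    ultimately show ?thesis by (simp add: \<A>_def)
  qed
  then have "\<exists>M\<in>\<A>. \<forall>X\<in>\<A>. M \<subseteq> X \<longrightarrow> X = M" by (rule subset_Zorn')
  then obtain E where E: "E \<in> \<A>" and max: "\<And>X. X \<in> \<A> \<Longrightarrow> E \<subseteq> X \<Longrightarrow> X = E" by blast
  define W where "W = {x. \<forall>e\<in>E. cinner e x = 0}"
  have subW: "complex_vector.subspace W"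
    by (auto simp: W_def complex_vector.subspace_def cinner.zero_right cinner_add_right cinner_scaleC_right)
  have "W = (\<Inter>e\<in>E. {x. cinner e x = 0})" by (auto simp: W_def)
  then have clW: "closed W"
    by (auto intro!: closed_INT closed_Collect_eq continuous_intros
        linear_continuous_on cinner.bounded_linear_right)
  have "?T x \<in> W" if "x \<in> W" for x
    unfolding W_def
  proof (intro CollectI ballI)
    fix e assume e: "e \<in> E"
    then obtain r where "?T e = complex_of_real r *\<^sub>C e" using E unfolding \<A>_def by blast
    moreover have "cinner e (?T x) = cinner (?T e) x"
      using cinner_self_adjoint[of ?T e x] hs_op[of a] by simp
    ultimately show "cinner e (?T x) = 0"
      using that e by (simp add: cinner_scaleC_left W_def)
  qed
  note inv = this
  have W0: "W = {0}"
  proof (rule ccontr)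
    assume "W \<noteq> {0}"
    from hs_herm_eigenvector[OF subW clW this inv]
    obtain x r where x: "x \<in> W" "norm x = 1" "?T x = complex_of_real r *\<^sub>C x" by blast
    have ex: "cinner e x = 0" "cinner x e = 0" if "e \<in> E" for e
      using x(1) that cinner_commute[of x e] by (simp_all add: W_def)
    have xx: "cinner x x = 1" using x(2) by (simp add: cinner_self)
    have "insert x E \<in> \<A>" using E ex xx x(3) by (auto simp: \<A>_def)
    then have "x \<in> E" using max by blast
    then show False using ex(1) xx by auto
  qed
  let ?S = "closure (complex_vector.span E)"
  have sub: "complex_vector.subspace ?S" by (rule closed_csubspace_closure) simp
  have "v \<in> ?S" for v
  proof -
    obtain p where p: "p \<in> ?S" "\<And>s. s \<in> ?S \<Longrightarrow> cinner s (v - p) = 0"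
      using orthogonal_projection[OF sub] by blast
    have "E \<subseteq> ?S" using complex_vector.span_superset closure_subset by blast
    then have "v - p \<in> W" using p(2) by (auto simp: W_def)
    then show ?thesis using W0 p(1) by auto
  qed
  then have "is_onb E" using E by (auto simp: \<A>_def is_onb_def)
  moreover have "\<forall>e\<in>E. \<exists>r. ?T e = complex_of_real r *\<^sub>C e"
    using E unfolding \<A>_def by blast
  from bchoice[OF this] obtain \<mu> where "\<forall>e\<in>E. ?T e = complex_of_real (\<mu> e) *\<^sub>C e" ..
  ultimately show ?thesis unfolding eigenbasis_def by blast
qed

section \<open>Exponentials of skew-adjoint operators\<close>

text \<open>An instance of \<open>double_series\<close> whose row \<open>n\<close> is the
  antidiagonal of total degree \<open>n\<close>. It is needed with composition of operators as
  \<open>B\<close>.\<close>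

lemma bilinear_Cauchy_product_sums:
  fixes x :: "nat \<Rightarrow> 'a::banach" and y :: "nat \<Rightarrow> 'b::banach" and B :: "'a \<Rightarrow> 'b \<Rightarrow> 'c::banach"
  assumes B: "bounded_bilinear B" and x: "summable (\<lambda>n. norm (x n))" and y: "summable (\<lambda>n. norm (y n))"
  shows "(\<lambda>n. \<Sum>i\<le>n. B (x i) (y (n - i))) sums B (suminf x) (suminf y)"
proof -
  interpret B: bounded_bilinear B by (rule B)
  obtain K where K: "0 \<le> K" "\<And>u v. norm (B u v) \<le> norm u * norm v * K"
    using B.nonneg_bounded by blast
  define a where "a n k = (if k \<le> n then B (x k) (y (n - k)) else 0)" for n k
  define t where "t n k = (if k \<le> n then norm (x k) * norm (y (n - k)) * K else 0)" for n k
  define s where "s n = (\<Sum>k\<le>n. norm (x k) * norm (y (n - k))) * K" for n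
  have s: "summable s"
    unfolding s_def by (intro summable_mult2 summable_Cauchy_product) (use x y in simp_all)
  have le: "norm (a n k) \<le> t n k" for n k using K by (simp add: a_def t_def)
  have z: "n < k \<Longrightarrow> t n k = 0" for n k by (simp add: t_def)
  have ts: "(\<Sum>k\<le>n. t n k) \<le> s n" for n by (simp add: t_def s_def sum_distrib_right)
  note D = double_series[OF le z ts s]
  have inner: "(\<Sum>n. a n k) = B (x k) (suminf y)" for k
  proof -
    have "(\<lambda>n. B (x k) (y n)) sums B (x k) (suminf y)"
      by (rule bounded_linear.sums[OF B.bounded_linear_right summable_sums[OF summable_norm_cancel[OF y]]])
    then have "(\<lambda>n. a (n + k) k) sums B (x k) (suminf y)" by (simp add: a_def)
    moreover have "(\<Sum>n<k. a n k) = 0" by (simp add: a_def)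
    ultimately have "(\<lambda>n. a n k) sums B (x k) (suminf y)"
      using sums_iff_shift[of "\<lambda>n. a n k" k] by simp
    then show ?thesis by (rule sums_unique[symmetric])
  qed
  have outer: "(\<lambda>k. B (x k) (suminf y)) sums B (suminf x) (suminf y)"
    by (rule bounded_linear.sums[OF B.bounded_linear_left summable_sums[OF summable_norm_cancel[OF x]]])
  have "(\<Sum>n. \<Sum>k\<le>n. a n k) = B (suminf x) (suminf y)"
    using D(3) outer sums_unique2 unfolding inner by blast
  moreover have "summable (\<lambda>n. \<Sum>k\<le>n. a n k)"
  proof (rule summable_comparison_test'[OF s])
    show "norm (\<Sum>k\<le>n. a n k) \<le> s n" for n
      by (rule order_trans[OF sum_norm_le ts]) (rule le)
  qed
  ultimately have "(\<lambda>n. \<Sum>k\<le>n. a n k) sums B (suminf x) (suminf y)"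
    using summable_sums by metis
  then show ?thesis by (simp add: a_def)
qed

definition ad :: "('a::real_normed_vector \<Rightarrow>\<^sub>L 'a) \<Rightarrow> ('a \<Rightarrow>\<^sub>L 'a) \<Rightarrow> ('a \<Rightarrow>\<^sub>L 'a)" where
  "ad k y = (k o\<^sub>L y) - (y o\<^sub>L k)"

definition exp_term :: "('a::real_normed_vector \<Rightarrow>\<^sub>L 'a) \<Rightarrow> nat \<Rightarrow> ('a \<Rightarrow>\<^sub>L 'a)" where
  "exp_term k n = (1 / fact n) *\<^sub>R ((o\<^sub>L) k ^^ n) id_blinfun"

definition blinfun_exp :: "('a::banach \<Rightarrow>\<^sub>L 'a) \<Rightarrow> ('a \<Rightarrow>\<^sub>L 'a)" where
  "blinfun_exp k = (\<Sum>n. exp_term k n)"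

lemmas blinfun_compose_simps =
  bounded_bilinear.add_left[OF bounded_bilinear_blinfun_compose]
  bounded_bilinear.add_right[OF bounded_bilinear_blinfun_compose]
  bounded_bilinear.diff_left[OF bounded_bilinear_blinfun_compose]
  bounded_bilinear.diff_right[OF bounded_bilinear_blinfun_compose]
  bounded_bilinear.minus_left[OF bounded_bilinear_blinfun_compose]
  bounded_bilinear.minus_right[OF bounded_bilinear_blinfun_compose]
  bounded_bilinear.scaleR_left[OF bounded_bilinear_blinfun_compose]
  bounded_bilinear.scaleR_right[OF bounded_bilinear_blinfun_compose]
  bounded_bilinear.sum_left[OF bounded_bilinear_blinfun_compose]
  bounded_bilinear.sum_right[OF bounded_bilinear_blinfun_compose]
  bounded_bilinear.zero_left[OF bounded_bilinear_blinfun_compose]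
  bounded_bilinear.zero_right[OF bounded_bilinear_blinfun_compose]

lemma blinfun_compose_assoc: "(a o\<^sub>L b) o\<^sub>L c = a o\<^sub>L (b o\<^sub>L c)"
  by (simp add: blinfun_eqI)

lemma blinfun_compose_id [simp]: "id_blinfun o\<^sub>L a = a" "a o\<^sub>L id_blinfun = a"
  by (simp_all add: blinfun_eqI)

lemma exp_term_Suc:
  "exp_term k (Suc n) = (1 / Suc n) *\<^sub>R (k o\<^sub>L exp_term k n)"
  by (simp add: exp_term_def blinfun_compose_simps)

lemma exp_term_0: "exp_term k 0 = id_blinfun"
  by (simp add: exp_term_def)

lemma exp_term_commute: "exp_term k n o\<^sub>L k = k o\<^sub>L exp_term k n"
proof (induction n)
  case (Suc n)
  then show ?case by (simp add: exp_term_Suc blinfun_compose_simps blinfun_compose_assoc)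
qed (simp add: exp_term_0 blinfun_eqI)

lemma norm_exp_term: "norm (exp_term k n) \<le> norm k ^ n /\<^sub>R fact n"
proof (induction n)
  case 0
  show ?case by (simp add: exp_term_0 norm_blinfun_id_le)
next
  case (Suc n)
  have "norm (exp_term k (Suc n)) \<le> (1 / Suc n) * (norm k * norm (exp_term k n))"
    unfolding exp_term_Suc by (simp add: norm_blinfun_compose divide_right_mono)
  also have "\<dots> \<le> (1 / Suc n) * (norm k * (norm k ^ n /\<^sub>R fact n))"
    by (intro mult_left_mono Suc) auto
  finally show ?case by (simp add: field_simps)
qed

lemma summable_norm_exp_term: "summable (\<lambda>n. norm (exp_term k n))"
  by (rule summable_comparison_test'[OF summable_exp_generic[of "norm k"]]) (use norm_exp_term[of k] in simp)

lemma exp_term_sums: "exp_term k sums blinfun_exp (k :: 'a::banach \<Rightarrow>\<^sub>L 'a)"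
  unfolding blinfun_exp_def by (rule summable_sums[OF summable_norm_cancel[OF summable_norm_exp_term]])

text \<open>The degree \<open>n\<close> part of \<open>exp k y exp (- k) = exp (ad k) y\<close>.
  Multiplying by \<open>k\<close> on the left weights term \<open>i\<close> of the next degree by
  \<open>i\<close>, multiplying on the right weights it by \<open>- (n + 1 - i)\<close>; in the
  commutator the weights add up to \<open>n + 1\<close> for every \<open>i\<close>.\<close>

lemma exp_term_conjugate:
  "(\<Sum>i\<le>n. exp_term k i o\<^sub>L (y o\<^sub>L exp_term (- k) (n - i))) = (1 / fact n) *\<^sub>R (ad k ^^ n) y"
proof (induction n)
  case 0
  show ?case by (simp add: exp_term_0 blinfun_eqI)
next
  case (Suc n)
  let ?Z = "\<lambda>n. \<Sum>i\<le>n. exp_term k i o\<^sub>L (y o\<^sub>L exp_term (- k) (n - i))"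
  let ?z = "\<lambda>i. exp_term k i o\<^sub>L (y o\<^sub>L exp_term (- k) (Suc n - i))"
  have 1: "k o\<^sub>L ?Z n = (\<Sum>i\<le>Suc n. real i *\<^sub>R ?z i)"
    unfolding sum.atMost_Suc_shift
    by (simp add: exp_term_Suc blinfun_compose_simps blinfun_compose_assoc del: of_nat_Suc)
  have "exp_term (- k) (Suc n - i) = (- 1 / real (Suc n - i)) *\<^sub>R (exp_term (- k) (n - i) o\<^sub>L k)" if "i \<le> n" for i
    using that exp_term_commute[of "- k" "n - i"]
    by (simp add: Suc_diff_le exp_term_Suc blinfun_compose_simps del: of_nat_Suc)
  then have "exp_term k i o\<^sub>L (y o\<^sub>L (exp_term (- k) (n - i) o\<^sub>L k)) = - (real (Suc n - i) *\<^sub>R ?z i)" if "i \<le> n" for i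
    using that by (simp add: blinfun_compose_simps Suc_diff_le del: of_nat_Suc)
  then have "?Z n o\<^sub>L k = - (\<Sum>i\<le>n. real (Suc n - i) *\<^sub>R ?z i)"
    by (simp add: blinfun_compose_simps blinfun_compose_assoc sum_negf del: of_nat_Suc of_nat_diff)
  then have 2: "?Z n o\<^sub>L k = - (\<Sum>i\<le>Suc n. real (Suc n - i) *\<^sub>R ?z i)" by simp
  have "ad k (?Z n) = (\<Sum>i\<le>Suc n. (real i + real (Suc n - i)) *\<^sub>R ?z i)"
    unfolding ad_def 1 2 scaleR_add_left sum.distrib by simp
  also have "\<dots> = (\<Sum>i\<le>Suc n. real (Suc n) *\<^sub>R ?z i)"
    by (intro sum.cong refl) (simp add: of_nat_diff)
  also have "\<dots> = real (Suc n) *\<^sub>R ?Z (Suc n)" by (simp only: scaleR_sum_right)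
  finally have "?Z (Suc n) = (1 / real (Suc n)) *\<^sub>R ad k (?Z n)" by (simp del: of_nat_Suc)
  also have "\<dots> = (1 / fact (Suc n)) *\<^sub>R (ad k ^^ Suc n) y"
    unfolding Suc.IH by (simp add: ad_def blinfun_compose_simps scaleR_diff_right)
  finally show ?case .
qed

lemma blinfun_exp_conjugate:
  fixes k y :: "'a::banach \<Rightarrow>\<^sub>L 'a"
  shows "(\<lambda>n. (1 / fact n) *\<^sub>R (ad k ^^ n) y) sums (blinfun_exp k o\<^sub>L (y o\<^sub>L blinfun_exp (- k)))"
proof -
  have s: "summable (\<lambda>n. norm (y o\<^sub>L exp_term (- k) n))"
    by (rule summable_comparison_test'[OF summable_mult[OF summable_norm_exp_term, of "norm y" "- k"]])
       (simp add: norm_blinfun_compose)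
  have "(\<lambda>n. y o\<^sub>L exp_term (- k) n) sums (y o\<^sub>L blinfun_exp (- k))"
    by (rule bounded_linear.sums[OF bounded_bilinear.bounded_linear_right[OF bounded_bilinear_blinfun_compose] exp_term_sums])
  then have "(\<Sum>n. y o\<^sub>L exp_term (- k) n) = y o\<^sub>L blinfun_exp (- k)" by (rule sums_unique[symmetric])
  then show ?thesis
    using bilinear_Cauchy_product_sums[OF bounded_bilinear_blinfun_compose summable_norm_exp_term s, of k]
    by (simp add: exp_term_conjugate blinfun_exp_def)
qed

text \<open>Conjugate the identity: \<open>ad k\<close> annihilates it, so only the term of degree
  \<open>0\<close> remains.\<close>

lemma blinfun_exp_inverse:
  fixes k :: "'a::banach \<Rightarrow>\<^sub>L 'a"
  shows "blinfun_exp k o\<^sub>L blinfun_exp (- k) = id_blinfun"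
proof -
  have ad0: "(ad k ^^ n) id_blinfun = 0" if "n \<noteq> 0" for n
  proof -
    have "(ad k ^^ Suc m) id_blinfun = 0" for m
      by (induction m) (simp_all add: ad_def blinfun_compose_simps)
    then show ?thesis using that not0_implies_Suc by blast
  qed
  have "(\<lambda>n. (1 / fact n) *\<^sub>R (ad k ^^ n) id_blinfun) sums (\<Sum>n\<in>{0}. (1 / fact n) *\<^sub>R (ad k ^^ n) id_blinfun)"
    by (rule sums_finite) (use ad0 in auto)
  then have "(\<lambda>n. (1 / fact n) *\<^sub>R (ad k ^^ n) id_blinfun) sums id_blinfun" by simp
  from sums_unique2[OF blinfun_exp_conjugate this] show ?thesis by simp
qed

text \<open>Skew-adjointness turns the terms of \<open>exp k\<close> into those of
  \<open>exp (- k)\<close> under the adjoint, and these exponentials are inverse to each other.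
  Complex linearity is checked as well, because the operator type consists of real-linear
  maps.\<close>

lemma unitary_blinfun_exp:
  fixes k :: "'a::complex_hilbert_space \<Rightarrow>\<^sub>L 'a"
  assumes k: "k \<in> bounded_ops" "adj k = - k"
  shows "unitary (blinfun_exp k)" "adj (blinfun_exp k) = blinfun_exp (- k)"
proof -
  have ksc: "k (c *\<^sub>C x) = c *\<^sub>C k x" for c x by (rule bounded_ops_scaleC[OF k(1)])
  have app: "(\<lambda>n. exp_term k n x) sums blinfun_exp k x" for x and k :: "'a \<Rightarrow>\<^sub>L 'a"
    by (rule bounded_linear.sums[OF blinfun.bounded_linear_left exp_term_sums])
  have et: "exp_term k n (c *\<^sub>C x) = c *\<^sub>C exp_term k n x" for n c x
    by (induction n) (simp_all add: exp_term_0 exp_term_Suc blinfun.scaleR_left ksc scaleR_eq_scaleC scaleC_scaleC mult.commute)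
  have b: "blinfun_exp k \<in> bounded_ops"
    unfolding bounded_ops_def
  proof (intro CollectI allI)
    fix c x
    have "(\<lambda>n. c *\<^sub>C exp_term k n x) sums (c *\<^sub>C blinfun_exp k x)"
      by (rule bounded_linear.sums[OF bounded_linear_scaleC app])
    then show "blinfun_exp k (c *\<^sub>C x) = c *\<^sub>C blinfun_exp k x"
      using app[of k "c *\<^sub>C x"] unfolding et by (metis sums_unique2)
  qed
  have kadj: "cinner (k x) y = - cinner x (k y)" for x y
    using cinner_adj_right[OF k(1), of x y] k(2) by (simp add: blinfun.minus_left cinner.minus_right)
  have kcomm: "k (exp_term (- k) n x) = exp_term (- k) n (k x)" for n x
    using arg_cong[OF exp_term_commute[of "- k" n], of "\<lambda>T. T x"]
    by (simp add: blinfun_compose_simps blinfun.minus_left)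
  have "cinner (exp_term k n x) y = cinner x (exp_term (- k) n y)" for n x y
  proof (induction n arbitrary: x y)
    case (Suc n)
    have "cinner (exp_term k (Suc n) x) y = (1 / real (Suc n)) *\<^sub>R cinner (k (exp_term k n x)) y"
      by (simp add: exp_term_Suc blinfun.scaleR_left cinner.scaleR_left del: of_nat_Suc)
    also have "\<dots> = (1 / real (Suc n)) *\<^sub>R - cinner x (exp_term (- k) n (k y))"
      by (simp only: kadj Suc)
    also have "\<dots> = cinner x (exp_term (- k) (Suc n) y)"
      by (simp add: exp_term_Suc blinfun.scaleR_left blinfun.minus_left cinner.scaleR_right cinner.minus_right kcomm del: of_nat_Suc)
    finally show ?case .
  qed (simp add: exp_term_0)
  then have "cinner (blinfun_exp k x) y = cinner x (blinfun_exp (- k) y)" for x y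
    using bounded_linear.sums[OF cinner.bounded_linear_left app[of k x], of y]
      bounded_linear.sums[OF cinner.bounded_linear_right app[of "- k" y], of x] sums_unique2 by simp
  then show adj: "adj (blinfun_exp k) = blinfun_exp (- k)" by (rule adj_unique)
  show "unitary (blinfun_exp k)"
    using b blinfun_exp_inverse[of k] blinfun_exp_inverse[of "- k"] by (simp add: unitary_def adj)
qed

section \<open>Orbits of operators with finite spectrum\<close>

lemma hs_op_Abs: "hilbert_schmidt T \<Longrightarrow> adj T = T \<Longrightarrow> hs_op (Abs_hs_herm T) = T"
  by (simp add: Abs_hs_herm_inverse)

section \<open>Hilbert-Schmidt bounds for commutators and compressions\<close>

abbreviation hs_sum :: "('a::complex_hilbert_space \<Rightarrow>\<^sub>L 'a) \<Rightarrow> real" where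
  "hs_sum T \<equiv> (\<Sum>\<^sub>\<infinity>e\<in>some_onb. (norm (T e))\<^sup>2)"

lemma hs_sum_compose_left:
  fixes S T :: "'a::complex_hilbert_space \<Rightarrow>\<^sub>L 'a"
  assumes S: "S \<in> bounded_ops" and T: "hilbert_schmidt T"
  shows "hs_sum (S o\<^sub>L T) \<le> (norm S)\<^sup>2 * hs_sum T"
proof -
  have s: "(\<lambda>e. (norm (T e))\<^sup>2) summable_on some_onb" if "hilbert_schmidt T" for T :: "'a \<Rightarrow>\<^sub>L 'a"
    using that is_onb_some by (auto simp: hilbert_schmidt_def)
  have "hs_sum (S o\<^sub>L T) \<le> (\<Sum>\<^sub>\<infinity>e\<in>some_onb. (norm S)\<^sup>2 * (norm (T e))\<^sup>2)"
  proof (rule infsum_mono[OF s summable_on_cmult_right[OF s[OF T]]])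
    show "hilbert_schmidt (S o\<^sub>L T)" by (rule hilbert_schmidt_compose_left[OF S T])
    show "(norm ((S o\<^sub>L T) e))\<^sup>2 \<le> (norm S)\<^sup>2 * (norm (T e))\<^sup>2" for e
      using power_mono[OF norm_blinfun[of S "T e"], of 2] by (simp add: power_mult_distrib)
  qed
  also have "\<dots> = (norm S)\<^sup>2 * hs_sum T"
    by (rule infsum_cmult_right) (rule s[OF T])
  finally show ?thesis .
qed

lemma hs_sum_adj:
  fixes T :: "'a::complex_hilbert_space \<Rightarrow>\<^sub>L 'a"
  assumes "hilbert_schmidt T"
  shows "hs_sum (adj T) = hs_sum T"
  using hs_infsum_inner_onb(2)[OF assms assms is_onb_some is_onb_some] by (simp add: power2_norm_eq_inner)

text \<open>The left-hand bound applied to adjoints. \<open>norm (adj S)\<close> reduces to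
  \<open>norm S\<close> for the self-adjoint and skew-adjoint \<open>S\<close> in question.\<close>

lemma hs_sum_compose_right:
  fixes S T :: "'a::complex_hilbert_space \<Rightarrow>\<^sub>L 'a"
  assumes S: "S \<in> bounded_ops" and T: "hilbert_schmidt T"
  shows "hs_sum (T o\<^sub>L S) \<le> (norm (adj S))\<^sup>2 * hs_sum T"
proof -
  have Tb: "T \<in> bounded_ops" using T by (simp add: hilbert_schmidt_def)
  have "adj (T o\<^sub>L S) = adj S o\<^sub>L adj T" by (rule adj_compose[OF Tb S])
  then show ?thesis
    using hs_sum_adj[OF hilbert_schmidt_compose_right[OF S T]]
      hs_sum_compose_left[OF adj_bounded_ops[OF S] hilbert_schmidt_adj[OF T]]
    by (simp add: hs_sum_adj[OF T])
qed

lemma norm_hs_herm_leI: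
  assumes "hs_sum (hs_op z) \<le> c\<^sup>2 * hs_sum (hs_op y)" "0 \<le> c"
  shows "norm z \<le> c * norm y"
  by (rule power2_le_imp_le) (use assms in \<open>simp_all add: power_mult_distrib norm_hs_herm_eq\<close>)

text \<open>Meaningful for skew-adjoint \<open>k\<close>, whose commutator with a self-adjoint
  operator is self-adjoint again.\<close>

definition herm_ad :: "('a::complex_hilbert_space \<Rightarrow>\<^sub>L 'a) \<Rightarrow> 'a hs_herm \<Rightarrow> 'a hs_herm" where
  "herm_ad k y = Abs_hs_herm (ad k (hs_op y))"

definition herm_cut :: "('a::complex_hilbert_space \<Rightarrow>\<^sub>L 'a) \<Rightarrow> 'a hs_herm \<Rightarrow> 'a hs_herm" where
  "herm_cut p y = Abs_hs_herm (p o\<^sub>L (hs_op y o\<^sub>L p))"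

text \<open>The norm bound is the summed form of \<open>(norm (u - v))\<^sup>2 \<le> 2 * (norm
  u)\<^sup>2 + 2 * (norm v)\<^sup>2\<close>: both products contribute
  \<open>2 * (norm k)\<^sup>2\<close>, together the square of \<open>2 * norm k\<close>.\<close>

lemma
  assumes k: "k \<in> bounded_ops" "adj k = - k"
  shows hs_op_herm_ad: "hs_op (herm_ad k y) = ad k (hs_op y)"
    and norm_herm_ad: "norm (herm_ad k y) \<le> 2 * norm k * norm y"
proof -
  have kadj: "cinner (k u) v = - cinner u (k v)" for u v
    using cinner_adj_right[OF k(1), of u v] k(2) by (simp add: blinfun.minus_left cinner.minus_right)
  have y: "cinner (hs_op y u) v = cinner u (hs_op y v)" for u v
    using cinner_self_adjoint hs_op by blast
  have hs: "hilbert_schmidt (k o\<^sub>L hs_op y)" "hilbert_schmidt (hs_op y o\<^sub>L k)"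
    by (intro hilbert_schmidt_compose_left hilbert_schmidt_compose_right k hs_op)+
  have "adj (ad k (hs_op y)) = ad k (hs_op y)"
    by (rule adj_unique)
       (simp add: ad_def blinfun.diff_left cinner.diff_left cinner.diff_right kadj y cinner.minus_left cinner.minus_right)
  then show eq: "hs_op (herm_ad k y) = ad k (hs_op y)"
    unfolding herm_ad_def using hs by (intro hs_op_Abs) (auto simp: ad_def hilbert_schmidt_diff)
  have s: "(\<lambda>e. (norm (T e))\<^sup>2) summable_on some_onb" if "hilbert_schmidt T" for T :: "'a \<Rightarrow>\<^sub>L 'a"
    using that is_onb_some by (auto simp: hilbert_schmidt_def)
  have "hs_sum (ad k (hs_op y)) \<le> (\<Sum>\<^sub>\<infinity>e\<in>some_onb. 2 * (norm ((k o\<^sub>L hs_op y) e))\<^sup>2 + 2 * (norm ((hs_op y o\<^sub>L k) e))\<^sup>2)"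
  proof (rule infsum_mono)
    show "(\<lambda>e. (norm (ad k (hs_op y) e))\<^sup>2) summable_on some_onb"
      by (rule s) (simp add: ad_def hilbert_schmidt_diff hs)
    show "(\<lambda>e. 2 * (norm ((k o\<^sub>L hs_op y) e))\<^sup>2 + 2 * (norm ((hs_op y o\<^sub>L k) e))\<^sup>2) summable_on some_onb"
      by (intro summable_on_add summable_on_cmult_right s hs)
    show "(norm (ad k (hs_op y) e))\<^sup>2 \<le> 2 * (norm ((k o\<^sub>L hs_op y) e))\<^sup>2 + 2 * (norm ((hs_op y o\<^sub>L k) e))\<^sup>2" for e
    proof -
      let ?u = "(k o\<^sub>L hs_op y) e" and ?v = "(hs_op y o\<^sub>L k) e"
      have "2 * (norm ?u)\<^sup>2 + 2 * (norm ?v)\<^sup>2 - (norm (?u - ?v))\<^sup>2 = (norm (?u + ?v))\<^sup>2"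
        by (simp add: power2_norm_eq_inner inner_diff_left inner_diff_right inner_add_left inner_add_right
            inner_commute del: blinfun_apply_blinfun_compose)
      then have "(norm (?u - ?v))\<^sup>2 \<le> 2 * (norm ?u)\<^sup>2 + 2 * (norm ?v)\<^sup>2"
        using zero_le_power2[of "norm (?u + ?v)"] by linarith
      then show ?thesis by (simp add: ad_def blinfun.diff_left)
    qed
  qed
  also have "\<dots> = 2 * hs_sum (k o\<^sub>L hs_op y) + 2 * hs_sum (hs_op y o\<^sub>L k)"
    using s[OF hs(1)] s[OF hs(2)]
    by (subst infsum_add) (auto intro!: summable_on_cmult_right simp: infsum_cmult_right')
  also have "\<dots> \<le> 2 * ((norm k)\<^sup>2 * hs_sum (hs_op y)) + 2 * ((norm k)\<^sup>2 * hs_sum (hs_op y))"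
    using hs_sum_compose_left[OF k(1) hs_op(1), of y] hs_sum_compose_right[OF k(1) hs_op(1), of y] k(2)
    by simp
  also have "\<dots> = (2 * norm k)\<^sup>2 * hs_sum (hs_op y)" by (simp add: power_mult_distrib)
  finally show "norm (herm_ad k y) \<le> 2 * norm k * norm y"
    by (intro norm_hs_herm_leI) (simp_all add: eq)
qed

lemma
  assumes p: "p \<in> bounded_ops" "adj p = p"
  shows hs_op_herm_cut: "hs_op (herm_cut p y) = p o\<^sub>L (hs_op y o\<^sub>L p)"
    and norm_herm_cut: "norm (herm_cut p y) \<le> (norm p)\<^sup>2 * norm y"
proof -
  have hs: "hilbert_schmidt (hs_op y o\<^sub>L p)" "hilbert_schmidt (p o\<^sub>L (hs_op y o\<^sub>L p))"
    by (intro hilbert_schmidt_compose_left hilbert_schmidt_compose_right p hs_op)+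
  have "adj (p o\<^sub>L (hs_op y o\<^sub>L p)) = p o\<^sub>L (hs_op y o\<^sub>L p)"
    by (simp add: adj_compose p bounded_ops_compose hs_op_bounded_ops hs_op(2) blinfun_compose_assoc)
  then show eq: "hs_op (herm_cut p y) = p o\<^sub>L (hs_op y o\<^sub>L p)"
    unfolding herm_cut_def using hs by (intro hs_op_Abs)
  have "hs_sum (p o\<^sub>L (hs_op y o\<^sub>L p)) \<le> (norm p)\<^sup>2 * hs_sum (hs_op y o\<^sub>L p)"
    by (rule hs_sum_compose_left[OF p(1) hs(1)])
  also have "\<dots> \<le> (norm p)\<^sup>2 * ((norm p)\<^sup>2 * hs_sum (hs_op y))"
    using hs_sum_compose_right[OF p(1) hs_op(1), of y] p(2) by (intro mult_left_mono) auto
  also have "\<dots> = ((norm p)\<^sup>2)\<^sup>2 * hs_sum (hs_op y)" by (simp add: power2_eq_square)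
  finally show "norm (herm_cut p y) \<le> (norm p)\<^sup>2 * norm y"
    by (intro norm_hs_herm_leI) (simp_all only: eq zero_le_power2)
qed

lemma unitary_orbit_eqI:
  assumes "x \<in> unitary_orbit y"
  shows "unitary_orbit x = unitary_orbit y"
proof -
  obtain U where U: "unitary U" "hs_op x = U o\<^sub>L hs_op y o\<^sub>L adj U"
    using assms by (auto simp: unitary_orbit_def)
  have sub: "unitary_orbit x \<subseteq> unitary_orbit y"
    if U: "unitary U" "hs_op x = U o\<^sub>L hs_op y o\<^sub>L adj U" for x y :: "'a hs_herm" and U
  proof
    fix z assume "z \<in> unitary_orbit x"
    then obtain V where V: "unitary V" "hs_op z = V o\<^sub>L hs_op x o\<^sub>L adj V"
      by (auto simp: unitary_orbit_def)
    have "hs_op z = (V o\<^sub>L U) o\<^sub>L hs_op y o\<^sub>L adj (V o\<^sub>L U)"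
      using U(1) V(1) unfolding V(2) U(2) by (simp add: unitary_def adj_compose blinfun_compose_assoc)
    then show "z \<in> unitary_orbit y"
      using unitary_compose[OF V(1) U(1)] by (auto simp: unitary_orbit_def)
  qed
  have "hs_op y = adj U o\<^sub>L hs_op x o\<^sub>L adj (adj U)"
    unfolding U(2) using U(1) adj_adj[of U] by (intro blinfun_eqI) (simp add: unitary_cancel unitary_def)
  then show ?thesis using sub[OF U] sub[OF unitary_adj[OF U(1)]] by blast
qed

lemma unitary_orbit_refl: "x \<in> unitary_orbit x"
proof -
  have "adj (id_blinfun :: 'a \<Rightarrow>\<^sub>L 'a) = id_blinfun" by (rule adj_unique) simp
  then show ?thesis
    unfolding unitary_orbit_def
    by (intro CollectI exI[of _ id_blinfun]) (simp add: unitary_def id_blinfun_bounded_ops)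
qed

lemma eigenbasis_conjugate:
  assumes E: "eigenbasis a E \<mu>" and U: "unitary U" "hs_op x = U o\<^sub>L hs_op a o\<^sub>L adj U"
  shows "eigenbasis x (blinfun_apply U ` E) (\<lambda>e. \<mu> (adj U e))"
proof -
  have Ub: "U \<in> bounded_ops" using U(1) by (simp add: unitary_def)
  show ?thesis
    using E unitary_onb[OF U(1)]
    by (auto simp: eigenbasis_def U(2) unitary_cancel[OF U(1)] bounded_ops_scaleC[OF Ub])
qed


text \<open>Set up for an arbitrary operator with finite spectrum, because it is later applied at
  every point of the orbit and not only at the operator that generates it.\<close>

locale finite_eigenbasis =
  fixes a :: "'h::complex_hilbert_space hs_herm" and E \<mu>
  assumes eig: "eigenbasis a E \<mu>" and fin: "finite (\<mu> ` E)"
begin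

lemma onb: "is_onb E" and a_eig: "e \<in> E \<Longrightarrow> hs_op a e = \<mu> e *\<^sub>R e"
  using eig by (simp_all add: eigenbasis_def scaleR_eq_scaleC)

section \<open>Block decomposition and normal coordinates\<close>

definition P :: "real \<Rightarrow> 'h \<Rightarrow>\<^sub>L 'h" where
  "P r = (SOME T. T \<in> bounded_ops \<and> (\<forall>e\<in>E. T e = (if \<mu> e = r then e else 0)))"

lemma P_bounded_ops: "P r \<in> bounded_ops" and P_eq: "e \<in> E \<Longrightarrow> P r e = (if \<mu> e = r then e else 0)"
proof -
  have "\<exists>T\<in>bounded_ops. \<forall>e\<in>E. T e = (if \<mu> e = r then e else 0)"
    by (rule onb_extension[OF onb, where C = 1])
       (auto simp: onb_cinner[OF onb] onb_norm[OF onb] cinner.zero_left cinner.zero_right)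
  then have "\<exists>T. T \<in> bounded_ops \<and> (\<forall>e\<in>E. T e = (if \<mu> e = r then e else 0))" by blast
  from someI_ex[OF this, folded P_def]
  show "P r \<in> bounded_ops" "e \<in> E \<Longrightarrow> P r e = (if \<mu> e = r then e else 0)" by blast+
qed

lemma P_adj: "adj (P r) = P r"
  by (rule onb_adj_eqI[OF onb P_bounded_ops P_bounded_ops])
     (simp add: P_eq onb_cinner[OF onb] cinner.zero_left cinner.zero_right)

lemma P_mult: "P r o\<^sub>L P s = (if r = s then P r else 0)"
  by (rule onb_operator_eqI[OF onb])
     (auto simp: P_eq bounded_ops_compose P_bounded_ops complex_vector.subspace_0[OF csubspace_bounded_ops]
       blinfun.zero_right)

lemma P_sum: "(\<Sum>r\<in>\<mu> ` E. P r) = id_blinfun"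
proof (rule onb_operator_eqI[OF onb])
  show "(\<Sum>r\<in>\<mu> ` E. P r) \<in> bounded_ops"
    by (intro complex_vector.subspace_sum csubspace_bounded_ops P_bounded_ops)
  show "(\<Sum>r\<in>\<mu> ` E. P r) e = id_blinfun e" if "e \<in> E" for e
    using that fin by (simp add: blinfun.sum_left P_eq)
qed (rule id_blinfun_bounded_ops)

lemma a_P: "hs_op a o\<^sub>L P r = r *\<^sub>R P r" and P_a: "P r o\<^sub>L hs_op a = r *\<^sub>R P r"
  by (rule onb_operator_eqI[OF onb];
      auto simp: P_eq a_eig bounded_ops_compose P_bounded_ops hs_op_bounded_ops scaleR_eq_scaleC
        complex_vector.subspace_scale[OF csubspace_bounded_ops] blinfun.zero_right
        bounded_ops_scaleC[OF P_bounded_ops] blinfun.scaleR_left)+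

definition D :: "'h hs_herm \<Rightarrow> 'h hs_herm" where
  "D y = (\<Sum>r\<in>\<mu> ` E. herm_cut (P r) y)"

definition K :: "'h hs_herm \<Rightarrow> 'h \<Rightarrow>\<^sub>L 'h" where
  "K u = (\<Sum>r\<in>\<mu> ` E. \<Sum>s\<in>\<mu> ` E. (if r = s then 0 else 1 / (s - r)) *\<^sub>R (P r o\<^sub>L (hs_op u o\<^sub>L P s)))"

lemma hs_op_sum: "hs_op (\<Sum>i\<in>I. f i) = (\<Sum>i\<in>I. hs_op (f i))"
  by (rule linear_sum[OF bounded_linear.linear[OF bounded_linear_hs_op]])

lemma hs_op_D: "hs_op (D y) = (\<Sum>r\<in>\<mu> ` E. P r o\<^sub>L (hs_op y o\<^sub>L P r))"
  by (simp add: D_def hs_op_sum hs_op_herm_cut P_bounded_ops P_adj)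

lemma bounded_linear_D: "bounded_linear D"
  unfolding D_def
proof (intro bounded_linear_sum)
  fix r
  have lin: "hs_op (herm_cut (P r) y) = P r o\<^sub>L (hs_op y o\<^sub>L P r)" for y
    by (simp add: hs_op_herm_cut P_bounded_ops P_adj)
  show "bounded_linear (herm_cut (P r))"
  proof (rule bounded_linear_intro)
    show "herm_cut (P r) (x + y) = herm_cut (P r) x + herm_cut (P r) y" for x y
      by (rule iffD1[OF hs_op_inject]) (simp add: lin plus_hs_herm.rep_eq blinfun_compose_simps)
    show "herm_cut (P r) (c *\<^sub>R x) = c *\<^sub>R herm_cut (P r) x" for c x
      by (rule iffD1[OF hs_op_inject]) (simp add: lin scaleR_hs_herm.rep_eq blinfun_compose_simps)
    show "norm (herm_cut (P r) y) \<le> norm y * (norm (P r))\<^sup>2" for y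
      using norm_herm_cut[OF P_bounded_ops P_adj] by (simp add: mult.commute)
  qed
qed

lemma P_D: "P r o\<^sub>L hs_op (D y) = hs_op (D y) o\<^sub>L P r"
proof -
  have "P r o\<^sub>L hs_op (D y) = (\<Sum>s\<in>\<mu> ` E. if r = s then P r o\<^sub>L (hs_op y o\<^sub>L P r) else 0)"
    unfolding hs_op_D blinfun_compose_simps
    by (intro sum.cong refl) (simp add: blinfun_compose_assoc[symmetric] P_mult blinfun_compose_simps)
  also have "\<dots> = hs_op (D y) o\<^sub>L P r"
    unfolding hs_op_D blinfun_compose_simps
    by (intro sum.cong refl) (simp add: blinfun_compose_assoc P_mult blinfun_compose_simps)
  finally show ?thesis .
qed

lemma D_D: "D (D y) = D y"
proof (rule iffD1[OF hs_op_inject])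
  have "hs_op (D (D y)) = (\<Sum>r\<in>\<mu> ` E. hs_op (D y) o\<^sub>L P r)"
    unfolding hs_op_D[of "D y"]
    by (intro sum.cong refl) (simp add: blinfun_compose_assoc[symmetric] P_D, simp add: blinfun_compose_assoc P_mult)
  also have "\<dots> = hs_op (D y)"
    by (simp add: blinfun_compose_simps(10)[symmetric] P_sum)
  finally show "hs_op (D (D y)) = hs_op (D y)" .
qed

lemma bounded_linear_K: "bounded_linear K"
  unfolding K_def
  by (intro bounded_linear_sum bounded_linear_const_scaleR
      bounded_linear_compose[OF bounded_bilinear.bounded_linear_right[OF bounded_bilinear_blinfun_compose]]
      bounded_linear_compose[OF bounded_bilinear.bounded_linear_left[OF bounded_bilinear_blinfun_compose] bounded_linear_hs_op])

lemma K_bounded_ops: "K u \<in> bounded_ops"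
  unfolding K_def scaleR_eq_scaleC
  by (intro complex_vector.subspace_sum complex_vector.subspace_scale csubspace_bounded_ops
      bounded_ops_compose P_bounded_ops hs_op_bounded_ops)

text \<open>The adjoint exchanges the blocks \<open>(r, s)\<close> and \<open>(s, r)\<close>, and
  the coefficient \<open>1 / (s - r)\<close> changes sign under this exchange.\<close>

lemma K_adj: "adj (K u) = - K u"
proof (rule adj_unique)
  fix x y
  let ?c = "\<lambda>r s. if r = s then 0 else 1 / (s - r) :: real"
  have swap: "cinner (P r (hs_op u (P s x))) y = cinner x (P s (hs_op u (P r y)))" for r s
    using cinner_adj_right[OF P_bounded_ops] cinner_self_adjoint hs_op P_adj by metis
  have "cinner (K u x) y = (\<Sum>r\<in>\<mu> ` E. \<Sum>s\<in>\<mu> ` E. ?c r s *\<^sub>R cinner x (P s (hs_op u (P r y))))"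
    by (simp add: K_def blinfun.sum_left blinfun.scaleR_left cinner.sum_left cinner.scaleR_left swap)
  also have "\<dots> = (\<Sum>r\<in>\<mu> ` E. \<Sum>s\<in>\<mu> ` E. ?c s r *\<^sub>R cinner x (P r (hs_op u (P s y))))"
    by (rule sum.swap)
  also have "\<dots> = (\<Sum>r\<in>\<mu> ` E. \<Sum>s\<in>\<mu> ` E. - (?c r s *\<^sub>R cinner x (P r (hs_op u (P s y)))))"
  proof (intro sum.cong refl)
    fix r s
    have "?c s r = - ?c r s" using minus_divide_right[of 1 "s - r"] by simp
    then show "?c s r *\<^sub>R cinner x (P r (hs_op u (P s y))) = - (?c r s *\<^sub>R cinner x (P r (hs_op u (P s y))))"
      by (simp only: scaleR_minus_left)
  qed
  also have "\<dots> = cinner x ((- K u) y)"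
    by (simp add: K_def blinfun.sum_left blinfun.scaleR_left blinfun.minus_left cinner.sum_right
        cinner.scaleR_right cinner.minus_right sum_negf)
  finally show "cinner (K u x) y = cinner x ((- K u) y)" .
qed

definition br :: "'h hs_herm \<Rightarrow> 'h hs_herm \<Rightarrow> 'h hs_herm" where
  "br u y = herm_ad (K u) y"

lemma hs_op_br: "hs_op (br u y) = ad (K u) (hs_op y)"
  by (simp add: br_def hs_op_herm_ad K_bounded_ops K_adj)

lemma bounded_bilinear_br: "bounded_bilinear br"
proof
  interpret K: bounded_linear K by (rule bounded_linear_K)
  note simps = hs_op_br ad_def blinfun_compose_simps plus_hs_herm.rep_eq scaleR_hs_herm.rep_eq
    K.add K.scaleR algebra_simps
  show "br (x + x') y = br x y + br x' y" for x x' y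
    by (rule iffD1[OF hs_op_inject]) (simp add: simps)
  show "br x (y + y') = br x y + br x y'" for x y y'
    by (rule iffD1[OF hs_op_inject]) (simp add: simps)
  show "br (r *\<^sub>R x) y = r *\<^sub>R br x y" for r x y
    by (rule iffD1[OF hs_op_inject]) (simp add: simps)
  show "br x (r *\<^sub>R y) = r *\<^sub>R br x y" for r x y
    by (rule iffD1[OF hs_op_inject]) (simp add: simps)
  obtain C where C: "\<And>u. norm (K u) \<le> norm u * C" using K.bounded by blast
  show "\<exists>C. \<forall>x y. norm (br x y) \<le> norm x * norm y * C"
  proof (intro exI allI)
    fix x y
    have "norm (br x y) \<le> 2 * norm (K x) * norm y"
      unfolding br_def by (rule norm_herm_ad[OF K_bounded_ops K_adj])
    also have "\<dots> \<le> 2 * (norm x * C) * norm y" by (intro mult_right_mono mult_left_mono C) auto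
    finally show "norm (br x y) \<le> norm x * norm y * (2 * C)" by (simp add: mult_ac)
  qed
qed

text \<open>On the block \<open>(r, s)\<close> the commutator with \<open>hs_op a\<close> acts as
  the scalar \<open>s - r\<close>, which cancels the denominator in \<open>K\<close>. All blocks
  except the diagonal ones are thus recovered, and \<open>D\<close> supplies those.\<close>

lemma br_a: "br u a + D u = u"
proof (rule iffD1[OF hs_op_inject])
  let ?c = "\<lambda>r s. if r = s then 0 else 1 / (s - r) :: real"
  let ?t = "\<lambda>r s. P r o\<^sub>L (hs_op u o\<^sub>L P s)"
  have "P r o\<^sub>L (hs_op u o\<^sub>L P s) o\<^sub>L hs_op a = s *\<^sub>R ?t r s" for r s
    by (simp add: blinfun_compose_assoc P_a blinfun_compose_simps)
  moreover have "hs_op a o\<^sub>L ?t r s = r *\<^sub>R ?t r s" for r s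
    by (simp add: blinfun_compose_assoc[symmetric] a_P blinfun_compose_simps)
  ultimately have "ad (K u) (hs_op a) = (\<Sum>r\<in>\<mu> ` E. \<Sum>s\<in>\<mu> ` E. ?c r s *\<^sub>R (s *\<^sub>R ?t r s - r *\<^sub>R ?t r s))"
    by (simp add: ad_def K_def blinfun_compose_simps sum_subtractf scaleR_diff_right)
  also have "\<dots> = (\<Sum>r\<in>\<mu> ` E. \<Sum>s\<in>\<mu> ` E. ?t r s - (if r = s then ?t r s else 0))"
    by (intro sum.cong refl) (simp add: scaleR_diff_left[symmetric])
  also have "\<dots> = (\<Sum>r\<in>\<mu> ` E. \<Sum>s\<in>\<mu> ` E. ?t r s) - (\<Sum>r\<in>\<mu> ` E. ?t r r)"
    using fin by (simp add: sum_subtractf)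
  also have "(\<Sum>r\<in>\<mu> ` E. \<Sum>s\<in>\<mu> ` E. ?t r s) = (\<Sum>r\<in>\<mu> ` E. P r) o\<^sub>L (hs_op u o\<^sub>L (\<Sum>s\<in>\<mu> ` E. P s))"
    by (simp add: blinfun_compose_simps) (rule sum.swap)
  finally show "hs_op (br u a + D u) = hs_op u"
    by (simp add: plus_hs_herm.rep_eq hs_op_br hs_op_D P_sum)
qed

text \<open>\<open>hs_op\<close> carries the series of \<open>br u\<close> to that of
  \<open>ad (K u)\<close>, whose sum is conjugation by the unitary exponential of
  \<open>K u\<close>.\<close>

lemma exp_action_orbit: "exp_action br u y \<in> unitary_orbit y"
proof -
  have pow: "hs_op ((br u ^^ n) y) = (ad (K u) ^^ n) (hs_op y)" for n
    by (induction n) (simp_all add: hs_op_br)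
  have "(\<lambda>n. hs_op ((1 / fact n) *\<^sub>R (br u ^^ n) y)) sums hs_op (exp_action br u y)"
    by (rule bounded_linear.sums[OF bounded_linear_hs_op exp_action_sums[OF bounded_bilinear_br]])
  then have "(\<lambda>n. (1 / fact n) *\<^sub>R (ad (K u) ^^ n) (hs_op y)) sums hs_op (exp_action br u y)"
    by (simp add: scaleR_hs_herm.rep_eq pow)
  then have "hs_op (exp_action br u y) = blinfun_exp (K u) o\<^sub>L (hs_op y o\<^sub>L blinfun_exp (- K u))"
    using blinfun_exp_conjugate sums_unique2 by blast
  then show ?thesis
    using unitary_blinfun_exp[OF K_bounded_ops K_adj, of u]
    by (auto simp: unitary_orbit_def blinfun_compose_assoc)
qed

text \<open>Let \<open>a + v\<close> be the conjugate of \<open>a\<close> by \<open>U\<close>. For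
  \<open>e\<close> in the basis, \<open>U e\<close> is an eigenvector of \<open>a + v\<close> with
  eigenvalue \<open>\<mu> e\<close>; its part in a block \<open>r \<noteq> \<mu> e\<close> satisfies
  the eigenvalue equation of \<open>v\<close> for \<open>\<mu> e - r\<close>, too large for
  \<open>v\<close>, so it vanishes. Hence \<open>a\<close> also acts on \<open>U e\<close> by
  \<open>\<mu> e\<close>, and \<open>a + v\<close> agrees with \<open>a\<close> on a basis.\<close>

lemma orbit_block_diagonal:
  assumes orb: "a + v \<in> unitary_orbit a" and v: "\<And>r. P r o\<^sub>L hs_op v = hs_op v o\<^sub>L P r"
    and small: "\<And>r s. r \<in> \<mu> ` E \<Longrightarrow> s \<in> \<mu> ` E \<Longrightarrow> r \<noteq> s \<Longrightarrow> norm (hs_op v) < \<bar>r - s\<bar>"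
  shows "v = 0"
proof -
  obtain U where U: "unitary U" "hs_op (a + v) = U o\<^sub>L hs_op a o\<^sub>L adj U"
    using orb by (auto simp: unitary_orbit_def)
  have Ub: "U \<in> bounded_ops" using U(1) by (simp add: unitary_def)
  have "hs_op (a + v) (U e) = hs_op a (U e)" if e: "e \<in> E" for e
  proof -
    let ?f = "U e" and ?j = "\<mu> e"
    have bf: "hs_op (a + v) ?f = ?j *\<^sub>R ?f"
      using e by (simp add: U(2) unitary_cancel[OF U(1)] a_eig blinfun.scaleR_right)
    have zero: "P r ?f = 0" if r: "r \<in> \<mu> ` E" "r \<noteq> ?j" for r
    proof (rule ccontr)
      assume nz: "P r ?f \<noteq> 0"
      have "?j *\<^sub>R P r ?f = P r (hs_op (a + v) ?f)" by (simp add: bf blinfun.scaleR_right)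
      also have "\<dots> = (P r o\<^sub>L hs_op a) ?f + (P r o\<^sub>L hs_op v) ?f"
        by (simp add: plus_hs_herm.rep_eq blinfun.add_left blinfun.add_right)
      also have "\<dots> = r *\<^sub>R P r ?f + hs_op v (P r ?f)"
        unfolding P_a v by (simp add: blinfun.scaleR_left)
      finally have "(?j - r) *\<^sub>R P r ?f = hs_op v (P r ?f)" by (simp add: scaleR_diff_left)
      then have "\<bar>?j - r\<bar> * norm (P r ?f) \<le> norm (hs_op v) * norm (P r ?f)"
        using norm_blinfun[of "hs_op v" "P r ?f"] by (metis norm_scaleR)
      then have "\<bar>?j - r\<bar> \<le> norm (hs_op v)" using nz by simp
      then show False using small[of ?j r] r e by auto
    qed
    have "?f = (\<Sum>r\<in>\<mu> ` E. P r) ?f" by (simp add: P_sum)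
    also have "\<dots> = (\<Sum>r\<in>\<mu> ` E. if r = ?j then P ?j ?f else 0)"
      unfolding blinfun.sum_left using zero by (intro sum.cong) auto
    also have "\<dots> = P ?j ?f" using e fin by simp
    finally have f: "P ?j ?f = ?f" by (rule sym)
    have "hs_op a (P ?j ?f) = ?j *\<^sub>R P ?j ?f"
      using arg_cong[OF a_P, of "\<lambda>T. T ?f"] by (simp add: blinfun.scaleR_left)
    then show ?thesis using bf by (simp add: f)
  qed
  then have "hs_op (a + v) = hs_op a"
    by (intro onb_operator_eqI[OF unitary_onb[OF U(1) onb] hs_op_bounded_ops hs_op_bounded_ops]) auto
  then have "a + v = a" by (simp add: hs_op_inject)
  then show ?thesis by simp
qed

text \<open>The exponential action stays within orbits, so whether a point of the parametrisation
  lies in the orbit of \<open>a\<close> depends only on \<open>a + D y\<close>.\<close>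

lemma chart:
  shows "\<exists>V (\<psi> :: 'h hs_herm \<Rightarrow> 'h hs_herm) F G V\<^sub>1 V\<^sub>2 c.
    a \<in> V \<and> closed_complements F G \<and>
    openin (top_of_set F) V\<^sub>1 \<and> openin (top_of_set G) V\<^sub>2 \<and> c \<in> V\<^sub>2 \<and>
    analytic_diffeo V {u + v | u v. u \<in> V\<^sub>1 \<and> v \<in> V\<^sub>2} \<psi> \<and>
    \<psi> ` (unitary_orbit a \<inter> V) = {u + c | u. u \<in> V\<^sub>1}"
proof -
  \<comment> \<open>Inserting \<open>1\<close> gives a positive minimum even if there is only one
    eigenvalue.\<close>
  define G where "G = insert 1 ((\<lambda>(r, s). \<bar>r - s\<bar>) ` (\<mu> ` E \<times> \<mu> ` E) - {0})"
  define \<gamma> where "\<gamma> = Min G"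
  have G: "finite G" "G \<noteq> {}" using fin by (auto simp: G_def)
  have \<gamma>: "\<gamma> > 0" unfolding \<gamma>_def using G by (subst Min_gr_iff) (auto simp: G_def)
  have gap: "\<gamma> \<le> \<bar>r - s\<bar>" if "r \<in> \<mu> ` E" "s \<in> \<mu> ` E" "r \<noteq> s" for r s
    unfolding \<gamma>_def using that by (intro Min_le G) (auto simp: G_def)
  obtain L where L: "0 \<le> L" "\<And>y. norm (D y) \<le> norm y * L"
    using bounded_linear.nonneg_bounded[OF bounded_linear_D] by blast
  \<comment> \<open>\<open>D\<close> is bounded by \<open>L\<close>, so \<open>D y\<close> stays
    below the gap; \<open>L + 1\<close> avoids dividing by \<open>0\<close>.\<close>
  have mem: "a + (exp_action br y (a + D y) - a) \<in> unitary_orbit a \<longleftrightarrow> D y = 0"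
    if y: "norm y < \<gamma> / (L + 1)" for y
  proof -
    let ?x = "exp_action br y (a + D y)"
    have "?x \<in> unitary_orbit a \<longleftrightarrow> a + D y \<in> unitary_orbit a"
      using unitary_orbit_eqI[OF exp_action_orbit, of y "a + D y"]
        unitary_orbit_eqI unitary_orbit_refl by metis
    also have "\<dots> \<longleftrightarrow> D y = 0"
    proof
      assume orb: "a + D y \<in> unitary_orbit a"
      have "norm (hs_op (D y)) \<le> norm (D y)"
        using norm_hs_op_le[of "D y"] norm_ge_zero[of "hs_op (D y)"] by linarith
      also have "\<dots> \<le> norm y * (L + 1)"
        using L(2)[of y] norm_ge_zero[of y] unfolding distrib_left by linarith
      also have "\<dots> < \<gamma>" using y L(1) by (simp add: pos_less_divide_eq)
      finally show "D y = 0"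
        using gap by (intro orbit_block_diagonal[OF orb P_D]) fastforce
    qed (simp add: unitary_orbit_refl)
    finally show ?thesis by simp
  qed
  show ?thesis
  proof (rule submanifold_chart[OF tangent_to_id_exp_action[OF bounded_bilinear_br bounded_linear_D br_a]
        bounded_linear_D D_D])
    show "0 < \<gamma> / (L + 1)" using \<gamma> L(1) by simp
  qed (rule mem)
qed

end

text \<open>A chart is available at the base point only. Any other point \<open>x\<close> has the
  same eigenvalues in the rotated basis and the same orbit, so it can serve as base point.\<close>

lemma analytic_submanifold_unitary_orbit:
  fixes a :: "'h::complex_hilbert_space hs_herm"
  assumes E: "eigenbasis a E \<mu>" and fin: "finite (\<mu> ` E)"
  shows "analytic_submanifold (unitary_orbit a)"
  unfolding analytic_submanifold_def
proof
  fix x assume x: "x \<in> unitary_orbit a"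
  then obtain U where U: "unitary U" "hs_op x = U o\<^sub>L hs_op a o\<^sub>L adj U"
    by (auto simp: unitary_orbit_def)
  have "(\<lambda>e. \<mu> (adj U e)) ` (blinfun_apply U ` E) = \<mu> ` E"
    by (simp add: image_image unitary_cancel[OF U(1)])
  then interpret finite_eigenbasis x "blinfun_apply U ` E" "\<lambda>e. \<mu> (adj U e)"
    using eigenbasis_conjugate[OF E U] fin by unfold_locales simp_all
  show "\<exists>V (\<psi> :: 'h hs_herm \<Rightarrow> 'h hs_herm) F G V\<^sub>1 V\<^sub>2 c. x \<in> V \<and> closed_complements F G \<and>
    openin (top_of_set F) V\<^sub>1 \<and> openin (top_of_set G) V\<^sub>2 \<and> c \<in> V\<^sub>2 \<and>
    analytic_diffeo V {u + v | u v. u \<in> V\<^sub>1 \<and> v \<in> V\<^sub>2} \<psi> \<and>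
    \<psi> ` (unitary_orbit a \<inter> V) = {u + c | u. u \<in> V\<^sub>1}"
    using chart unfolding unitary_orbit_eqI[OF x] .
qed

section \<open>The \<open>C\<^sup>*\<close>-algebra generated by \<open>a\<close> and \<open>1\<close>\<close>

lemma cstar_hull_closure_properties:
  fixes S :: "('a::complex_hilbert_space \<Rightarrow>\<^sub>L 'a) set"
  defines "A \<equiv> cstar_subalgebra hull S"
  shows "S \<subseteq> A" "complex_vector.subspace A" "\<And>x y. x \<in> A \<Longrightarrow> y \<in> A \<Longrightarrow> x o\<^sub>L y \<in> A"
  unfolding A_def
  by (rule hull_subset)
     (auto simp: hull_def complex_vector.subspace_def cstar_subalgebra_def)

text \<open>Lagrange interpolation: for a finite set \<open>R\<close> of eigenvalues the polynomials
  in \<open>a\<close> that vanish on \<open>R\<close> except at one point are linearly independent.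
  One eigenvalue more than the size of a spanning set is a contradiction.\<close>

lemma finite_dim_hull_imp_finite_spectrum:
  assumes E: "eigenbasis a E \<mu>"
    and fd: "finite_dim_csubspace (cstar_subalgebra hull {hs_op a, id_blinfun})"
  shows "finite (\<mu> ` E)"
proof (rule ccontr)
  assume inf: "infinite (\<mu> ` E)"
  let ?A = "cstar_subalgebra hull {hs_op a, id_blinfun}"
  note A = cstar_hull_closure_properties[where S = "{hs_op a, id_blinfun}"]
  have onb: "is_onb E" and a: "\<And>e. e \<in> E \<Longrightarrow> hs_op a e = \<mu> e *\<^sub>R e"
    using E by (simp_all add: eigenbasis_def scaleR_eq_scaleC)
  obtain B where B: "finite B" "?A = complex_vector.span B"
    using fd by (auto simp: finite_dim_csubspace_def)
  obtain R where R: "R \<subseteq> \<mu> ` E" "finite R" "card R = Suc (card B)"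
    using infinite_arbitrarily_large[OF inf] by metis
  \<comment> \<open>Products of factors \<open>a - s\<close>, with the identity as the empty
    product.\<close>
  have poly: "\<exists>T\<in>?A. \<forall>e\<in>E. T e = (\<Prod>s\<in>Q. \<mu> e - s) *\<^sub>R e" if "finite Q" for Q
    using that
  proof induction
    case empty
    show ?case using A(1) by (intro bexI[of _ id_blinfun]) auto
  next
    case (insert s Q)
    then obtain T where T: "T \<in> ?A" "\<forall>e\<in>E. T e = (\<Prod>s\<in>Q. \<mu> e - s) *\<^sub>R e" by blast
    have "hs_op a \<in> ?A" "id_blinfun \<in> ?A" using A(1) by auto
    then have "hs_op a - complex_of_real s *\<^sub>C id_blinfun \<in> ?A"
      by (intro complex_vector.subspace_diff complex_vector.subspace_scale A(2))
    then have "(hs_op a - complex_of_real s *\<^sub>C id_blinfun) o\<^sub>L T \<in> ?A" using T(1) by (rule A(3))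
    moreover have "((hs_op a - complex_of_real s *\<^sub>C id_blinfun) o\<^sub>L T) e = (\<Prod>s\<in>insert s Q. \<mu> e - s) *\<^sub>R e"
      if "e \<in> E" for e
      using that T(2) insert(1,2)
      by (simp add: blinfun.diff_left a blinfun.scaleR_left blinfun.scaleR_right scaleR_eq_scaleC[symmetric] algebra_simps)
    ultimately show ?case by blast
  qed
  have "\<forall>r. \<exists>T. T \<in> ?A \<and> (\<forall>e\<in>E. T e = (\<Prod>s\<in>R - {r}. \<mu> e - s) *\<^sub>R e)"
    using poly[OF finite_Diff[OF R(2)]] by blast
  then obtain L where L: "\<And>r. L r \<in> ?A" "\<And>r e. e \<in> E \<Longrightarrow> L r e = (\<Prod>s\<in>R - {r}. \<mu> e - s) *\<^sub>R e"
    by metis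
  have zero: "L r e = 0" if "e \<in> E" "\<mu> e \<in> R" "\<mu> e \<noteq> r" for r e
    using that R(2) by (auto simp: L(2) prod_zero_iff)
  have nonzero: "L (\<mu> e) e \<noteq> 0" if "e \<in> E" for e
    using that R(2) onb_norm[OF onb that] by (auto simp: L(2))
  have inj: "inj_on L R"
  proof (rule inj_onI)
    fix r s assume rs: "r \<in> R" "s \<in> R" "L r = L s"
    then obtain e where "e \<in> E" "r = \<mu> e" using R(1) by blast
    then show "r = s" using zero[of e s] nonzero[of e] rs by metis
  qed
  have "complex_vector.independent (L ` R)"
    unfolding complex_vector.dependent_finite[OF finite_imageI[OF R(2)]]
  proof (rule notI, elim exE conjE bexE)
    fix u v assume v: "v \<in> L ` R" "u v \<noteq> 0" and sum: "(\<Sum>v\<in>L ` R. u v *\<^sub>C v) = 0"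
    obtain e where e: "e \<in> E" "\<mu> e \<in> R" "v = L (\<mu> e)" using v(1) R(1) by blast
    have "(\<Sum>r\<in>R. u (L r) *\<^sub>C L r) = 0" using sum by (simp add: sum.reindex[OF inj])
    then have "0 = (\<Sum>r\<in>R. u (L r) *\<^sub>C L r) e" by simp
    also have "\<dots> = (\<Sum>r\<in>R. u (L r) *\<^sub>C L r e)" by (simp add: blinfun.sum_left)
    also have "\<dots> = (\<Sum>r\<in>R. if r = \<mu> e then u v *\<^sub>C v e else 0)"
      using e zero[OF e(1,2)] by (intro sum.cong) auto
    also have "\<dots> = u v *\<^sub>C v e" using e(2) R(2) by simp
    finally show False using v(2) nonzero[OF e(1)] e(3) by auto
  qed
  moreover have "L ` R \<subseteq> complex_vector.span B" using L(1) B(2) by auto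
  ultimately have "card (L ` R) \<le> card B"
    using complex_vector.independent_span_bound[OF B(1)] by blast
  then show False using R(3) card_image[OF inj] by simp
qed

context finite_eigenbasis
begin

text \<open>The operators that are scalar on each eigenspace form a \<open>C\<^sup>*\<close>-algebra
  containing \<open>a\<close> and \<open>1\<close>, hence containing the hull, and they are spanned
  by the finitely many projections \<open>P r\<close>.\<close>

lemma finite_dim_hull: "finite_dim_csubspace (cstar_subalgebra hull {hs_op a, id_blinfun})"
proof -
  let ?H = "cstar_subalgebra hull {hs_op a, id_blinfun}"
  \<comment> \<open>Scalar on each eigenspace, with the scalar read off as the diagonal entry at any
    \<open>f\<close> in it. In this form \<open>A\<close> is an intersection of solution sets of
    continuous equations, hence closed.\<close>
  define A where "A = {T \<in> bounded_ops. \<forall>e\<in>E. \<forall>f\<in>E. \<mu> e = \<mu> f \<longrightarrow> T e = cinner f (T f) *\<^sub>C e}"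
  have ee: "cinner e e = 1" if "e \<in> E" for e using onb_cinner[OF onb that that] by simp
  have eq: "T e = cinner f (T f) *\<^sub>C e" if "T \<in> A" "e \<in> E" "f \<in> E" "\<mu> e = \<mu> f" for T e f
    using that unfolding A_def by blast
  have "cstar_subalgebra A"
    unfolding cstar_subalgebra_def
  proof (intro conjI ballI)
    show "A \<subseteq> bounded_ops" by (auto simp: A_def)
    then have Ab: "T \<in> bounded_ops" if "T \<in> A" for T using that by blast
    show "complex_vector.subspace A"
      unfolding complex_vector.subspace_def
    proof (intro conjI ballI allI)
      show "0 \<in> A" by (simp add: A_def complex_vector.subspace_0[OF csubspace_bounded_ops] cinner.zero_right)
      show "S + T \<in> A" if ST: "S \<in> A" "T \<in> A" for S T
        unfolding A_def
      proof (intro CollectI conjI ballI impI)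
        show "S + T \<in> bounded_ops" by (intro complex_vector.subspace_add csubspace_bounded_ops Ab ST)
        fix e f assume "e \<in> E" "f \<in> E" "\<mu> e = \<mu> f"
        then show "(S + T) e = cinner f ((S + T) f) *\<^sub>C e"
          unfolding blinfun.add_left cinner_add_right scaleC_add_left
          by (intro arg_cong2[where f = "(+)"] eq ST)
      qed
      show "c *\<^sub>C T \<in> A" if T: "T \<in> A" for c T
        unfolding A_def
      proof (intro CollectI conjI ballI impI)
        show "c *\<^sub>C T \<in> bounded_ops" by (intro complex_vector.subspace_scale csubspace_bounded_ops Ab T)
        fix e f assume "e \<in> E" "f \<in> E" "\<mu> e = \<mu> f"
        then show "(c *\<^sub>C T) e = cinner f ((c *\<^sub>C T) f) *\<^sub>C e"
          unfolding scaleC_blinfun.rep_eq cinner_scaleC_right scaleC_scaleC[symmetric]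
          by (intro arg_cong[where f = "scaleC c"] eq T)
      qed
    qed
    show "S o\<^sub>L T \<in> A" if S: "S \<in> A" and T: "T \<in> A" for S T
      unfolding A_def
    proof (intro CollectI conjI ballI impI)
      show "S o\<^sub>L T \<in> bounded_ops" by (intro bounded_ops_compose Ab S T)
      fix e f assume ef: "e \<in> E" "f \<in> E" "\<mu> e = \<mu> f"
      have "(S o\<^sub>L T) g = (cinner f (T f) * cinner f (S f)) *\<^sub>C g" if "g \<in> E" "\<mu> g = \<mu> f" for g
      proof -
        have "(S o\<^sub>L T) g = cinner f (T f) *\<^sub>C S g"
          using arg_cong[OF eq[OF T that(1) ef(2) that(2)], of S] by (simp add: bounded_ops_scaleC[OF Ab[OF S]])
        also have "S g = cinner f (S f) *\<^sub>C g" by (rule eq[OF S that(1) ef(2) that(2)])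
        finally show ?thesis by (simp add: scaleC_scaleC)
      qed
      from this[OF ef(1,3)] this[OF ef(2) refl] show "(S o\<^sub>L T) e = cinner f ((S o\<^sub>L T) f) *\<^sub>C e"
        using ee[OF ef(2)] by (simp only: cinner_scaleC_right mult_1_right)
    qed
    show "adj T \<in> A" if T: "T \<in> A" for T
      unfolding A_def
    proof (intro CollectI conjI ballI impI)
      show "adj T \<in> bounded_ops" by (intro adj_bounded_ops Ab T)
      fix e f assume ef: "e \<in> E" "f \<in> E" "\<mu> e = \<mu> f"
      have "adj T g = cnj (cinner f (T f)) *\<^sub>C g" if g: "g \<in> E" "\<mu> g = \<mu> f" for g
      proof (rule onb_vector_eqI[OF onb])
        fix h assume h: "h \<in> E"
        have "cinner h (adj T g) = cinner (cinner h (T h) *\<^sub>C h) g"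
          unfolding cinner_adj_right[OF Ab[OF T]] eq[OF T h h refl, symmetric] ..
        also have "\<dots> = cnj (cinner f (T f)) * cinner h g"
        proof (cases "h = g")
          case True
          have "cinner h (T h) = cinner f (T f)"
            using arg_cong[OF eq[OF T g(1) ef(2) g(2)], of "cinner h"] True ee[OF h]
            by (simp add: cinner_scaleC_right)
          then show ?thesis by (simp add: cinner_scaleC_left)
        qed (use onb_cinner[OF onb h g(1)] in \<open>simp add: cinner_scaleC_left\<close>)
        finally show "cinner h (adj T g) = cinner h (cnj (cinner f (T f)) *\<^sub>C g)"
          by (simp add: cinner_scaleC_right)
      qed
      from this[OF ef(1,3)] this[OF ef(2) refl] show "adj T e = cinner f (adj T f) *\<^sub>C e"
        using ee[OF ef(2)] by (simp only: cinner_scaleC_right mult_1_right)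
    qed
    have c1: "closed {T::'h \<Rightarrow>\<^sub>L 'h. T (c *\<^sub>C x) = c *\<^sub>C T x}" for c x
      by (intro closed_Collect_eq linear_continuous_on blinfun.bounded_linear_left
          bounded_linear_compose[OF bounded_linear_scaleC])
    have b_eq: "bounded_ops = (\<Inter>c. \<Inter>x. {T::'h \<Rightarrow>\<^sub>L 'h. T (c *\<^sub>C x) = c *\<^sub>C T x})"
      by (auto simp: bounded_ops_def)
    have cb: "closed (bounded_ops :: ('h \<Rightarrow>\<^sub>L 'h) set)"
      unfolding b_eq by (intro closed_INT ballI c1)
    have A_eq: "A = bounded_ops \<inter> (\<Inter>e\<in>E. \<Inter>f\<in>{f\<in>E. \<mu> e = \<mu> f}. {T::'h \<Rightarrow>\<^sub>L 'h. T e = cinner f (T f) *\<^sub>C e})"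
      by (auto simp: A_def)
    have c2: "closed {T::'h \<Rightarrow>\<^sub>L 'h. T e = cinner f (T f) *\<^sub>C e}" for e f
    proof (intro closed_Collect_eq linear_continuous_on blinfun.bounded_linear_left)
      have "bounded_linear (\<lambda>c. c *\<^sub>C e)"
        by (rule bounded_linear_intro[where K = "norm e"])
           (simp_all add: scaleC_add_left scaleR_eq_scaleC scaleC_scaleC norm_scaleC scaleR_conv_of_real)
      then show "bounded_linear (\<lambda>T::'h \<Rightarrow>\<^sub>L 'h. cinner f (T f) *\<^sub>C e)"
        by (rule bounded_linear_compose)
           (rule bounded_linear_compose[OF cinner.bounded_linear_right blinfun.bounded_linear_left])
    qed
    show "closed A" unfolding A_eq by (intro closed_Int closed_INT ballI cb c2)
  qed
  moreover have "hs_op a \<in> A" "id_blinfun \<in> A"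
    using ee by (auto simp: A_def hs_op_bounded_ops id_blinfun_bounded_ops a_eig cinner_scaleC_right
        scaleR_eq_scaleC)
  ultimately have "?H \<subseteq> A" by (intro hull_minimal) auto
  also have "A \<subseteq> complex_vector.span (P ` \<mu> ` E)"
  proof
    fix T assume T: "T \<in> A"
    define c where "c r = (SOME z. \<forall>e\<in>E. \<mu> e = r \<longrightarrow> T e = z *\<^sub>C e)" for r
    have c: "T e = c (\<mu> e) *\<^sub>C e" if "e \<in> E" for e
    proof -
      have "\<exists>z. \<forall>f\<in>E. \<mu> f = \<mu> e \<longrightarrow> T f = z *\<^sub>C f" using eq[OF T _ that] by blast
      from someI_ex[OF this, folded c_def] show ?thesis using that by blast
    qed
    have T_eq: "T = (\<Sum>r\<in>\<mu> ` E. c r *\<^sub>C P r)"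
    proof (rule onb_operator_eqI[OF onb])
      show "T \<in> bounded_ops" using T by (simp add: A_def)
      show "(\<Sum>r\<in>\<mu> ` E. c r *\<^sub>C P r) \<in> bounded_ops"
        by (intro complex_vector.subspace_sum complex_vector.subspace_scale csubspace_bounded_ops P_bounded_ops)
      fix e assume e: "e \<in> E"
      have "(\<Sum>r\<in>\<mu> ` E. c r *\<^sub>C P r) e = (\<Sum>r\<in>\<mu> ` E. if r = \<mu> e then c (\<mu> e) *\<^sub>C e else 0)"
        using e by (simp add: blinfun.sum_left P_eq) (intro sum.cong refl, auto)
      then show "T e = (\<Sum>r\<in>\<mu> ` E. c r *\<^sub>C P r) e" using c e fin by simp
    qed
    show "T \<in> complex_vector.span (P ` \<mu> ` E)"
      by (subst T_eq, rule complex_vector.span_sum,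
          rule complex_vector.span_scale, rule complex_vector.span_base, erule imageI)
  qed
  finally have sub: "?H \<subseteq> complex_vector.span (P ` \<mu> ` E)" .
  \<comment> \<open>A finite set spanning exactly the hull is required, and the projections are only
    known to span a larger space; a basis is chosen inside the hull instead.\<close>
  obtain B where B: "B \<subseteq> ?H" "complex_vector.independent B" "?H \<subseteq> complex_vector.span B"
    using complex_vector.maximal_independent_subset by blast
  have "finite B"
    using complex_vector.independent_span_bound[OF _ B(2), of "P ` \<mu> ` E"] fin B(1) sub by auto
  moreover have "complex_vector.span B \<subseteq> ?H"
    by (rule complex_vector.span_minimal[OF B(1) cstar_hull_closure_properties(2)])
  ultimately show ?thesis using B(3) unfolding finite_dim_csubspace_def by blast
qed

end

theorem finite_dim_hull_iff_finite_spectrum: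
  assumes "eigenbasis a E \<mu>"
  shows "finite_dim_csubspace (cstar_subalgebra hull {hs_op a, id_blinfun}) \<longleftrightarrow> finite (\<mu> ` E)"
  using finite_eigenbasis.finite_dim_hull[of a E \<mu>] finite_dim_hull_imp_finite_spectrum[OF assms] assms
  by (auto simp: finite_eigenbasis_def)

section \<open>Orbits of operators with infinite spectrum\<close>

text \<open>If points of \<open>M\<close> converge to \<open>y\<close> in the chart domain,
  \<open>\<psi> y - c\<close> lies in the closed subspace \<open>F\<close>. The
  \<open>G\<close>-component of \<open>\<psi> y\<close> then differs from \<open>c\<close> by an
  element of \<open>F \<inter> G\<close>, so it is \<open>c\<close>; thus \<open>\<psi> y\<close> is
  on the slice, and injectivity of \<open>\<psi>\<close> puts \<open>y\<close> in
  \<open>M\<close>.\<close>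

lemma chart_locally_closed:
  fixes M :: "'a::banach set" and \<psi> :: "'a \<Rightarrow> 'a"
  assumes V: "x \<in> V" and FG: "closed_complements F G"
    and V1: "openin (top_of_set F) V1" and V2: "openin (top_of_set G) V2" and c: "c \<in> V2"
    and \<psi>: "analytic_diffeo V {u + v | u v. u \<in> V1 \<and> v \<in> V2} \<psi>"
    and MV: "\<psi> ` (M \<inter> V) = {u + c | u. u \<in> V1}"
  shows "\<exists>V. open V \<and> x \<in> V \<and> (\<forall>X y. (\<forall>n::nat. X n \<in> M) \<longrightarrow> X \<longlonglongrightarrow> y \<longrightarrow> y \<in> V \<longrightarrow> y \<in> M)"
proof -
  note \<psi>' = \<psi>[unfolded analytic_diffeo_def]
  have oV: "open V" by (rule conjunct1[OF \<psi>'])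
  have im: "\<psi> ` V = {u + v | u v. u \<in> V1 \<and> v \<in> V2}"
    by (rule conjunct1[OF conjunct2[OF conjunct2[OF \<psi>']]])
  have an: "\<forall>x\<in>V. real_analytic_at \<psi> x"
    by (rule conjunct1[OF conjunct2[OF conjunct2[OF conjunct2[OF \<psi>']]]])
  obtain g where g: "\<forall>x\<in>V. g (\<psi> x) = x"
    using conjunct2[OF conjunct2[OF conjunct2[OF conjunct2[OF \<psi>']]]] by (elim exE conjE) (rule that)
  have F: "subspace F" "closed F" and G: "subspace G" and FG0: "F \<inter> G = {0}"
    using FG by (simp_all add: closed_complements_def)
  have V1F: "V1 \<subseteq> F" and V2G: "V2 \<subseteq> G" using V1 V2 openin_imp_subset by blast+
  have key: "y \<in> M" if X: "\<And>n::nat. X n \<in> M" "X \<longlonglongrightarrow> y" and y: "y \<in> V" for X y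
  proof -
    have "\<forall>\<^sub>F n in sequentially. X n \<in> V" by (rule topological_tendstoD[OF X(2) oV y])
    then have ev: "\<forall>\<^sub>F n in sequentially. \<psi> (X n) - c \<in> F"
    proof eventually_elim
      case (elim n)
      then have "\<psi> (X n) \<in> \<psi> ` (M \<inter> V)" using X(1) by blast
      then show ?case using MV V1F by auto
    qed
    have "isCont \<psi> y" using an y by (intro real_analytic_at_isCont) blast
    then have "(\<lambda>n. \<psi> (X n) - c) \<longlonglongrightarrow> \<psi> y - c"
      by (intro tendsto_diff tendsto_const isCont_tendsto_compose[OF _ X(2)])
    then have inF: "\<psi> y - c \<in> F" by (rule Lim_in_closed_set[OF F(2) ev sequentially_bot])
    obtain u v where uv: "u \<in> V1" "v \<in> V2" "\<psi> y = u + v" using im y by blast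
    have "v - c = (\<psi> y - c) - u" by (simp add: uv(3))
    moreover have "(\<psi> y - c) - u \<in> F" using uv(1) V1F by (intro subspace_diff[OF F(1) inF]) auto
    ultimately have "v - c \<in> F" by (simp only:)
    moreover have "v - c \<in> G" using uv(2) c V2G by (intro subspace_diff[OF G]) auto
    ultimately have "v - c \<in> F \<inter> G" by (rule IntI)
    then have "v = c" by (simp add: FG0)
    then have "\<psi> y \<in> \<psi> ` (M \<inter> V)" unfolding MV using uv by blast
    then obtain m where m: "\<psi> y = \<psi> m" "m \<in> M \<inter> V" by (rule imageE)
    have "y = g (\<psi> m)" using bspec[OF g y] unfolding m(1) by (rule sym)
    also have "\<dots> = m" by (rule bspec[OF g IntD2[OF m(2)]])
    finally have "y = m" .
    then show ?thesis using m(2) by simp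
  qed
  have "\<forall>X y. (\<forall>n::nat. X n \<in> M) \<longrightarrow> X \<longlonglongrightarrow> y \<longrightarrow> y \<in> V \<longrightarrow> y \<in> M"
    by (intro allI impI) (rule key; simp)
  with oV V show ?thesis by (intro exI[of _ V] conjI)
qed

lemma analytic_submanifold_locally_closed:
  fixes M :: "'a::banach set"
  assumes "analytic_submanifold M" "x \<in> M"
  shows "\<exists>V. open V \<and> x \<in> V \<and> (\<forall>X y. (\<forall>n::nat. X n \<in> M) \<longrightarrow> X \<longlonglongrightarrow> y \<longrightarrow> y \<in> V \<longrightarrow> y \<in> M)"
  using bspec[OF assms(1)[unfolded analytic_submanifold_def] assms(2)]
proof (elim exE conjE, goal_cases)
  case (1 V \<psi> F G V1 V2 c)
  then show ?case by (intro chart_locally_closed[of x V F G V1 V2 c \<psi> M])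
qed

text \<open>Distinct basis vectors have distance \<open>sqrt 2\<close>, more than twice
  \<open>1/2\<close>, so choosing for each a point of a countable dense set within
  \<open>1/2\<close> is injective.\<close>

lemma onb_countable:
  assumes sep: "separable_space (euclidean :: 'h::complex_hilbert_space topology)"
    and E: "is_onb (E :: 'h set)"
  shows "countable E"
proof -
  obtain C :: "'h set" where C: "countable C" "closure C = UNIV"
    using sep unfolding separable_space_def euclidean_closure_of topspace_euclidean by blast
  have "\<exists>c\<in>C. dist c e < 1/2" for e
  proof -
    have "e \<in> closure C" using C(2) by simp
    from this[unfolded closure_approachable, rule_format, of "1/2"] show ?thesis by simp
  qed
  then obtain f where f: "\<And>e. f e \<in> C" "\<And>e. dist (f e) e < 1/2" by metis
  have "inj_on f E"
  proof (rule inj_onI, rule ccontr)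
    fix d e assume de: "d \<in> E" "e \<in> E" "f d = f e" "d \<noteq> e"
    have "inner d e = 0" "inner e d = 0"
      using onb_cinner[OF E de(1,2)] onb_cinner[OF E de(2,1)] de(4) by (auto simp: inner_eq_Re_cinner)
    then have "(norm (d - e))\<^sup>2 = (norm d)\<^sup>2 + (norm e)\<^sup>2"
      by (simp add: power2_norm_eq_inner inner_diff_left inner_diff_right)
    then have "(norm (d - e))\<^sup>2 = 2" using onb_norm[OF E] de by simp
    moreover have "norm (d - e) < 1"
      using dist_triangle3[of d e "f d"] f(2)[of d] f(2)[of e] de(3) by (simp add: dist_norm)
    then have "(norm (d - e))\<^sup>2 < 1\<^sup>2" by (intro power_strict_mono) auto
    ultimately show False by simp
  qed
  moreover have "countable (f ` E)" using C(1) f(1) by (meson countable_subset image_subsetI)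
  ultimately show ?thesis using countable_image_inj_on by blast
qed

section \<open>Perturbing and permuting eigenvalues in a fixed basis\<close>

lemma eigenbasis_norm:
  assumes a: "eigenbasis a E \<mu>" and b: "eigenbasis b E \<nu>"
  shows "(norm (a - b))\<^sup>2 = 4 * (\<Sum>\<^sub>\<infinity>e\<in>E. (\<mu> e - \<nu> e)\<^sup>2)"
proof -
  have E: "is_onb E" using a by (simp add: eigenbasis_def)
  have "(norm (hs_op (a - b) e))\<^sup>2 = (\<mu> e - \<nu> e)\<^sup>2" if "e \<in> E" for e
  proof -
    have "hs_op (a - b) e = (\<mu> e - \<nu> e) *\<^sub>R e"
      using a b that by (simp add: eigenbasis_def minus_hs_herm.rep_eq blinfun.diff_left
          scaleR_eq_scaleC[symmetric] scaleR_diff_left)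
    then show ?thesis using onb_norm[OF E that] by simp
  qed
  then show ?thesis unfolding norm_hs_herm_onb[OF E] by (simp cong: infsum_cong)
qed

lemma eigenbasis_summable:
  assumes a: "eigenbasis a E \<mu>"
  shows "(\<lambda>e. (\<mu> e)\<^sup>2) summable_on E"
proof -
  have E: "is_onb E" using a by (simp add: eigenbasis_def)
  have "(norm (hs_op a e))\<^sup>2 = (\<mu> e)\<^sup>2" if "e \<in> E" for e
    using a that onb_norm[OF E that] by (simp add: eigenbasis_def norm_scaleC)
  moreover have "(\<lambda>e. (norm (hs_op a e))\<^sup>2) summable_on E"
    using hs_op(1)[of a] E by (simp add: hilbert_schmidt_def)
  ultimately show ?thesis by (simp cong: summable_on_cong)
qed

text \<open>Discarding from \<open>F\<close> the vectors with eigenvalue \<open>0\<close> changes no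
  sum. It keeps \<open>F\<close> among the vectors whose eigenvalues are going to be moved.\<close>

lemma eigenbasis_small_tail:
  assumes a: "eigenbasis a E \<mu>" and \<eta>: "\<eta> > 0"
  obtains F where "finite F" "F \<subseteq> {e \<in> E. \<mu> e \<noteq> 0}"
    "\<And>Y. finite Y \<Longrightarrow> Y \<subseteq> E \<Longrightarrow> Y \<inter> F = {} \<Longrightarrow> (\<Sum>e\<in>Y. (\<mu> e)\<^sup>2) < \<eta>"
proof -
  let ?N = "{e \<in> E. \<mu> e \<noteq> 0}"
  obtain F where F: "finite F" "F \<subseteq> E"
    and small: "\<And>Y. finite Y \<Longrightarrow> Y \<subseteq> E \<Longrightarrow> Y \<inter> F = {} \<Longrightarrow> \<bar>\<Sum>e\<in>Y. (\<mu> e)\<^sup>2\<bar> < \<eta>"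
    by (rule summable_on_small_tail[OF eigenbasis_summable[OF a] \<eta>]) blast
  have "(\<Sum>e\<in>Y. (\<mu> e)\<^sup>2) < \<eta>" if Y: "finite Y" "Y \<subseteq> E" "Y \<inter> (F \<inter> ?N) = {}" for Y
  proof -
    have "(\<Sum>e\<in>Y. (\<mu> e)\<^sup>2) = (\<Sum>e\<in>Y \<inter> ?N. (\<mu> e)\<^sup>2)"
      using Y by (intro sum.mono_neutral_right) auto
    moreover have "finite (Y \<inter> ?N)" "Y \<inter> ?N \<subseteq> E" "(Y \<inter> ?N) \<inter> F = {}" using Y by auto
    from small[OF this] have "(\<Sum>e\<in>Y \<inter> ?N. (\<mu> e)\<^sup>2) < \<eta>" by linarith
    ultimately show ?thesis by simp
  qed
  then show thesis using F by (intro that[of "F \<inter> ?N"]) auto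
qed

lemma ex_eigenbasis_operator:
  fixes E :: "'h::complex_hilbert_space set"
  assumes E: "is_onb E" and s: "(\<lambda>e. (\<nu> e)\<^sup>2) summable_on E"
  shows "\<exists>b. eigenbasis b E \<nu>"
proof -
  have "\<bar>\<nu> e\<bar> \<le> sqrt (\<Sum>\<^sub>\<infinity>e\<in>E. (\<nu> e)\<^sup>2)" if "e \<in> E" for e
  proof (rule real_le_rsqrt)
    show "\<bar>\<nu> e\<bar>\<^sup>2 \<le> (\<Sum>\<^sub>\<infinity>e\<in>E. (\<nu> e)\<^sup>2)"
      using finite_sum_le_infsum[OF s, of "{e}"] that by simp
  qed
  then obtain T where T: "T \<in> bounded_ops" "\<And>e. e \<in> E \<Longrightarrow> T e = \<nu> e *\<^sub>R e"
    using onb_extension[OF E, of "\<lambda>e. \<nu> e *\<^sub>R e" "sqrt (\<Sum>\<^sub>\<infinity>e\<in>E. (\<nu> e)\<^sup>2)"] onb_norm[OF E] onb_cinner[OF E]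
    by (auto simp: cinner.scaleR_left cinner.scaleR_right)
  have "(\<lambda>e. (norm (T e))\<^sup>2) summable_on E \<longleftrightarrow> (\<lambda>e. (\<nu> e)\<^sup>2) summable_on E"
    by (rule summable_on_cong) (simp add: T(2) onb_norm[OF E])
  then have "hilbert_schmidt T" using s T(1) by (simp add: hilbert_schmidt_iff[OF E])
  moreover have "adj T = T"
    by (rule onb_adj_eqI[OF E T(1) T(1)])
       (auto simp: T(2) cinner.scaleR_left cinner.scaleR_right onb_cinner[OF E])
  ultimately show ?thesis
    using T(2) E by (intro exI[of _ "Abs_hs_herm T"]) (simp add: eigenbasis_def hs_op_Abs scaleR_eq_scaleC)
qed

lemma eigenbasis_permute:
  fixes a :: "'h::complex_hilbert_space hs_herm"
  assumes a: "eigenbasis a E \<mu>" and \<sigma>: "bij_betw \<sigma> E E"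
  shows "\<exists>x\<in>unitary_orbit a. eigenbasis x E (\<lambda>e. \<mu> (inv_into E \<sigma> e))"
proof -
  let ?\<tau> = "inv_into E \<sigma>"
  have E: "is_onb E" using a by (simp add: eigenbasis_def)
  have \<tau>: "bij_betw ?\<tau> E E" by (rule bij_betw_inv_into[OF \<sigma>])
  have ex: "\<exists>T\<in>bounded_ops. \<forall>e\<in>E. T e = \<rho> e" if \<rho>: "bij_betw \<rho> E E" for \<rho>
  proof (rule onb_extension[OF E, where C = 1])
    show "cinner (\<rho> d) (\<rho> e) = 0" if "d \<in> E" "e \<in> E" "d \<noteq> e" for d e
      using onb_cinner[OF E bij_betwE[OF \<rho>, rule_format, OF that(1)] bij_betwE[OF \<rho>, rule_format, OF that(2)]]
        inj_onD[OF bij_betw_imp_inj_on[OF \<rho>]] that by auto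
    show "norm (\<rho> e) \<le> 1" if "e \<in> E" for e
      using onb_norm[OF E] bij_betwE[OF \<rho>] that by simp
  qed
  obtain U where U: "U \<in> bounded_ops" "\<And>e. e \<in> E \<Longrightarrow> U e = \<sigma> e" using ex[OF \<sigma>] by blast
  obtain V where V: "V \<in> bounded_ops" "\<And>e. e \<in> E \<Longrightarrow> V e = ?\<tau> e" using ex[OF \<tau>] by blast
  have \<sigma>\<tau>: "?\<tau> e \<in> E" "\<sigma> e \<in> E" "\<sigma> (?\<tau> e) = e" "?\<tau> (\<sigma> e) = e" if "e \<in> E" for e
    using that bij_betwE[OF \<sigma>] bij_betwE[OF \<tau>] bij_betw_inv_into_right[OF \<sigma>] bij_betw_inv_into_left[OF \<sigma>] by auto
  have adjU: "adj U = V"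
  proof (rule onb_adj_eqI[OF E V(1) U(1)])
    fix e f assume ef: "e \<in> E" "f \<in> E"
    have "\<sigma> e = f \<longleftrightarrow> e = ?\<tau> f" using \<sigma>\<tau> ef by metis
    then show "cinner (U e) f = cinner e (V f)"
      using ef \<sigma>\<tau> by (simp add: U(2) V(2) onb_cinner[OF E])
  qed
  have "V o\<^sub>L U = id_blinfun" "U o\<^sub>L V = id_blinfun"
    by (rule onb_operator_eqI[OF E]; simp add: bounded_ops_compose U V \<sigma>\<tau> id_blinfun_bounded_ops)+
  then have uU: "unitary U" using U(1) by (simp add: unitary_def adjU)
  have "U o\<^sub>L hs_op a o\<^sub>L adj U \<in> hs_op ` unitary_orbit a"
    unfolding hs_op_unitary_orbit using uU by blast
  then obtain x where x: "x \<in> unitary_orbit a" "hs_op x = U o\<^sub>L hs_op a o\<^sub>L adj U" by auto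
  have "blinfun_apply U ` E = \<sigma> ` E" using U(2) by auto
  then have "blinfun_apply U ` E = E" using \<sigma> by (simp add: bij_betw_def)
  then have "eigenbasis x E (\<lambda>e. \<mu> (V e))"
    using eigenbasis_conjugate[OF a uU x(2)] by (simp add: adjU)
  then have "eigenbasis x E (\<lambda>e. \<mu> (?\<tau> e))" using V(2) by (simp add: eigenbasis_def)
  with x(1) show ?thesis by blast
qed

text \<open>Inside the finite set \<open>?H\<close> the complements of \<open>F\<close> and of its
  image have equally many elements, so they can be matched; outside \<open>?H\<close> the
  permutation is the identity.\<close>

lemma finite_injection_extends:
  assumes F: "finite F" "F \<subseteq> E" and \<beta>: "inj_on \<beta> F" "\<beta> ` F \<subseteq> E"
  shows "\<exists>\<sigma>. bij_betw \<sigma> E E \<and> (\<forall>e\<in>F. \<sigma> e = \<beta> e)"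
proof -
  let ?H = "F \<union> \<beta> ` F"
  have "card (\<beta> ` F) = card F" by (rule card_image[OF \<beta>(1)])
  then have "card (?H - F) = card (?H - \<beta> ` F)"
    using F(1) by (simp add: card_Diff_subset)
  then obtain h where h: "bij_betw h (?H - F) (?H - \<beta> ` F)"
    using F(1) finite_same_card_bij[of "?H - F" "?H - \<beta> ` F"] by auto
  define \<sigma> where "\<sigma> e = (if e \<in> F then \<beta> e else if e \<in> ?H then h e else e)" for e
  have 1: "bij_betw \<sigma> F (\<beta> ` F)"
    using \<beta>(1) by (subst bij_betw_cong[of _ _ \<beta>]) (auto simp: \<sigma>_def inj_on_imp_bij_betw)
  have 2: "bij_betw \<sigma> (?H - F) (?H - \<beta> ` F)"
    using h by (subst bij_betw_cong[of _ _ h]) (auto simp: \<sigma>_def)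
  have 3: "bij_betw \<sigma> (E - ?H) (E - ?H)"
    by (subst bij_betw_cong[of _ _ id]) (auto simp: \<sigma>_def)
  have "bij_betw \<sigma> (F \<union> (?H - F)) (\<beta> ` F \<union> (?H - \<beta> ` F))"
    by (rule bij_betw_combine[OF 1 2]) auto
  then have "bij_betw \<sigma> (F \<union> (?H - F) \<union> (E - ?H)) (\<beta> ` F \<union> (?H - \<beta> ` F) \<union> (E - ?H))"
    by (rule bij_betw_combine[OF _ 3]) auto
  moreover have "F \<union> (?H - F) \<union> (E - ?H) = E" "\<beta> ` F \<union> (?H - \<beta> ` F) \<union> (E - ?H) = E"
    using F(2) \<beta>(2) by auto
  ultimately have "bij_betw \<sigma> E E" by simp
  then show ?thesis by (auto simp: \<sigma>_def)
qed

text \<open>Outside \<open>K\<close> the bound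
  \<open>(x - y)\<^sup>2 \<le> 2 * x\<^sup>2 + 2 * y\<^sup>2\<close> gives
  \<open>4 * \<eta>\<close>; the other factor \<open>4\<close> is the normalisation of the
  Hilbert-Schmidt norm.\<close>

lemma eigenbasis_dist:
  assumes a: "eigenbasis a E \<mu>" and b: "eigenbasis b E \<nu>"
    and eq: "\<And>e. e \<in> K \<Longrightarrow> \<mu> e = \<nu> e"
    and small: "\<And>Y. finite Y \<Longrightarrow> Y \<subseteq> E \<Longrightarrow> Y \<inter> K = {} \<Longrightarrow> (\<Sum>e\<in>Y. (\<mu> e)\<^sup>2) < \<eta>"
      "\<And>Y. finite Y \<Longrightarrow> Y \<subseteq> E \<Longrightarrow> Y \<inter> K = {} \<Longrightarrow> (\<Sum>e\<in>Y. (\<nu> e)\<^sup>2) < \<eta>"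
  shows "(norm (a - b))\<^sup>2 \<le> 16 * \<eta>"
proof -
  have le: "(\<mu> e - \<nu> e)\<^sup>2 \<le> 2 * (\<mu> e)\<^sup>2 + 2 * (\<nu> e)\<^sup>2" for e
    using zero_le_power2[of "\<mu> e + \<nu> e"] by (simp add: power2_eq_square algebra_simps)
  have "(\<Sum>\<^sub>\<infinity>e\<in>E. (\<mu> e - \<nu> e)\<^sup>2) \<le> 4 * \<eta>"
  proof (rule infsum_le_finite_sums)
    show "(\<lambda>e. (\<mu> e - \<nu> e)\<^sup>2) summable_on E"
      by (rule summable_on_comparison_test[OF summable_on_add[OF
            summable_on_cmult_right[OF eigenbasis_summable[OF a], of 2]
            summable_on_cmult_right[OF eigenbasis_summable[OF b], of 2]]]) (use le in auto)
    fix Y assume Y: "finite Y" "Y \<subseteq> E"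
    have "(\<Sum>e\<in>Y. (\<mu> e - \<nu> e)\<^sup>2) = (\<Sum>e\<in>Y - K. (\<mu> e - \<nu> e)\<^sup>2)"
      using Y eq by (intro sum.mono_neutral_right) auto
    also have "\<dots> \<le> 2 * (\<Sum>e\<in>Y - K. (\<mu> e)\<^sup>2) + 2 * (\<Sum>e\<in>Y - K. (\<nu> e)\<^sup>2)"
      unfolding sum_distrib_left sum.distrib[symmetric] by (intro sum_mono le)
    also have "\<dots> \<le> 4 * \<eta>"
    proof -
      have "finite (Y - K)" "Y - K \<subseteq> E" "(Y - K) \<inter> K = {}" using Y by auto
      from small(1)[OF this] small(2)[OF this] show ?thesis by linarith
    qed
    finally show "(\<Sum>e\<in>Y. (\<mu> e - \<nu> e)\<^sup>2) \<le> 4 * \<eta>" .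
  qed
  then show ?thesis unfolding eigenbasis_norm[OF a b] by simp
qed

lemma eigenbasis_injective_iff:
  assumes a: "eigenbasis a E \<mu>"
  shows "(\<forall>x. hs_op a x = 0 \<longrightarrow> x = 0) \<longleftrightarrow> (\<forall>e\<in>E. \<mu> e \<noteq> 0)"
proof
  have E: "is_onb E" and ae: "\<And>e. e \<in> E \<Longrightarrow> hs_op a e = complex_of_real (\<mu> e) *\<^sub>C e"
    using a by (simp_all add: eigenbasis_def)
  show "\<forall>e\<in>E. \<mu> e \<noteq> 0" if "\<forall>x. hs_op a x = 0 \<longrightarrow> x = 0"
    using that ae onb_norm[OF E] by force
  show "\<forall>x. hs_op a x = 0 \<longrightarrow> x = 0" if nz: "\<forall>e\<in>E. \<mu> e \<noteq> 0"
  proof (intro allI impI)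
    fix x assume x: "hs_op a x = 0"
    show "x = 0"
    proof (rule onb_vector_eqI[OF E])
      fix e assume e: "e \<in> E"
      have "0 = cinner e (hs_op a x)" by (simp add: x cinner.zero_right)
      also have "\<dots> = cinner (hs_op a e) x" using cinner_self_adjoint hs_op by metis
      also have "\<dots> = complex_of_real (\<mu> e) * cinner e x" by (simp add: ae[OF e] cinner_scaleC_left)
      finally show "cinner e x = cinner e 0" using nz e by (simp add: cinner.zero_right)
    qed
  qed
qed

lemma unitary_orbit_injective:
  assumes "x \<in> unitary_orbit a" "\<forall>y. hs_op a y = 0 \<longrightarrow> y = 0"
  shows "\<forall>y. hs_op x y = 0 \<longrightarrow> y = 0"
proof (intro allI impI)
  fix y assume y: "hs_op x y = 0"
  obtain U where U: "unitary U" "hs_op x = U o\<^sub>L hs_op a o\<^sub>L adj U"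
    using assms(1) by (auto simp: unitary_orbit_def)
  have "hs_op a (adj U y) = adj U (hs_op x y)" by (simp add: U(2) unitary_cancel[OF U(1)])
  then have "adj U y = 0" using assms(2) y by (simp add: blinfun.zero_right)
  then show "y = 0" using unitary_cancel(2)[OF U(1), of y] by (simp add: blinfun.zero_right)
qed


lemma countable_infinite_bij:
  assumes "countable A" "infinite A" "countable B" "infinite B"
  shows "\<exists>f. bij_betw f A B"
  using bij_betw_trans[OF to_nat_on_infinite[OF assms(1,2)] bij_betw_inv_into[OF to_nat_on_infinite[OF assms(3,4)]]]
  by blast

text \<open>An injection \<open>\<beta>\<close> moves the nonzero eigenvalues of \<open>a\<close> to other basis vectors. The moved
  operator is a limit of permuted copies of \<open>a\<close>, since on finitely many eigenvalues \<open>\<beta>\<close> is the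
  restriction of a permutation.\<close>

locale moved_spectrum =
  fixes a :: "'h::complex_hilbert_space hs_herm" and E \<mu> \<beta>
  assumes a: "eigenbasis a E \<mu>"
    and inj: "inj_on \<beta> {e \<in> E. \<mu> e \<noteq> 0}" and into: "\<beta> ` {e \<in> E. \<mu> e \<noteq> 0} \<subseteq> E"
begin

definition N :: "'h set" where "N = {e \<in> E. \<mu> e \<noteq> 0}"

text \<open>Basis vectors that \<open>\<beta>\<close> does not hit receive the eigenvalue
  \<open>0\<close>, so they span the kernel of the moved operator.\<close>

definition \<nu> :: "'h \<Rightarrow> real" where
  "\<nu> e = (if e \<in> \<beta> ` N then \<mu> (inv_into N \<beta> e) else 0)"

lemma \<nu>_\<beta>: "e \<in> N \<Longrightarrow> \<nu> (\<beta> e) = \<mu> e"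
  using inj by (simp add: \<nu>_def N_def)

lemma \<nu>_eq_0_iff: "\<nu> e = 0 \<longleftrightarrow> e \<notin> \<beta> ` N"
  using \<nu>_\<beta> by (auto simp: \<nu>_def N_def)

text \<open>Pulling back along \<open>\<beta>\<close> turns finite sums of moved squares into finite
  sums of original squares; summability and smallness of tails carry over.\<close>

lemma sum_\<nu>:
  assumes "finite Y" "Y \<inter> \<beta> ` F = {}"
  shows "\<exists>Z. finite Z \<and> Z \<subseteq> N \<and> Z \<inter> F = {} \<and> (\<Sum>e\<in>Y. (\<nu> e)\<^sup>2) = (\<Sum>e\<in>Z. (\<mu> e)\<^sup>2)"
proof -
  let ?Z = "{e \<in> N. \<beta> e \<in> Y}"
  have inj': "inj_on \<beta> ?Z" by (rule inj_on_subset[OF inj]) (auto simp: N_def)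
  have im: "\<beta> ` ?Z = Y \<inter> \<beta> ` N" by auto
  have "finite ?Z" using assms(1) finite_imageD[OF _ inj'] im by simp
  moreover have "(\<Sum>e\<in>Y. (\<nu> e)\<^sup>2) = (\<Sum>e\<in>\<beta> ` ?Z. (\<nu> e)\<^sup>2)"
    unfolding im using assms(1) \<nu>_eq_0_iff by (intro sum.mono_neutral_right) auto
  moreover have "\<dots> = (\<Sum>e\<in>?Z. (\<mu> e)\<^sup>2)" by (simp add: sum.reindex[OF inj'] \<nu>_\<beta>)
  moreover have "?Z \<inter> F = {}" using assms(2) by blast
  ultimately show ?thesis by (intro exI[of _ ?Z]) auto
qed

lemma ex_moved: "\<exists>b. eigenbasis b E \<nu>"
proof (rule ex_eigenbasis_operator)
  show "is_onb E" using a by (simp add: eigenbasis_def)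
  show "(\<lambda>e. (\<nu> e)\<^sup>2) summable_on E"
  proof (rule nonneg_bdd_above_summable_on)
    show "bdd_above (sum (\<lambda>e. (\<nu> e)\<^sup>2) ` {F. F \<subseteq> E \<and> finite F})"
    proof (rule bdd_aboveI2)
      fix Y assume "Y \<in> {F. F \<subseteq> E \<and> finite F}"
      then obtain Z where "finite Z" "Z \<subseteq> N" "(\<Sum>e\<in>Y. (\<nu> e)\<^sup>2) = (\<Sum>e\<in>Z. (\<mu> e)\<^sup>2)"
        using sum_\<nu>[of Y "{}"] by auto
      then show "(\<Sum>e\<in>Y. (\<nu> e)\<^sup>2) \<le> (\<Sum>\<^sub>\<infinity>e\<in>E. (\<mu> e)\<^sup>2)"
        using finite_sum_le_infsum[OF eigenbasis_summable[OF a], of Z] by (auto simp: N_def)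
    qed
  qed simp
qed

lemma moved_near:
  assumes b: "eigenbasis b E \<nu>" and F: "F \<subseteq> N" "\<And>e. e \<in> F \<Longrightarrow> \<beta> e = e"
    and small: "\<And>Y. finite Y \<Longrightarrow> Y \<subseteq> E \<Longrightarrow> Y \<inter> F = {} \<Longrightarrow> (\<Sum>e\<in>Y. (\<mu> e)\<^sup>2) < \<eta>"
  shows "(norm (a - b))\<^sup>2 \<le> 16 * \<eta>"
proof (rule eigenbasis_dist[OF a b, of F])
  show "\<mu> e = \<nu> e" if "e \<in> F" for e using \<nu>_\<beta>[of e] F that by auto
  show "(\<Sum>e\<in>Y. (\<mu> e)\<^sup>2) < \<eta>" if "finite Y" "Y \<subseteq> E" "Y \<inter> F = {}" for Y by (rule small[OF that])
  show "(\<Sum>e\<in>Y. (\<nu> e)\<^sup>2) < \<eta>" if Y: "finite Y" "Y \<subseteq> E" "Y \<inter> F = {}" for Y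
  proof -
    have "\<beta> ` F = F" using F(2) by force
    then obtain Z where "finite Z" "Z \<subseteq> N" "Z \<inter> F = {}" "(\<Sum>e\<in>Y. (\<nu> e)\<^sup>2) = (\<Sum>e\<in>Z. (\<mu> e)\<^sup>2)"
      using sum_\<nu>[of Y F] Y by auto
    then show ?thesis using small[of Z] by (auto simp: N_def)
  qed
qed

lemma moved_in_closure:
  assumes b: "eigenbasis b E \<nu>" and \<epsilon>: "\<epsilon> > 0"
  shows "\<exists>x\<in>unitary_orbit a. norm (x - b) < \<epsilon>"
proof -
  \<comment> \<open>Then \<open>16 * \<eta>\<close> in the distance estimate is
    \<open>(\<epsilon> / 2)\<^sup>2\<close>.\<close>
  define \<eta> where "\<eta> = (\<epsilon> / 8)\<^sup>2"
  have \<eta>: "\<eta> > 0" using \<epsilon> by (simp add: \<eta>_def)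
  obtain F where F: "finite F" "F \<subseteq> N"
    and small: "\<And>Y. finite Y \<Longrightarrow> Y \<subseteq> E \<Longrightarrow> Y \<inter> F = {} \<Longrightarrow> (\<Sum>e\<in>Y. (\<mu> e)\<^sup>2) < \<eta>"
    unfolding N_def by (rule eigenbasis_small_tail[OF a \<eta>]) blast
  have FE: "F \<subseteq> E" using F(2) by (auto simp: N_def)
  have "inj_on \<beta> F" "\<beta> ` F \<subseteq> E"
    using inj_on_subset[OF inj, of F] into F(2) by (auto simp: N_def)
  then obtain \<sigma> where \<sigma>: "bij_betw \<sigma> E E" "\<And>e. e \<in> F \<Longrightarrow> \<sigma> e = \<beta> e"
    using finite_injection_extends[OF F(1) FE] by blast
  let ?\<tau> = "inv_into E \<sigma>"
  obtain x where x: "x \<in> unitary_orbit a" "eigenbasis x E (\<lambda>e. \<mu> (?\<tau> e))"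
    using eigenbasis_permute[OF a \<sigma>(1)] by blast
  have "(norm (x - b))\<^sup>2 \<le> 16 * \<eta>"
  proof (rule eigenbasis_dist[OF x(2) b, of "\<beta> ` F"])
    show "\<mu> (?\<tau> e) = \<nu> e" if e: "e \<in> \<beta> ` F" for e
    proof -
      obtain f where f: "f \<in> F" "e = \<beta> f" using e by blast
      then have "?\<tau> e = f" using bij_betw_inv_into_left[OF \<sigma>(1), of f] FE \<sigma>(2) by auto
      then show ?thesis using f F(2) \<nu>_\<beta> by auto
    qed
    show "(\<Sum>e\<in>Y. (\<nu> e)\<^sup>2) < \<eta>" if Y: "finite Y" "Y \<subseteq> E" "Y \<inter> \<beta> ` F = {}" for Y
    proof -
      obtain Z where "finite Z" "Z \<subseteq> N" "Z \<inter> F = {}" "(\<Sum>e\<in>Y. (\<nu> e)\<^sup>2) = (\<Sum>e\<in>Z. (\<mu> e)\<^sup>2)"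
        using sum_\<nu>[OF Y(1,3)] by blast
      then show ?thesis using small[of Z] by (auto simp: N_def)
    qed
    show "(\<Sum>e\<in>Y. (\<mu> (?\<tau> e))\<^sup>2) < \<eta>" if Y: "finite Y" "Y \<subseteq> E" "Y \<inter> \<beta> ` F = {}" for Y
    proof -
      have "inj_on ?\<tau> Y"
        using inj_on_subset[OF bij_betw_imp_inj_on[OF bij_betw_inv_into[OF \<sigma>(1)]] Y(2)] .
      then have "(\<Sum>e\<in>Y. (\<mu> (?\<tau> e))\<^sup>2) = (\<Sum>e\<in>?\<tau> ` Y. (\<mu> e)\<^sup>2)" by (simp add: sum.reindex)
      also have "\<dots> < \<eta>"
      proof (rule small)
        show "?\<tau> ` Y \<subseteq> E" using bij_betwE[OF bij_betw_inv_into[OF \<sigma>(1)]] Y(2) by blast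
        have "e \<in> \<beta> ` F" if "e \<in> Y" "?\<tau> e \<in> F" for e
          using bij_betw_inv_into_right[OF \<sigma>(1), of e] \<sigma>(2)[OF that(2)] that Y(2) by (metis image_eqI subsetD)
        then show "?\<tau> ` Y \<inter> F = {}" using Y(3) by blast
      qed (use Y in simp)
      finally show ?thesis .
    qed
  qed
  also have "16 * \<eta> = (\<epsilon> / 2)\<^sup>2" by (simp add: \<eta>_def power2_eq_square)
  finally have "norm (x - b) \<le> \<epsilon> / 2" by (rule power2_le_imp_le) (use \<epsilon> in simp)
  then show ?thesis using x(1) \<epsilon> by (intro bexI[of _ x]) auto
qed

text \<open>Injectivity is invariant under conjugation. \<open>a\<close> is injective iff
  \<open>N\<close> is the whole basis, \<open>b\<close> iff the image of \<open>N\<close> is;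
  \<open>kernel\<close> says that exactly one of them is injective.\<close>

lemma moved_not_in_orbit:
  assumes b: "eigenbasis b E \<nu>" and kernel: "(\<beta> ` N = E) \<noteq> (N = E)"
  shows "b \<notin> unitary_orbit a"
proof
  assume orb: "b \<in> unitary_orbit a"
  then have "a \<in> unitary_orbit b" using unitary_orbit_eqI unitary_orbit_refl by metis
  then have "(\<forall>x. hs_op a x = 0 \<longrightarrow> x = 0) \<longleftrightarrow> (\<forall>x. hs_op b x = 0 \<longrightarrow> x = 0)"
    using unitary_orbit_injective orb by metis
  then have "(\<forall>e\<in>E. \<mu> e \<noteq> 0) \<longleftrightarrow> (\<forall>e\<in>E. \<nu> e \<noteq> 0)"
    using eigenbasis_injective_iff[OF a] eigenbasis_injective_iff[OF b] by simp
  moreover have "(\<forall>e\<in>E. \<mu> e \<noteq> 0) \<longleftrightarrow> N = E" by (auto simp: N_def)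
  moreover have "(\<forall>e\<in>E. \<nu> e \<noteq> 0) \<longleftrightarrow> \<beta> ` N = E"
    using into unfolding \<nu>_eq_0_iff N_def by blast
  ultimately show False using kernel by simp
qed

end

text \<open>The eigenvalues on \<open>F0\<close> carry almost the whole norm and stay in place,
  which keeps the moved operator inside the neighbourhood \<open>V\<close>. The others are
  redistributed so as to create a kernel if there is none and to remove it otherwise.\<close>

lemma submanifold_imp_finite_spectrum:
  fixes a :: "'h::complex_hilbert_space hs_herm"
  assumes sep: "separable_space (euclidean :: 'h topology)" and a: "eigenbasis a E \<mu>"
    and M: "analytic_submanifold (unitary_orbit a)"
  shows "finite (\<mu> ` E)"
proof (rule ccontr)
  assume inf: "infinite (\<mu> ` E)"
  define S where "S = {e \<in> E. \<mu> e \<noteq> 0}"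
  have "\<mu> ` E \<subseteq> insert 0 (\<mu> ` S)" by (auto simp: S_def)
  then have S: "infinite S" "S \<subseteq> E"
    using inf finite_subset[of "\<mu> ` E" "insert 0 (\<mu> ` S)"] unfolding S_def by blast+
  have count: "countable E" using onb_countable[OF sep] a by (simp add: eigenbasis_def)
  obtain V where V: "open V" "a \<in> V"
    and closed: "\<forall>X y. (\<forall>n::nat. X n \<in> unitary_orbit a) \<longrightarrow> X \<longlonglongrightarrow> y \<longrightarrow> y \<in> V \<longrightarrow> y \<in> unitary_orbit a"
    using analytic_submanifold_locally_closed[OF M unitary_orbit_refl] by (elim exE conjE)
  obtain \<epsilon> where \<epsilon>: "\<epsilon> > 0" "ball a \<epsilon> \<subseteq> V" using V open_contains_ball by blast
  define \<eta> where "\<eta> = (\<epsilon> / 8)\<^sup>2"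
  have \<eta>: "\<eta> > 0" using \<epsilon> by (simp add: \<eta>_def)
  obtain F0 where F0: "finite F0" "F0 \<subseteq> S"
    and small: "\<And>Y. finite Y \<Longrightarrow> Y \<subseteq> E \<Longrightarrow> Y \<inter> F0 = {} \<Longrightarrow> (\<Sum>e\<in>Y. (\<mu> e)\<^sup>2) < \<eta>"
    unfolding S_def by (rule eigenbasis_small_tail[OF a \<eta>]) blast
  have "infinite (E - F0)" using S F0 infinite_super by auto
  then obtain z where z: "z \<in> E - F0" using infinite_imp_nonempty by blast
  define T where "T = (if S = E then E - F0 - {z} else E - F0)"
  have "infinite (S - F0)" "infinite (E - F0 - {z})" using S F0 \<open>infinite (E - F0)\<close> by auto
  with \<open>infinite (E - F0)\<close> have "infinite (S - F0)" "infinite T" by (auto simp: T_def)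
  moreover have "countable (S - F0)" "countable T"
    using count S by (auto simp: T_def intro: countable_subset)
  \<comment> \<open>Both sets are countably infinite, so a bijection exists even when one properly
    contains the other.\<close>
  ultimately obtain g where g: "bij_betw g (S - F0) T" using countable_infinite_bij by blast
  define \<beta> where "\<beta> e = (if e \<in> F0 then e else g e)" for e
  have "bij_betw \<beta> F0 F0" by (subst bij_betw_cong[of _ _ id]) (auto simp: \<beta>_def)
  moreover have "bij_betw \<beta> (S - F0) T" using g by (subst bij_betw_cong[of _ _ g]) (auto simp: \<beta>_def)
  ultimately have "bij_betw \<beta> (F0 \<union> (S - F0)) (F0 \<union> T)"
    by (rule bij_betw_combine) (auto simp: T_def)
  moreover have "F0 \<union> (S - F0) = S" using F0 by auto
  ultimately have \<beta>: "bij_betw \<beta> S (F0 \<union> T)" by simp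
  have T_sub: "F0 \<union> T \<subseteq> E" using F0 S by (auto simp: T_def)
  interpret moved_spectrum a E \<mu> \<beta>
    using \<beta> T_sub a by unfold_locales (auto simp: bij_betw_def S_def)
  have N_eq: "N = S" by (simp add: S_def N_def)
  obtain b where b: "eigenbasis b E \<nu>" using ex_moved by blast
  have "(F0 \<union> T = E) \<noteq> (S = E)" using z F0 S by (auto simp: T_def)
  then have "b \<notin> unitary_orbit a"
    using \<beta> by (intro moved_not_in_orbit[OF b]) (simp add: N_eq bij_betw_def)
  moreover have "b \<in> unitary_orbit a"
  proof -
    have "\<exists>x\<in>unitary_orbit a. norm (x - b) < 1 / real (Suc n)" for n
      by (rule moved_in_closure[OF b]) simp
    then obtain X where X: "\<And>n. X n \<in> unitary_orbit a" "\<And>n. norm (X n - b) < 1 / real (Suc n)" by metis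
    have "(\<lambda>n. X n - b) \<longlonglongrightarrow> 0"
    proof (rule Lim_null_comparison)
      show "\<forall>\<^sub>F n in sequentially. norm (X n - b) \<le> 1 / real (Suc n)"
        by (intro always_eventually allI less_imp_le X(2))
      show "(\<lambda>n. 1 / real (Suc n)) \<longlonglongrightarrow> 0" by (intro LIMSEQ_Suc lim_1_over_n)
    qed
    then have "X \<longlonglongrightarrow> b" by (rule LIM_zero_cancel)
    moreover have "b \<in> V"
    proof -
      have "(norm (a - b))\<^sup>2 \<le> 16 * \<eta>"
      proof (rule moved_near[OF b, of F0])
        show "F0 \<subseteq> N" unfolding N_eq by (rule F0(2))
        show "\<beta> e = e" if "e \<in> F0" for e using that by (simp add: \<beta>_def)
      qed (rule small)
      also have "16 * \<eta> = (\<epsilon> / 2)\<^sup>2" by (simp add: \<eta>_def power2_eq_square)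
      finally have "norm (a - b) \<le> \<epsilon> / 2" by (rule power2_le_imp_le) (use \<epsilon> in simp)
      then have "b \<in> ball a \<epsilon>" using \<epsilon>(1) by (simp add: dist_norm)
      then show ?thesis using \<epsilon>(2) by blast
    qed
    ultimately show ?thesis using closed X(1) by blast
  qed
  ultimately show False by simp
qed

theorem theorem2p6:
  fixes a :: "'h::complex_hilbert_space hs_herm"
  assumes "separable_space (euclidean :: 'h topology)"
  shows "analytic_submanifold (unitary_orbit a) \<longleftrightarrow>
    finite_dim_csubspace (cstar_subalgebra hull {hs_op a, id_blinfun})"
proof -
  obtain E \<mu> where E: "eigenbasis a E \<mu>" using ex_eigenbasis by blast
  show ?thesis
    unfolding finite_dim_hull_iff_finite_spectrum[OF E]
    using analytic_submanifold_unitary_orbit[OF E] submanifold_imp_finite_spectrum[OF assms E] by blast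
qed

end
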